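(* Let $\mathbb{K}\in\{\mathbb{R},\mathbb{C}\}$ and let $A$ be a Mackey-complete continuous inverse algebra over $\mathbb{K}$. If $A$ is commutative or locally m-convex, then $A^\times$ is a regular Lie group in Milnor's sense.
   Context: All locally convex spaces are Hausdorff. A locally convex, unital, associative topological algebra $A$ over $\mathbb{K}\in\{\mathbb{R},\mathbb{C}\}$ (multiplication $A\times A\to A$ jointly continuous) is called a continuous inverse algebra if its group $A^\times$ of invertible elements is open in $A$ and the inversion map $A^\times\to A$, $x\mapsto x^{-1}$ is continuous. Then $A^\times$, as an open subset of $A$, is a ($\mathbb{K}$-analytic) Lie group modelled on $A$; its tangent bundle is identified with $A^\times\times A$ and its Lie algebra with $A$. A topological algebra $A$ is locally m-convex if its topology arises from a set of seminorms $q$ which are submultiplicative, i.e. $q(xy)\le q(x)q(y)$ for all $x,y\in A$. A locally convex space $E$ is Mackey-complete if every Lipschitz curve in $E$ admits a Riemann integral in $E$; equivalently, every Mackey-Cauchy sequence in $E$ converges, i.e. every sequence $(x_n)$ for which there are a bounded set $B\subseteq E$ and reals $r_{n,m}\ge 0$ with $x_n-x_m\in r_{n,m}B$ and $r_{n,m}\to 0$ as both $n,m\to\infty$. Here $\gamma\colon[0,1]\to E$ is a Lipschitz curve if $\{\frac{\gamma(t)-\gamma(s)}{t-s}: s\neq t\in[0,1]\}$ is bounded in $E$. Smooth maps: for locally convex spaces $E,F$ (regarded as real spaces), $U\subseteq E$ open and $r\in\mathbb{N}_0\cup\{\infty\}$, a map $f\colon U\to F$ is $C^r$ if it is continuous,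 the iterated directional derivatives $d^{(k)}f(x,y_1,\dots,y_k):=(D_{y_k}\cdots D_{y_1}f)(x)$ exist for all $k\in\mathbb{N}$ with $k\le r$, $x\in U$, $y_1,\dots,y_k\in E$, and the maps $d^{(k)}f\colon U\times E^k\to F$ are continuous. Smooth means $C^\infty$. For a locally convex space $E$, $C^\infty([0,1],E)$ is the space of smooth curves $[0,1]\to E$ with the locally convex topology given by the seminorms $\|\gamma\|_{C^k,p}:=\max_{0\le j\le k}\max_{t\in[0,1]}p(\gamma^{(j)}(t))$, for $k\in\mathbb{N}_0$ and continuous seminorms $p$ on $E$. Regularity: let $G$ be a Lie group modelled on a locally convex space, with identity element $1$ and Lie algebra $\mathfrak{g}=T_1G$; for $g\in G$, $v\in T_1G$ let $gv:=T_1(\lambda_g)(v)$, where $\lambda_g(x)=gx$. For a continuous map $\gamma\colon[0,1]\to\mathfrak{g}$ there is at most one $C^1$-map $\eta\colon[0,1]\to G$ with $\eta(0)=1$ and $\eta'(t)=\eta(t)\gamma(t)$ for all $t\in[0,1]$; if it exists, $\eta_\gamma:=\eta$ is called the evolution of $\gamma$. (For $G=A^\times$, $\eta\colon[0,1]\to A^\times\subseteq A$ is a $C^1$-curve and $\eta(t)\gamma(t)$ is the product in $A$.) $G$ is called regular (in Milnor's sense) if each $\gamma\in C^\infty([0,1],\mathfrak{g})$ has an evolution $\eta_\gamma$ and the map $\operatorname{evol}\colon C^\infty([0,1],\mathfrak{g})\to G$, $\gamma\mapsto\eta_\gamma(1)$ is smooth. *)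

theory Defs
  imports "HOL-Analysis.Analysis" "HOL-Library.Extended_Nat" "HOL-Algebra.Group"
begin

section \<open>The ground field\<close>

text \<open>Up to isomorphism of normed fields, the instances are exactly \<open>real\<close> and \<open>complex\<close>:
  a multiplicative norm on the complex numbers that extends the real absolute value is the usual
  modulus.\<close>

class real_or_complex_field = real_normed_field +
  assumes real_or_complex:
    "(\<forall>z. \<exists>a. z = a *\<^sub>R 1) \<or>
     (\<exists>i. i * i = - 1 \<and> (\<forall>z. \<exists>a b. z = a *\<^sub>R 1 + b *\<^sub>R i))"

instance real :: real_or_complex_field
  by standard auto

instance complex :: real_or_complex_field
proof
  have "\<exists>a b. z = a *\<^sub>R 1 + b *\<^sub>R \<i>" for z
    by (intro exI[of _ "Re z"] exI[of _ "Im z"]) (simp add: complex_eq_iff)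
  moreover have "\<i> * \<i> = - 1" by simp
  ultimately show "(\<forall>z::complex. \<exists>a. z = a *\<^sub>R 1) \<or>
      (\<exists>i::complex. i * i = - 1 \<and> (\<forall>z. \<exists>a b. z = a *\<^sub>R 1 + b *\<^sub>R i))"
    by blast
qed


section \<open>Locally convex spaces\<close>

definition seminorm ::
    "('k::real_normed_field \<Rightarrow> 'a \<Rightarrow> 'a) \<Rightarrow> ('a::ab_group_add \<Rightarrow> real) \<Rightarrow> bool"
  where "seminorm smul p \<longleftrightarrow>
    (\<forall>x y. p (x + y) \<le> p x + p y) \<and> (\<forall>c x. p (smul c x) = norm c * p x)"

text \<open>Real Hausdorff locally convex spaces. Continuity of the scalar multiplication is not listed
  because it follows from the other axioms.\<close>

class locally_convex_space = real_vector + t2_space + topological_ab_group_add +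
  assumes locally_convex:
    "open U \<Longrightarrow> 0 \<in> U \<Longrightarrow>
      \<exists>p :: 'a \<Rightarrow> real. (\<forall>x y. p (x + y) \<le> p x + p y) \<and> (\<forall>c x. p (c *\<^sub>R x) = \<bar>c\<bar> * p x) \<and>
        (\<forall>x. filterlim p (nhds (p x)) (nhds x)) \<and> {x. p x < 1} \<subseteq> U"

lemma locally_convex_iff:
  fixes U :: "'a::{real_vector, topological_space} set"
  shows "(\<exists>p :: 'a \<Rightarrow> real. (\<forall>x y. p (x + y) \<le> p x + p y) \<and>
      (\<forall>c x. p (c *\<^sub>R x) = \<bar>c\<bar> * p x) \<and> (\<forall>x. filterlim p (nhds (p x)) (nhds x)) \<and>
      {x. p x < 1} \<subseteq> U) \<longleftrightarrow>
    (\<exists>p. seminorm scaleR p \<and> continuous_on UNIV p \<and> {x. p x < 1} \<subseteq> U)"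
  by (simp add: seminorm_def continuous_on_def tendsto_at_iff_tendsto_nhds)

lemma continuous_seminorm_ball:
  fixes U :: "'a::locally_convex_space set"
  shows "open U \<Longrightarrow> 0 \<in> U \<Longrightarrow>
    \<exists>p. seminorm scaleR p \<and> continuous_on UNIV p \<and> {x. p x < 1} \<subseteq> U"
  using locally_convex[of U] by (simp only: locally_convex_iff)

definition continuous_seminorm :: "('a::locally_convex_space \<Rightarrow> real) \<Rightarrow> bool"
  where "continuous_seminorm p \<longleftrightarrow> seminorm scaleR p \<and> continuous_on UNIV p"

lemma seminorm_add: "seminorm smul p \<Longrightarrow> p (x + y) \<le> p x + p y"
  by (simp add: seminorm_def)

lemma seminorm_scaleR:
  fixes p :: "'a::real_vector \<Rightarrow> real"
  shows "seminorm scaleR p \<Longrightarrow> p (c *\<^sub>R x) = \<bar>c\<bar> * p x"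
  by (simp add: seminorm_def)

lemma seminorm_zero:
  fixes p :: "'a::real_vector \<Rightarrow> real"
  shows "seminorm scaleR p \<Longrightarrow> p 0 = 0"
  using seminorm_scaleR[of p 0 0] by simp

lemma seminorm_minus:
  fixes p :: "'a::real_vector \<Rightarrow> real"
  shows "seminorm scaleR p \<Longrightarrow> p (- x) = p x"
  using seminorm_scaleR[of p "-1" x] by simp

lemma seminorm_nonneg:
  fixes p :: "'a::real_vector \<Rightarrow> real"
  shows "seminorm scaleR p \<Longrightarrow> 0 \<le> p x"
  using seminorm_add[of scaleR p x "- x"] by (simp add: seminorm_zero seminorm_minus)

lemma seminorm_sum2:
  fixes p q :: "'a::real_vector \<Rightarrow> real"
  shows "seminorm scaleR p \<Longrightarrow> seminorm scaleR q \<Longrightarrow> seminorm scaleR (\<lambda>x. p x + q x)"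
  unfolding seminorm_def
proof (intro conjI allI; elim conjE)
  fix x y :: 'a
  assume "\<forall>x y. p (x + y) \<le> p x + p y" "\<forall>x y. q (x + y) \<le> q x + q y"
  then have "p (x + y) \<le> p x + p y" "q (x + y) \<le> q x + q y" by blast+
  then show "p (x + y) + q (x + y) \<le> p x + q x + (p y + q y)" by linarith
qed (simp add: distrib_left)

instance real_normed_vector \<subseteq> locally_convex_space
proof
  fix U :: "'a set" assume "open U" "0 \<in> U"
  then obtain e where e: "e > 0" "ball 0 e \<subseteq> U"
    using open_contains_ball by blast
  show "\<exists>p :: 'a \<Rightarrow> real. (\<forall>x y. p (x + y) \<le> p x + p y) \<and>
      (\<forall>c x. p (c *\<^sub>R x) = \<bar>c\<bar> * p x) \<and> (\<forall>x. filterlim p (nhds (p x)) (nhds x)) \<and>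
      {x. p x < 1} \<subseteq> U"
    unfolding locally_convex_iff
  proof (intro exI[of _ "\<lambda>x. norm x / e"] conjI)
    show "seminorm scaleR (\<lambda>x::'a. norm x / e)"
      using e unfolding seminorm_def
      by (auto simp: add_divide_distrib[symmetric] divide_right_mono norm_triangle_ineq)
    show "continuous_on UNIV (\<lambda>x::'a. norm x / e)" using e by (intro continuous_intros) auto
    show "{x. norm x / e < 1} \<subseteq> U" using e by (auto simp: subset_iff)
  qed
qed

instance prod :: (topological_monoid_add, topological_monoid_add) topological_monoid_add
proof
  fix a b :: "'a \<times> 'b"
  have "((\<lambda>x. fst x + snd x) \<longlongrightarrow> a + b) (nhds (a, b))"
  proof -
    have id: "((\<lambda>x. x) \<longlongrightarrow> (a, b)) (nhds (a, b))" by (rule filterlim_ident)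
    have "((\<lambda>x. (fst (fst x) + fst (snd x), snd (fst x) + snd (snd x))) \<longlongrightarrow>
        (fst a + fst b, snd a + snd b)) (nhds (a, b))"
      using tendsto_fst[OF id] tendsto_snd[OF id] by (auto intro!: tendsto_intros)
    then show ?thesis by (simp add: plus_prod_def)
  qed
  then show "((\<lambda>x. fst x + snd x) \<longlongrightarrow> a + b) (nhds a \<times>\<^sub>F nhds b)"
    by (simp add: nhds_prod)
qed

instance prod :: (topological_comm_monoid_add, topological_comm_monoid_add)
  topological_comm_monoid_add ..

instance prod :: (topological_group_add, topological_group_add) topological_group_add
proof
  fix a :: "'a \<times> 'b"
  have id: "((\<lambda>x. x) \<longlongrightarrow> a) (nhds a)" by (rule filterlim_ident)
  have "((\<lambda>x. (- fst x, - snd x)) \<longlongrightarrow> (- fst a, - snd a)) (nhds a)"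
    by (intro tendsto_intros id)
  then show "(uminus \<longlongrightarrow> - a) (nhds a)" by (simp add: uminus_prod_def[abs_def])
qed

instance prod :: (topological_ab_group_add, topological_ab_group_add) topological_ab_group_add ..

instance prod :: (locally_convex_space, locally_convex_space) locally_convex_space
proof
  fix U :: "('a \<times> 'b) set" assume "open U" "0 \<in> U"
  then obtain A B where AB: "open A" "open B" "0 \<in> A" "0 \<in> B" "A \<times> B \<subseteq> U"
    unfolding zero_prod_def using open_prod_elim[of U "(0, 0)"] by (metis mem_Times_iff fst_conv snd_conv)
  obtain p where p: "seminorm scaleR p" "continuous_on UNIV p" "{x. p x < 1} \<subseteq> A"
    using continuous_seminorm_ball AB by blast
  obtain q where q: "seminorm scaleR q" "continuous_on UNIV q" "{x. q x < 1} \<subseteq> B"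
    using continuous_seminorm_ball AB by blast
  let ?r = "\<lambda>x::'a \<times> 'b. p (fst x) + q (snd x)"
  have "seminorm scaleR (\<lambda>x::'a \<times> 'b. p (fst x))" "seminorm scaleR (\<lambda>x::'a \<times> 'b. q (snd x))"
    using p(1) q(1) by (simp_all add: seminorm_def)
  then have "seminorm scaleR ?r" by (rule seminorm_sum2)
  moreover have "continuous_on UNIV ?r"
    by (intro continuous_on_add continuous_on_compose2[OF p(2)] continuous_on_compose2[OF q(2)]
        continuous_on_fst continuous_on_snd continuous_on_id) auto
  moreover have "{x. ?r x < 1} \<subseteq> U"
  proof
    fix x assume "x \<in> {x. ?r x < 1}"
    then have "p (fst x) < 1" "q (snd x) < 1"
      using seminorm_nonneg[OF p(1), of "fst x"] seminorm_nonneg[OF q(1), of "snd x"] by auto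
    then have "x \<in> A \<times> B" using p q by (auto simp: mem_Times_iff)
    then show "x \<in> U" using AB by auto
  qed
  ultimately show "\<exists>p :: ('a \<times> 'b) \<Rightarrow> real. (\<forall>x y. p (x + y) \<le> p x + p y) \<and>
      (\<forall>c x. p (c *\<^sub>R x) = \<bar>c\<bar> * p x) \<and> (\<forall>x. filterlim p (nhds (p x)) (nhds x)) \<and>
      {x. p x < 1} \<subseteq> U"
    unfolding locally_convex_iff by (intro exI[of _ ?r] conjI)
qed


section \<open>Differentiable maps on open sets\<close>

definition has_dir_deriv ::
    "('e::locally_convex_space \<Rightarrow> 'f::locally_convex_space) \<Rightarrow> 'f \<Rightarrow> 'e \<Rightarrow> 'e \<Rightarrow> bool"
  where "has_dir_deriv f l y x \<longleftrightarrow> ((\<lambda>t. (f (x + t *\<^sub>R y) - f x) /\<^sub>R t) \<longlongrightarrow> l) (at (0::real))"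

definition dir_deriv ::
    "('e::locally_convex_space \<Rightarrow> 'f::locally_convex_space) \<Rightarrow> 'e \<Rightarrow> 'e \<Rightarrow> 'f"
  where "dir_deriv f y x = Lim (at (0::real)) (\<lambda>t. (f (x + t *\<^sub>R y) - f x) /\<^sub>R t)"

text \<open>The directions \<open>y\<^sub>1, \<dots>, y\<^sub>k\<close> are \<open>y 0, \<dots>, y (k - 1)\<close>.\<close>

primrec iter_dir_deriv ::
    "nat \<Rightarrow> ('e::locally_convex_space \<Rightarrow> 'f::locally_convex_space) \<Rightarrow> 'e \<Rightarrow> (nat \<Rightarrow> 'e) \<Rightarrow> 'f"
  where
    "iter_dir_deriv 0 f x y = f x"
  | "iter_dir_deriv (Suc k) f x y = dir_deriv (\<lambda>z. iter_dir_deriv k f z y) (y k) x"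

definition Cr_on ::
    "enat \<Rightarrow> 'e::locally_convex_space set \<Rightarrow> ('e \<Rightarrow> 'f::locally_convex_space) \<Rightarrow> bool"
  where "Cr_on r U f \<longleftrightarrow>
    open U \<and> continuous_on U f \<and>
    (\<forall>k. enat (Suc k) \<le> r \<longrightarrow>
      (\<forall>x\<in>U. \<forall>y. \<exists>l. has_dir_deriv (\<lambda>z. iter_dir_deriv k f z y) l (y k) x)) \<and>
    (\<forall>k. enat k \<le> r \<longrightarrow>
      continuous_map (prod_topology (top_of_set U) (product_topology (\<lambda>_. euclidean) {..<k}))
        euclidean (\<lambda>(x, y). iter_dir_deriv k f x y))"

abbreviation smooth_map_on ::
    "'e::locally_convex_space set \<Rightarrow> ('e \<Rightarrow> 'f::locally_convex_space) \<Rightarrow> bool"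
  where "smooth_map_on \<equiv> Cr_on \<infinity>"


section \<open>Curves on the unit interval\<close>

text \<open>A curve is a function on the real line of which only the values on \<open>{0..1}\<close> matter;
  derivatives at the end points are one-sided.\<close>

definition has_curve_deriv :: "(real \<Rightarrow> 'e::locally_convex_space) \<Rightarrow> 'e \<Rightarrow> real \<Rightarrow> bool"
  where "has_curve_deriv \<gamma> v t \<longleftrightarrow>
    ((\<lambda>s. (\<gamma> s - \<gamma> t) /\<^sub>R (s - t)) \<longlongrightarrow> v) (at t within {0..1})"

definition curve_deriv :: "(real \<Rightarrow> 'e::locally_convex_space) \<Rightarrow> real \<Rightarrow> 'e"
  where "curve_deriv \<gamma> t = Lim (at t within {0..1}) (\<lambda>s. (\<gamma> s - \<gamma> t) /\<^sub>R (s - t))"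

definition Cr_curve :: "enat \<Rightarrow> (real \<Rightarrow> 'e::locally_convex_space) \<Rightarrow> bool"
  where "Cr_curve r \<gamma> \<longleftrightarrow>
    (\<forall>j. enat (Suc j) \<le> r \<longrightarrow> (\<forall>t\<in>{0..1}. \<exists>v. has_curve_deriv ((curve_deriv ^^ j) \<gamma>) v t)) \<and>
    (\<forall>j. enat j \<le> r \<longrightarrow> continuous_on {0..1} ((curve_deriv ^^ j) \<gamma>))"

text \<open>Elements of \<open>C\<^sup>\<infinity>([0,1], E)\<close>, each represented by its extension by \<open>0\<close>.\<close>

definition smooth_curves :: "(real \<Rightarrow> 'e::locally_convex_space) set"
  where "smooth_curves = {\<gamma>. Cr_curve \<infinity> \<gamma> \<and> (\<forall>t. t \<notin> {0..1} \<longrightarrow> \<gamma> t = 0)}"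

lemma at_within_unit_interval_neq_bot:
  "t \<in> {0..1} \<Longrightarrow> at t within {0..1::real} \<noteq> bot"
  by (simp add: trivial_limit_within islimpt_Icc)

lemma curve_deriv_eqI: "t \<in> {0..1} \<Longrightarrow> has_curve_deriv \<gamma> v t \<Longrightarrow> curve_deriv \<gamma> t = v"
  unfolding has_curve_deriv_def curve_deriv_def
  by (rule tendsto_Lim[OF at_within_unit_interval_neq_bot])

lemma has_curve_deriv_cong:
  assumes "\<And>s. s \<in> {0..1} \<Longrightarrow> \<gamma> s = \<delta> s" "t \<in> {0..1}"
  shows "has_curve_deriv \<gamma> v t \<longleftrightarrow> has_curve_deriv \<delta> v t"
  unfolding has_curve_deriv_def
  by (intro tendsto_cong) (simp add: eventually_at_filter assms del: atLeastAtMost_iff)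

lemma tendsto_scaleR_lc:
  fixes f :: "'b \<Rightarrow> 'e::locally_convex_space"
  assumes "(f \<longlongrightarrow> v) F"
  shows "((\<lambda>x. c *\<^sub>R f x) \<longlongrightarrow> c *\<^sub>R v) F"
proof (rule topological_tendstoI)
  fix S assume S: "open S" "c *\<^sub>R v \<in> S"
  have "open ((\<lambda>x. x + c *\<^sub>R v) -` S)"
    by (intro open_vimage S continuous_on_add continuous_on_id continuous_on_const)
  moreover have "0 \<in> (\<lambda>x. x + c *\<^sub>R v) -` S" using S by simp
  ultimately obtain p where p: "seminorm scaleR p" "continuous_on UNIV p"
    "{x. p x < 1} \<subseteq> (\<lambda>x. x + c *\<^sub>R v) -` S"
    using continuous_seminorm_ball by blast
  have "((\<lambda>x. f x - v) \<longlongrightarrow> v - v) F"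
    using tendsto_add[OF assms tendsto_const[of "- v"]] by simp
  then have "((\<lambda>x. p (f x - v)) \<longlongrightarrow> p 0) F"
    by (intro continuous_on_tendsto_compose[OF p(2)]) simp_all
  then have "((\<lambda>x. \<bar>c\<bar> * p (f x - v)) \<longlongrightarrow> \<bar>c\<bar> * 0) F"
    by (intro tendsto_mult tendsto_const) (simp add: seminorm_zero[OF p(1)])
  then have "eventually (\<lambda>x. \<bar>c\<bar> * p (f x - v) < 1) F"
    by (rule order_tendstoD) simp
  then show "eventually (\<lambda>x. c *\<^sub>R f x \<in> S) F"
  proof eventually_elim
    case (elim x)
    then have "p (c *\<^sub>R f x - c *\<^sub>R v) < 1"
      using seminorm_scaleR[OF p(1), of c "f x - v"] by (simp add: scaleR_diff_right)
    then show ?case using p(3) by auto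
  qed
qed

lemma has_curve_deriv_lincomb:
  assumes "has_curve_deriv \<gamma> v t" "has_curve_deriv \<delta> w t"
  shows "has_curve_deriv (\<lambda>s. a *\<^sub>R \<gamma> s + b *\<^sub>R \<delta> s) (a *\<^sub>R v + b *\<^sub>R w) t"
proof -
  have "((\<lambda>s. a *\<^sub>R ((\<gamma> s - \<gamma> t) /\<^sub>R (s - t)) + b *\<^sub>R ((\<delta> s - \<delta> t) /\<^sub>R (s - t))) \<longlongrightarrow>
      a *\<^sub>R v + b *\<^sub>R w) (at t within {0..1})"
    using assms unfolding has_curve_deriv_def by (intro tendsto_add tendsto_scaleR_lc)
  then show ?thesis
    unfolding has_curve_deriv_def by (simp add: algebra_simps)
qed

lemma Cr_curve_has_curve_deriv:
  assumes "Cr_curve \<infinity> \<gamma>" "t \<in> {0..1}"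
  shows "has_curve_deriv ((curve_deriv ^^ j) \<gamma>) ((curve_deriv ^^ Suc j) \<gamma> t) t"
proof -
  obtain v where v: "has_curve_deriv ((curve_deriv ^^ j) \<gamma>) v t"
    using assms unfolding Cr_curve_def by (meson enat_ord_code(3))
  moreover have "(curve_deriv ^^ Suc j) \<gamma> t = v"
    using curve_deriv_eqI[OF assms(2) v] by simp
  ultimately show ?thesis by simp
qed

lemma funpow_curve_deriv_lincomb:
  assumes "Cr_curve \<infinity> \<gamma>" "Cr_curve \<infinity> \<delta>" "t \<in> {0..1}"
  shows "(curve_deriv ^^ j) (\<lambda>s. a *\<^sub>R \<gamma> s + b *\<^sub>R \<delta> s) t =
    a *\<^sub>R (curve_deriv ^^ j) \<gamma> t + b *\<^sub>R (curve_deriv ^^ j) \<delta> t"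
  using assms(3)
proof (induction j arbitrary: t)
  case (Suc j)
  have "has_curve_deriv ((curve_deriv ^^ j) (\<lambda>s. a *\<^sub>R \<gamma> s + b *\<^sub>R \<delta> s))
      (a *\<^sub>R (curve_deriv ^^ Suc j) \<gamma> t + b *\<^sub>R (curve_deriv ^^ Suc j) \<delta> t) t"
  proof (subst has_curve_deriv_cong)
    show "(curve_deriv ^^ j) (\<lambda>s. a *\<^sub>R \<gamma> s + b *\<^sub>R \<delta> s) s =
        a *\<^sub>R (curve_deriv ^^ j) \<gamma> s + b *\<^sub>R (curve_deriv ^^ j) \<delta> s" if "s \<in> {0..1}" for s
      by (rule Suc.IH[OF that])
  qed (intro has_curve_deriv_lincomb Cr_curve_has_curve_deriv assms Suc.prems)+
  then show ?case using curve_deriv_eqI[OF Suc.prems] by simp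
qed simp

lemma Cr_curve_lincomb:
  assumes "Cr_curve \<infinity> \<gamma>" "Cr_curve \<infinity> \<delta>"
  shows "Cr_curve \<infinity> (\<lambda>s. a *\<^sub>R \<gamma> s + b *\<^sub>R \<delta> s)"
  unfolding Cr_curve_def
proof (intro conjI allI impI ballI)
  fix j :: nat and t :: real assume t: "t \<in> {0..1}"
  have "has_curve_deriv ((curve_deriv ^^ j) (\<lambda>s. a *\<^sub>R \<gamma> s + b *\<^sub>R \<delta> s))
      (a *\<^sub>R (curve_deriv ^^ Suc j) \<gamma> t + b *\<^sub>R (curve_deriv ^^ Suc j) \<delta> t) t"
  proof (subst has_curve_deriv_cong)
    show "(curve_deriv ^^ j) (\<lambda>s. a *\<^sub>R \<gamma> s + b *\<^sub>R \<delta> s) s =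
        a *\<^sub>R (curve_deriv ^^ j) \<gamma> s + b *\<^sub>R (curve_deriv ^^ j) \<delta> s" if "s \<in> {0..1}" for s
      by (rule funpow_curve_deriv_lincomb[OF assms that])
  qed (intro has_curve_deriv_lincomb Cr_curve_has_curve_deriv assms t)+
  then show "\<exists>v. has_curve_deriv ((curve_deriv ^^ j) (\<lambda>s. a *\<^sub>R \<gamma> s + b *\<^sub>R \<delta> s)) v t" ..
next
  fix j :: nat
  have "continuous_on {0..1} (\<lambda>t. a *\<^sub>R (curve_deriv ^^ j) \<gamma> t + b *\<^sub>R (curve_deriv ^^ j) \<delta> t)"
    using assms unfolding Cr_curve_def continuous_on_def
    by (auto intro!: tendsto_add tendsto_scaleR_lc)
  then show "continuous_on {0..1} ((curve_deriv ^^ j) (\<lambda>s. a *\<^sub>R \<gamma> s + b *\<^sub>R \<delta> s))"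
    by (rule continuous_on_eq) (simp add: funpow_curve_deriv_lincomb[OF assms] del: atLeastAtMost_iff)
qed

lemma funpow_curve_deriv_zero:
  "t \<in> {0..1} \<Longrightarrow> (curve_deriv ^^ j) (\<lambda>_. 0::'e::locally_convex_space) t = 0"
proof (induction j arbitrary: t)
  case (Suc j)
  have "has_curve_deriv ((curve_deriv ^^ j) (\<lambda>_. 0::'e)) 0 t"
    using has_curve_deriv_cong[of "(curve_deriv ^^ j) (\<lambda>_. 0::'e)" "\<lambda>_. 0" t 0] Suc
    by (simp add: has_curve_deriv_def)
  then show ?case using curve_deriv_eqI[OF Suc.prems] by simp
qed simp

lemma Cr_curve_zero: "Cr_curve \<infinity> (\<lambda>_. 0::'e::locally_convex_space)"
  unfolding Cr_curve_def
proof (intro conjI allI impI ballI)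
  fix j :: nat and t :: real assume "t \<in> {0..1}"
  then have "has_curve_deriv ((curve_deriv ^^ j) (\<lambda>_. 0::'e)) 0 t"
  proof (subst has_curve_deriv_cong)
    show "(curve_deriv ^^ j) (\<lambda>_. 0::'e) s = 0" if "s \<in> {0..1}" for s
      by (rule funpow_curve_deriv_zero[OF that])
  qed (auto simp: has_curve_deriv_def)
  then show "\<exists>v. has_curve_deriv ((curve_deriv ^^ j) (\<lambda>_. 0::'e)) v t" ..
next
  fix j :: nat
  show "continuous_on {0..1} ((curve_deriv ^^ j) (\<lambda>_. 0::'e))"
    by (rule continuous_on_eq[OF continuous_on_const[of _ 0]])
      (simp add: funpow_curve_deriv_zero del: atLeastAtMost_iff)
qed

lemma smooth_curves_lincomb:
  "\<gamma> \<in> smooth_curves \<Longrightarrow> \<delta> \<in> smooth_curves \<Longrightarrow> (\<lambda>s. a *\<^sub>R \<gamma> s + b *\<^sub>R \<delta> s) \<in> smooth_curves"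
  by (simp add: smooth_curves_def Cr_curve_lincomb)

typedef (overloaded) 'e smooth_curve = "smooth_curves :: (real \<Rightarrow> 'e::locally_convex_space) set"
  morphisms curve_at Abs_smooth_curve
  by (rule exI[of _ "\<lambda>_. 0"]) (simp add: smooth_curves_def Cr_curve_zero)

setup_lifting type_definition_smooth_curve

instantiation smooth_curve :: (locally_convex_space) real_vector
begin

lift_definition zero_smooth_curve :: "'a smooth_curve" is "\<lambda>_. 0"
  by (simp add: smooth_curves_def Cr_curve_zero)

lift_definition plus_smooth_curve :: "'a smooth_curve \<Rightarrow> 'a smooth_curve \<Rightarrow> 'a smooth_curve"
  is "\<lambda>\<gamma> \<delta> t. \<gamma> t + \<delta> t"
  using smooth_curves_lincomb[of _ _ 1 1] by simp

lift_definition minus_smooth_curve :: "'a smooth_curve \<Rightarrow> 'a smooth_curve \<Rightarrow> 'a smooth_curve"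
  is "\<lambda>\<gamma> \<delta> t. \<gamma> t - \<delta> t"
  using smooth_curves_lincomb[of _ _ 1 "-1"] by simp

lift_definition uminus_smooth_curve :: "'a smooth_curve \<Rightarrow> 'a smooth_curve"
  is "\<lambda>\<gamma> t. - \<gamma> t"
  subgoal for \<gamma> using smooth_curves_lincomb[of \<gamma> \<gamma> "-1" 0] by simp
  done

lift_definition scaleR_smooth_curve :: "real \<Rightarrow> 'a smooth_curve \<Rightarrow> 'a smooth_curve"
  is "\<lambda>c \<gamma> t. c *\<^sub>R \<gamma> t"
  subgoal for c \<gamma> using smooth_curves_lincomb[of \<gamma> \<gamma> c 0] by simp
  done

instance
  by standard (transfer; simp add: algebra_simps)+

end

text \<open>The seminorms \<open>\<parallel>\<gamma>\<parallel>\<^bsub>C\<^sup>k,p\<^esub>\<close>. The supremum over \<open>t\<close> is attained, so it is the maximum.\<close>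

definition Ck_seminorm ::
    "nat \<Rightarrow> ('e::locally_convex_space \<Rightarrow> real) \<Rightarrow> 'e smooth_curve \<Rightarrow> real"
  where "Ck_seminorm k p \<gamma> =
    (MAX j\<in>{..k}. SUP t\<in>{0..1}. p ((curve_deriv ^^ j) (curve_at \<gamma>) t))"

lemma Cr_curve_curve_at: "Cr_curve \<infinity> (curve_at \<gamma>)"
  using curve_at[of \<gamma>] by (simp add: smooth_curves_def)

lemma Ck_seminorm_bdd:
  assumes "continuous_seminorm p"
  shows "bdd_above ((\<lambda>t. p ((curve_deriv ^^ j) (curve_at \<gamma>) t)) ` {0..1})"
proof -
  have "continuous_on {0..1} ((curve_deriv ^^ j) (curve_at \<gamma>))"
    using Cr_curve_curve_at[of \<gamma>] unfolding Cr_curve_def by simp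
  then have "continuous_on {0..1} (\<lambda>t. p ((curve_deriv ^^ j) (curve_at \<gamma>) t))"
    using assms continuous_on_compose2 unfolding continuous_seminorm_def by blast
  then have "compact ((\<lambda>t. p ((curve_deriv ^^ j) (curve_at \<gamma>) t)) ` {0..1})"
    by (intro compact_continuous_image) auto
  then show ?thesis by (simp add: compact_imp_bounded bounded_imp_bdd_above)
qed

lemma Ck_seminorm_le_iff:
  assumes "continuous_seminorm p"
  shows "Ck_seminorm k p \<gamma> \<le> c \<longleftrightarrow>
    (\<forall>j\<le>k. \<forall>t\<in>{0..1}. p ((curve_deriv ^^ j) (curve_at \<gamma>) t) \<le> c)"
  unfolding Ck_seminorm_def
  by (auto simp: cSUP_le_iff[OF _ Ck_seminorm_bdd[OF assms]])

lemma Ck_seminorm_upper: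
  assumes "continuous_seminorm p" "j \<le> k" "t \<in> {0..1}"
  shows "p ((curve_deriv ^^ j) (curve_at \<gamma>) t) \<le> Ck_seminorm k p \<gamma>"
  using Ck_seminorm_le_iff[OF assms(1), of k \<gamma> "Ck_seminorm k p \<gamma>"] assms by auto

lemma Ck_seminorm_nonneg:
  assumes "continuous_seminorm p"
  shows "0 \<le> Ck_seminorm k p \<gamma>"
proof -
  have "0 \<le> p ((curve_deriv ^^ 0) (curve_at \<gamma>) 0)"
    using assms by (intro seminorm_nonneg) (simp add: continuous_seminorm_def)
  also have "\<dots> \<le> Ck_seminorm k p \<gamma>"
    by (intro Ck_seminorm_upper assms) auto
  finally show ?thesis .
qed

lemma Ck_seminorm_seminorm:
  assumes "continuous_seminorm p"
  shows "seminorm scaleR (Ck_seminorm k p)"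
proof -
  have p: "seminorm scaleR p" using assms by (simp add: continuous_seminorm_def)
  have le: "Ck_seminorm k p (c *\<^sub>R \<gamma>) \<le> \<bar>c\<bar> * Ck_seminorm k p \<gamma>" for c and \<gamma> :: "'a smooth_curve"
  proof -
    have eq: "curve_at (c *\<^sub>R \<gamma>) = (\<lambda>s. c *\<^sub>R curve_at \<gamma> s + 0 *\<^sub>R curve_at \<gamma> s)"
      by (simp add: scaleR_smooth_curve.rep_eq)
    show ?thesis
      unfolding Ck_seminorm_le_iff[OF assms] eq
    proof (intro allI impI ballI)
      fix j and t :: real assume jt: "j \<le> k" "t \<in> {0..1}"
      have "p (c *\<^sub>R (curve_deriv ^^ j) (curve_at \<gamma>) t) \<le> \<bar>c\<bar> * Ck_seminorm k p \<gamma>"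
        unfolding seminorm_scaleR[OF p] by (intro mult_left_mono Ck_seminorm_upper assms jt) simp
      then show "p ((curve_deriv ^^ j) (\<lambda>s. c *\<^sub>R curve_at \<gamma> s + 0 *\<^sub>R curve_at \<gamma> s) t) \<le>
          \<bar>c\<bar> * Ck_seminorm k p \<gamma>"
        unfolding funpow_curve_deriv_lincomb[OF Cr_curve_curve_at Cr_curve_curve_at jt(2)] by simp
    qed
  qed
  have "Ck_seminorm k p (\<gamma> + \<delta>) \<le> Ck_seminorm k p \<gamma> + Ck_seminorm k p \<delta>"
    for \<gamma> \<delta> :: "'a smooth_curve"
  proof -
    have eq: "curve_at (\<gamma> + \<delta>) = (\<lambda>s. 1 *\<^sub>R curve_at \<gamma> s + 1 *\<^sub>R curve_at \<delta> s)"
      by (simp add: plus_smooth_curve.rep_eq)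
    show ?thesis
      unfolding Ck_seminorm_le_iff[OF assms] eq
    proof (intro allI impI ballI)
      fix j and t :: real assume jt: "j \<le> k" "t \<in> {0..1}"
      have "p ((curve_deriv ^^ j) (curve_at \<gamma>) t + (curve_deriv ^^ j) (curve_at \<delta>) t) \<le>
          Ck_seminorm k p \<gamma> + Ck_seminorm k p \<delta>"
        by (rule order_trans[OF seminorm_add[OF p]])
          (intro add_mono Ck_seminorm_upper assms jt)
      then show "p ((curve_deriv ^^ j) (\<lambda>s. 1 *\<^sub>R curve_at \<gamma> s + 1 *\<^sub>R curve_at \<delta> s) t) \<le>
          Ck_seminorm k p \<gamma> + Ck_seminorm k p \<delta>"
        unfolding funpow_curve_deriv_lincomb[OF Cr_curve_curve_at Cr_curve_curve_at jt(2)] by simp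
    qed
  qed
  moreover have "Ck_seminorm k p (c *\<^sub>R \<gamma>) = \<bar>c\<bar> * Ck_seminorm k p \<gamma>"
    for c and \<gamma> :: "'a smooth_curve"
  proof (cases "c = 0")
    case True
    then show ?thesis using le[of 0 \<gamma>] Ck_seminorm_nonneg[OF assms, of k 0] by simp
  next
    case False
    have "Ck_seminorm k p \<gamma> \<le> \<bar>inverse c\<bar> * Ck_seminorm k p (c *\<^sub>R \<gamma>)"
      using le[of "inverse c" "c *\<^sub>R \<gamma>"] False by simp
    then have "\<bar>c\<bar> * Ck_seminorm k p \<gamma> \<le> Ck_seminorm k p (c *\<^sub>R \<gamma>)"
      using False by (simp add: field_simps)
    then show ?thesis using le[of c \<gamma>] by simp
  qed
  ultimately show ?thesis by (simp add: seminorm_def)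
qed

lemma Ck_seminorm_mono:
  assumes "continuous_seminorm p" "continuous_seminorm q" "k \<le> l" "\<And>x. p x \<le> q x"
  shows "Ck_seminorm k p \<gamma> \<le> Ck_seminorm l q \<gamma>"
  unfolding Ck_seminorm_le_iff[OF assms(1)]
proof (intro allI impI ballI)
  fix j and t :: real assume jt: "j \<le> k" "t \<in> {0..1}"
  have "p ((curve_deriv ^^ j) (curve_at \<gamma>) t) \<le> q ((curve_deriv ^^ j) (curve_at \<gamma>) t)"
    by (rule assms(4))
  also have "\<dots> \<le> Ck_seminorm l q \<gamma>"
    by (rule Ck_seminorm_upper[OF assms(2) order_trans[OF jt(1) assms(3)] jt(2)])
  finally show "p ((curve_deriv ^^ j) (curve_at \<gamma>) t) \<le> Ck_seminorm l q \<gamma>" .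
qed

lemma continuous_seminorm_sum2:
  "continuous_seminorm p \<Longrightarrow> continuous_seminorm q \<Longrightarrow> continuous_seminorm (\<lambda>x. p x + q x)"
  unfolding continuous_seminorm_def by (simp add: seminorm_sum2 continuous_on_add)

instantiation smooth_curve :: (locally_convex_space) topological_space
begin

definition open_smooth_curve :: "'a smooth_curve set \<Rightarrow> bool"
  where "open_smooth_curve U \<longleftrightarrow>
    (\<forall>\<gamma>\<in>U. \<exists>k p \<epsilon>. continuous_seminorm p \<and> \<epsilon> > 0 \<and> {\<delta>. Ck_seminorm k p (\<delta> - \<gamma>) < \<epsilon>} \<subseteq> U)"

instance
proof
  show "open (UNIV :: 'a smooth_curve set)"
    unfolding open_smooth_curve_def
    by (intro ballI exI[of _ 0] exI[of _ "\<lambda>_. 0"] exI[of _ 1])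
      (simp add: continuous_seminorm_def seminorm_def)
next
  fix S T :: "'a smooth_curve set"
  assume S: "open S" and T: "open T"
  show "open (S \<inter> T)"
    unfolding open_smooth_curve_def
  proof
    fix \<gamma> assume "\<gamma> \<in> S \<inter> T"
    then have "\<gamma> \<in> S" "\<gamma> \<in> T" by simp_all
    from bspec[OF S[unfolded open_smooth_curve_def] this(1)] obtain k p e where
      p: "continuous_seminorm p" "e > 0" "{\<delta>. Ck_seminorm k p (\<delta> - \<gamma>) < e} \<subseteq> S"
      by (elim exE conjE)
    from bspec[OF T[unfolded open_smooth_curve_def] \<open>\<gamma> \<in> T\<close>] obtain l q f where
      q: "continuous_seminorm q" "f > 0" "{\<delta>. Ck_seminorm l q (\<delta> - \<gamma>) < f} \<subseteq> T"
      by (elim exE conjE)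
    let ?r = "\<lambda>x. p x + q x"
    have r: "continuous_seminorm ?r" by (rule continuous_seminorm_sum2[OF p(1) q(1)])
    have nn: "p x \<le> ?r x" "q x \<le> ?r x" for x
      using p(1) q(1) seminorm_nonneg[of q x] seminorm_nonneg[of p x]
      by (simp_all add: continuous_seminorm_def)
    have "{\<delta>. Ck_seminorm (max k l) ?r (\<delta> - \<gamma>) < min e f} \<subseteq> S \<inter> T"
    proof
      fix \<delta> assume "\<delta> \<in> {\<delta>. Ck_seminorm (max k l) ?r (\<delta> - \<gamma>) < min e f}"
      then have "Ck_seminorm k p (\<delta> - \<gamma>) < e" "Ck_seminorm l q (\<delta> - \<gamma>) < f"
        using Ck_seminorm_mono[OF p(1) r _ nn(1), of k "max k l" "\<delta> - \<gamma>"]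
          Ck_seminorm_mono[OF q(1) r _ nn(2), of l "max k l" "\<delta> - \<gamma>"] by simp_all
      then show "\<delta> \<in> S \<inter> T" using p(3) q(3) by blast
    qed
    moreover have "0 < min e f" using p(2) q(2) by simp
    ultimately show "\<exists>k p \<epsilon>. continuous_seminorm p \<and> \<epsilon> > 0 \<and>
        {\<delta>. Ck_seminorm k p (\<delta> - \<gamma>) < \<epsilon>} \<subseteq> S \<inter> T"
      using r by (intro exI conjI)
  qed
next
  fix K :: "'a smooth_curve set set"
  assume K: "\<forall>S\<in>K. open S"
  show "open (\<Union>K)"
    unfolding open_smooth_curve_def
  proof
    fix \<gamma> assume "\<gamma> \<in> \<Union>K"
    then obtain S where S: "S \<in> K" "\<gamma> \<in> S" by blast
    from bspec[OF bspec[OF K S(1), unfolded open_smooth_curve_def] S(2)] obtain k p e where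
      "continuous_seminorm p" "e > 0" "{\<delta>. Ck_seminorm k p (\<delta> - \<gamma>) < e} \<subseteq> S"
      by (elim exE conjE)
    moreover from this(3) have "{\<delta>. Ck_seminorm k p (\<delta> - \<gamma>) < e} \<subseteq> \<Union>K"
      using S(1) by blast
    ultimately show "\<exists>k p \<epsilon>. continuous_seminorm p \<and> \<epsilon> > 0 \<and>
        {\<delta>. Ck_seminorm k p (\<delta> - \<gamma>) < \<epsilon>} \<subseteq> \<Union>K"
      by (intro exI conjI)
  qed
qed

end

lemma open_smooth_curveE:
  assumes "open U" "\<gamma> \<in> U"
  obtains k p e where "continuous_seminorm p" "e > 0" "{\<delta>. Ck_seminorm k p (\<delta> - \<gamma>) < e} \<subseteq> U"
  using bspec[OF assms(1)[unfolded open_smooth_curve_def] assms(2)] by (elim exE conjE)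

lemma open_Ck_ball:
  assumes "continuous_seminorm p"
  shows "open {\<delta>. Ck_seminorm k p (\<delta> - \<gamma>) < e}"
  unfolding open_smooth_curve_def
proof
  fix \<delta> assume d: "\<delta> \<in> {\<delta>. Ck_seminorm k p (\<delta> - \<gamma>) < e}"
  have "{\<eta>. Ck_seminorm k p (\<eta> - \<delta>) < e - Ck_seminorm k p (\<delta> - \<gamma>)} \<subseteq>
      {\<delta>. Ck_seminorm k p (\<delta> - \<gamma>) < e}"
  proof
    fix \<eta> assume "\<eta> \<in> {\<eta>. Ck_seminorm k p (\<eta> - \<delta>) < e - Ck_seminorm k p (\<delta> - \<gamma>)}"
    then show "\<eta> \<in> {\<delta>. Ck_seminorm k p (\<delta> - \<gamma>) < e}"
      using seminorm_add[OF Ck_seminorm_seminorm[OF assms], of k "\<eta> - \<delta>" "\<delta> - \<gamma>"] by simp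
  qed
  then show "\<exists>k' p' \<epsilon>. continuous_seminorm p' \<and> \<epsilon> > 0 \<and>
      {\<eta>. Ck_seminorm k' p' (\<eta> - \<delta>) < \<epsilon>} \<subseteq> {\<delta>. Ck_seminorm k p (\<delta> - \<gamma>) < e}"
    using assms d by (intro exI[of _ k] exI[of _ p]
        exI[of _ "e - Ck_seminorm k p (\<delta> - \<gamma>)"] conjI) simp_all
qed

lemma Ck_ball_nhds:
  assumes "continuous_seminorm p" "e > 0"
  shows "eventually (\<lambda>\<delta>. Ck_seminorm k p (\<delta> - \<gamma>) < e) (nhds \<gamma>)"
  unfolding eventually_nhds
  by (intro exI[of _ "{\<delta>. Ck_seminorm k p (\<delta> - \<gamma>) < e}"])
    (auto simp: open_Ck_ball assms seminorm_zero[OF Ck_seminorm_seminorm])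

instance smooth_curve :: (locally_convex_space) locally_convex_space
proof
  fix \<gamma> \<delta> :: "'a smooth_curve" assume "\<gamma> \<noteq> \<delta>"
  then obtain t where t: "curve_at \<gamma> t \<noteq> curve_at \<delta> t"
    unfolding curve_at_inject[symmetric] by (auto simp: fun_eq_iff)
  then have t01: "t \<in> {0..1}"
  proof (rule contrapos_np)
    assume "t \<notin> {0..1}"
    then show "curve_at \<gamma> t = curve_at \<delta> t"
      using curve_at[of \<gamma>] curve_at[of \<delta>] by (simp add: smooth_curves_def del: atLeastAtMost_iff)
  qed
  obtain A where A: "open A" "0 \<in> A" "curve_at \<gamma> t - curve_at \<delta> t \<notin> A"
    using t separation_t1[of 0 "curve_at \<gamma> t - curve_at \<delta> t"] by auto
  then obtain p where p: "continuous_seminorm p" "{x. p x < 1} \<subseteq> A"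
    using continuous_seminorm_ball[OF A(1,2)] unfolding continuous_seminorm_def by blast
  have "1 \<le> p (curve_at \<gamma> t - curve_at \<delta> t)" using A(3) p(2) by (meson linorder_not_le mem_Collect_eq subsetD)
  also have "\<dots> \<le> Ck_seminorm 0 p (\<gamma> - \<delta>)"
    using Ck_seminorm_upper[OF p(1), of 0 0 t "\<gamma> - \<delta>"] t01
    by (simp add: minus_smooth_curve.rep_eq)
  finally have ge: "1 \<le> Ck_seminorm 0 p (\<gamma> - \<delta>)" .
  note sn = Ck_seminorm_seminorm[OF p(1), of 0]
  show "\<exists>U V. open U \<and> open V \<and> \<gamma> \<in> U \<and> \<delta> \<in> V \<and> U \<inter> V = {}"
  proof (intro exI conjI)
    show "open {\<eta>. Ck_seminorm 0 p (\<eta> - \<gamma>) < 1/2}" "open {\<eta>. Ck_seminorm 0 p (\<eta> - \<delta>) < 1/2}"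
      by (intro open_Ck_ball p)+
    show "\<gamma> \<in> {\<eta>. Ck_seminorm 0 p (\<eta> - \<gamma>) < 1/2}" "\<delta> \<in> {\<eta>. Ck_seminorm 0 p (\<eta> - \<delta>) < 1/2}"
      by (auto simp: seminorm_zero[OF sn])
    have "False" if "Ck_seminorm 0 p (\<eta> - \<gamma>) < 1/2" "Ck_seminorm 0 p (\<eta> - \<delta>) < 1/2" for \<eta>
      using seminorm_add[OF sn, of "- (\<eta> - \<gamma>)" "\<eta> - \<delta>"] seminorm_minus[OF sn, of "\<eta> - \<gamma>"] that ge
      by simp
    then show "{\<eta>. Ck_seminorm 0 p (\<eta> - \<gamma>) < 1/2} \<inter> {\<eta>. Ck_seminorm 0 p (\<eta> - \<delta>) < 1/2} = {}"
      by blast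
  qed
next
  fix a b :: "'a smooth_curve"
  show "((\<lambda>x. fst x + snd x) \<longlongrightarrow> a + b) (nhds a \<times>\<^sub>F nhds b)"
  proof (rule topological_tendstoI)
    fix S assume "open S" "a + b \<in> S"
    then obtain k p e where p: "continuous_seminorm p" "e > 0"
      "{\<delta>. Ck_seminorm k p (\<delta> - (a + b)) < e} \<subseteq> S"
      by (rule open_smooth_curveE)
    have "eventually (\<lambda>x. Ck_seminorm k p (fst x - a) < e/2) (nhds a \<times>\<^sub>F nhds b)"
      using Ck_ball_nhds[OF p(1), of "e/2" k a] p(2)
      by (intro eventually_compose_filterlim[OF _ filterlim_fst]) auto
    moreover have "eventually (\<lambda>x. Ck_seminorm k p (snd x - b) < e/2) (nhds a \<times>\<^sub>F nhds b)"
      using Ck_ball_nhds[OF p(1), of "e/2" k b] p(2)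
      by (intro eventually_compose_filterlim[OF _ filterlim_snd]) auto
    ultimately show "eventually (\<lambda>x. fst x + snd x \<in> S) (nhds a \<times>\<^sub>F nhds b)"
    proof eventually_elim
      case (elim x)
      have eq: "fst x + snd x - (a + b) = (fst x - a) + (snd x - b)" by simp
      have "Ck_seminorm k p (fst x + snd x - (a + b)) < e"
        using seminorm_add[OF Ck_seminorm_seminorm[OF p(1)], of k "fst x - a" "snd x - b"] elim
        unfolding eq by linarith
      then show ?case using p(3) by blast
    qed
  qed
  show "(uminus \<longlongrightarrow> - a) (nhds a)"
  proof (rule topological_tendstoI)
    fix S assume "open S" "- a \<in> S"
    then obtain k p e where p: "continuous_seminorm p" "e > 0"
      "{\<delta>. Ck_seminorm k p (\<delta> - (- a)) < e} \<subseteq> S"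
      by (rule open_smooth_curveE)
    have "eventually (\<lambda>x. Ck_seminorm k p (x - a) < e) (nhds a)"
      by (intro Ck_ball_nhds p)
    then show "eventually (\<lambda>x. - x \<in> S) (nhds a)"
    proof eventually_elim
      case (elim x)
      then have "Ck_seminorm k p (- x - (- a)) < e"
        using seminorm_minus[OF Ck_seminorm_seminorm[OF p(1)], of k "x - a"] by simp
      then show ?case using p(3) by blast
    qed
  qed
next
  fix U :: "'a smooth_curve set" assume "open U" "0 \<in> U"
  then obtain k p e where p: "continuous_seminorm p" "e > 0"
    "{\<delta>. Ck_seminorm k p (\<delta> - 0) < e} \<subseteq> U"
    by (rule open_smooth_curveE)
  note sn = Ck_seminorm_seminorm[OF p(1), of k]
  let ?r = "\<lambda>x. Ck_seminorm k p x / e"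
  have "seminorm scaleR ?r"
    using sn p(2) by (simp add: seminorm_def add_divide_distrib[symmetric] divide_right_mono)
  moreover have "continuous_on UNIV ?r"
    unfolding continuous_on_def
  proof (intro ballI tendsto_divide tendsto_const)
    fix \<gamma> :: "'a smooth_curve"
    show "((\<lambda>x. Ck_seminorm k p x) \<longlongrightarrow> Ck_seminorm k p \<gamma>) (at \<gamma>)"
    proof (rule tendstoI)
      fix d :: real assume "d > 0"
      have "eventually (\<lambda>x. Ck_seminorm k p (x - \<gamma>) < d) (at \<gamma>)"
        unfolding eventually_at_filter
        by (rule eventually_mono[OF Ck_ball_nhds[OF p(1) \<open>d > 0\<close>, of k \<gamma>]]) simp
      then show "eventually (\<lambda>x. dist (Ck_seminorm k p x) (Ck_seminorm k p \<gamma>) < d) (at \<gamma>)"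
      proof eventually_elim
        case (elim x)
        then show ?case
          using seminorm_add[OF sn, of "x - \<gamma>" \<gamma>] seminorm_add[OF sn, of "- (x - \<gamma>)" x]
            seminorm_minus[OF sn, of "x - \<gamma>"]
          by (simp add: dist_real_def)
      qed
    qed
  qed (use p(2) in auto)
  moreover have "{x. ?r x < 1} \<subseteq> U"
    using p by (auto simp: subset_iff)
  ultimately show "\<exists>p :: 'a smooth_curve \<Rightarrow> real. (\<forall>x y. p (x + y) \<le> p x + p y) \<and>
      (\<forall>c x. p (c *\<^sub>R x) = \<bar>c\<bar> * p x) \<and> (\<forall>x. filterlim p (nhds (p x)) (nhds x)) \<and>
      {x. p x < 1} \<subseteq> U"
    unfolding locally_convex_iff by (intro exI[of _ ?r] conjI)
qed


section \<open>Mackey completeness\<close>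

definition vn_bounded :: "'e::locally_convex_space set \<Rightarrow> bool"
  where "vn_bounded B \<longleftrightarrow> (\<forall>U. open U \<and> 0 \<in> U \<longrightarrow> (\<exists>r>0. B \<subseteq> (\<lambda>x. r *\<^sub>R x) ` U))"

definition lipschitz_curve :: "(real \<Rightarrow> 'e::locally_convex_space) \<Rightarrow> bool"
  where "lipschitz_curve \<gamma> \<longleftrightarrow>
    vn_bounded {(\<gamma> t - \<gamma> s) /\<^sub>R (t - s) | s t. s \<in> {0..1} \<and> t \<in> {0..1} \<and> s \<noteq> t}"

definition has_riemann_integral :: "(real \<Rightarrow> 'e::locally_convex_space) \<Rightarrow> 'e \<Rightarrow> bool"
  where "has_riemann_integral \<gamma> I \<longleftrightarrow>
    (\<forall>U. open U \<and> 0 \<in> U \<longrightarrow>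
      (\<exists>\<delta>>0. \<forall>D. D tagged_division_of {0..1} \<and> (\<forall>(t, K)\<in>D. measure lborel K < \<delta>) \<longrightarrow>
        (\<Sum>(t, K)\<in>D. measure lborel K *\<^sub>R \<gamma> t) - I \<in> U))"

definition mackey_complete :: "'e::locally_convex_space itself \<Rightarrow> bool"
  where "mackey_complete (_ :: 'e itself) \<longleftrightarrow>
    (\<forall>\<gamma> :: real \<Rightarrow> 'e. lipschitz_curve \<gamma> \<longrightarrow> (\<exists>I. has_riemann_integral \<gamma> I))"


section \<open>Continuous inverse algebras\<close>

definition mult_monoid :: "'a::monoid_mult monoid"
  where "mult_monoid = \<lparr>carrier = UNIV, monoid.mult = (*), one = 1\<rparr>"

abbreviation unit_group :: "'a::monoid_mult monoid"
  where "unit_group \<equiv> units_of mult_monoid"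

text \<open>The classes provide the real Hausdorff locally convex space underlying \<open>A\<close>, the (possibly
  trivial) unital ring structure, and joint continuity of the multiplication; \<open>ring_1\<close> would rule
  out the zero algebra.\<close>

locale continuous_inverse_algebra = vector_space smul
  for smul :: "'k::real_or_complex_field \<Rightarrow>
      'a::{locally_convex_space, ring, topological_monoid_mult} \<Rightarrow> 'a" +
  assumes scale_of_real: "smul (of_real r) x = r *\<^sub>R x"
    and scale_mult_left: "smul c x * y = smul c (x * y)"
    and scale_mult_right: "x * smul c y = smul c (x * y)"
    and continuous_scale: "continuous_on UNIV (\<lambda>(c, x). smul c x)"
    and open_units: "open (Units (mult_monoid :: 'a monoid))"
    and continuous_inverse:
      "continuous_on (Units (mult_monoid :: 'a monoid)) (m_inv mult_monoid)"

definition topology_from_seminorms :: "('a::{topological_space, ab_group_add} \<Rightarrow> real) set \<Rightarrow> bool"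
  where "topology_from_seminorms Q \<longleftrightarrow>
    (\<forall>U. open U \<longleftrightarrow>
      (\<forall>x\<in>U. \<exists>F \<epsilon>. finite F \<and> F \<subseteq> Q \<and> \<epsilon> > 0 \<and> {y. \<forall>q\<in>F. q (y - x) < \<epsilon>} \<subseteq> U))"

definition locally_m_convex ::
    "('k::real_normed_field \<Rightarrow> 'a::{topological_space, ring} \<Rightarrow> 'a) \<Rightarrow> bool"
  where "locally_m_convex smul \<longleftrightarrow>
    (\<exists>Q. (\<forall>q\<in>Q. seminorm smul q \<and> (\<forall>x y. q (x * y) \<le> q x * q y)) \<and>
      topology_from_seminorms Q)"


section \<open>Lie groups and regularity\<close>

text \<open>Lie groups whose underlying manifold is an open subset of the modelling space \<open>E\<close>, with the
  identity as a global chart. The Lie algebra is then \<open>E\<close> as a locally convex space.\<close>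

definition lie_group :: "'e::locally_convex_space monoid \<Rightarrow> bool"
  where "lie_group G \<longleftrightarrow>
    group G \<and> open (carrier G) \<and>
    smooth_map_on (carrier G \<times> carrier G) (\<lambda>(x, y). x \<otimes>\<^bsub>G\<^esub> y) \<and>
    smooth_map_on (carrier G) (m_inv G)"

text \<open>\<open>gv = T\<^sub>1(\<lambda>\<^sub>g)(v)\<close>\<close>

definition left_translate :: "'e::locally_convex_space monoid \<Rightarrow> 'e \<Rightarrow> 'e \<Rightarrow> 'e"
  where "left_translate G g v = dir_deriv (\<lambda>x. g \<otimes>\<^bsub>G\<^esub> x) v \<one>\<^bsub>G\<^esub>"

lemma (in continuous_inverse_algebra) left_translate_unit_group:
  "left_translate unit_group g v = g * v" for g v :: 'a
proof -
  have "g * (t *\<^sub>R v) = t *\<^sub>R (g * v)" for t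
    using scale_mult_right[of g "of_real t" v] by (simp add: scale_of_real)
  then have "eventually (\<lambda>t. (g * (1 + t *\<^sub>R v) - g * 1) /\<^sub>R t = g * v) (at (0::real))"
    by (simp add: eventually_at_filter distrib_left)
  then have "((\<lambda>t. (g * (1 + t *\<^sub>R v) - g * 1) /\<^sub>R t) \<longlongrightarrow> g * v) (at (0::real))"
    by (rule tendsto_eventually)
  then show ?thesis
    by (simp add: left_translate_def dir_deriv_def units_of_def mult_monoid_def tendsto_Lim)
qed

definition is_evolution ::
    "'e::locally_convex_space monoid \<Rightarrow> (real \<Rightarrow> 'e) \<Rightarrow> (real \<Rightarrow> 'e) \<Rightarrow> bool"
  where "is_evolution G \<gamma> \<eta> \<longleftrightarrow>
    Cr_curve 1 \<eta> \<and> (\<forall>t\<in>{0..1}. \<eta> t \<in> carrier G) \<and> \<eta> 0 = \<one>\<^bsub>G\<^esub> \<and>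
    (\<forall>t\<in>{0..1}. curve_deriv \<eta> t = left_translate G (\<eta> t) (\<gamma> t))"

text \<open>Evolutions are unique on \<open>{0..1}\<close>, so the choice does not matter there.\<close>

definition evolution :: "'e::locally_convex_space monoid \<Rightarrow> (real \<Rightarrow> 'e) \<Rightarrow> real \<Rightarrow> 'e"
  where "evolution G \<gamma> = (SOME \<eta>. is_evolution G \<gamma> \<eta>)"

definition evol :: "'e::locally_convex_space monoid \<Rightarrow> 'e smooth_curve \<Rightarrow> 'e"
  where "evol G \<gamma> = evolution G (curve_at \<gamma>) 1"

definition regular_lie_group :: "'e::locally_convex_space monoid \<Rightarrow> bool"
  where "regular_lie_group G \<longleftrightarrow>
    lie_group G \<and>
    (\<forall>\<gamma> :: 'e smooth_curve. \<exists>\<eta>. is_evolution G (curve_at \<gamma>) \<eta>) \<and>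
    smooth_map_on UNIV (evol G)"

end

(*
  A commutative continuous inverse algebra is locally m-convex: the geometric series is controlled by
  averaging resolvents over roots of unity, which bounds the powers of small elements, and
  polarization passes from powers to products. So submultiplicative seminorms are always available.
  With them the Picard iteration for eta' = eta gamma converges faster than geometrically, and
  Mackey completeness suffices to sum it. The solution is invertible because the equation
  zeta' = - gamma zeta provides a one-sided inverse and the group of units is open.

  Differentiation of the evolution is reduced to its behaviour near 0 by the identity
  Ev (gamma + delta) = Ev (Ad delta) Ev gamma, where Ad delta = Ev gamma * delta * (Ev gamma)^-1.
  Its derivative is an expression in Ev gamma, (Ev gamma)^-1 and the direction that is built with
  products and integrals. Expressions of this kind are continuous and closed under differentiation,
  which gives all higher derivatives at once.
*)
theory Submission
  imports Defs
begin

section \<open>Seminorms and curves\<close>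

text \<open>Mackey completeness, in the form assumed, integrates Lipschitz curves and nothing else.
  This shapes every construction: all curves are kept Lipschitz, a property stable under products
  and primitives, and even the sum of a series is produced as such an integral. Its
  \<open>n\<close>-th term lives on an interval of length \<open>2^-(n+1)\<close>, where a bump with
  Lipschitz constant \<open>2\<close> has an integral of order \<open>8^-n\<close>; normalising it
  costs a factor of order \<open>8^n\<close>, which the \<open>1/n!\<close> in the Picard terms
  absorbs. That decay needs the same seminorm on both sides of the estimate at every iteration, and
  this is what submultiplicativity supplies. The scalars may be real, so resolvents at conjugate
  roots of unity are combined into quadratic factors with cosine coefficients. Polarization of
  \<open>n\<close> factors costs a constant to the power \<open>n\<close> only, hence is compensated
  by shrinking the neighbourhood. The derivative of the evolution involves its inverse. Both are
  therefore obtained as a pair of solutions and differentiated together.\<close>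

abbreviation cs :: "('e::locally_convex_space \<Rightarrow> real) \<Rightarrow> bool"
  where "cs \<equiv> continuous_seminorm"

lemma cs_seminorm: "cs p \<Longrightarrow> seminorm scaleR p"
  by (simp add: continuous_seminorm_def)

lemma cs_add: "cs p \<Longrightarrow> p (x + y) \<le> p x + p y"
  by (rule seminorm_add[OF cs_seminorm])

lemma cs_scaleR: "cs p \<Longrightarrow> p (c *\<^sub>R x) = \<bar>c\<bar> * p x"
  by (simp add: cs_seminorm seminorm_scaleR)

lemma cs_zero: "cs p \<Longrightarrow> p 0 = 0"
  by (simp add: cs_seminorm seminorm_zero)

lemma cs_minus: "cs p \<Longrightarrow> p (- x) = p x"
  by (simp add: cs_seminorm seminorm_minus)

lemma cs_nonneg: "cs p \<Longrightarrow> 0 \<le> p x"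
  by (simp add: cs_seminorm seminorm_nonneg)

lemma cs_minus_commute: "cs p \<Longrightarrow> p (x - y) = p (y - x)"
  using cs_minus[of p "x - y"] by simp

lemma cs_diff: "cs p \<Longrightarrow> p (x - y) \<le> p x + p y"
  using cs_add[of p x "- y"] cs_minus[of p y] by simp

lemma cs_triangle: "cs p \<Longrightarrow> p (x - z) \<le> p (x - y) + p (y - z)"
  using cs_add[of p "x - y" "y - z"] by simp

lemma cs_sum: "cs p \<Longrightarrow> p (sum f A) \<le> (\<Sum>i\<in>A. p (f i))"
  by (induction A rule: infinite_finite_induct)
    (auto simp: cs_zero intro: order_trans[OF cs_add] add_left_mono)

lemma cs_ballE:
  fixes U :: "'e::locally_convex_space set"
  assumes "open U" "0 \<in> U"
  obtains p where "cs p" "{x. p x < 1} \<subseteq> U"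
  using continuous_seminorm_ball[OF assms] unfolding continuous_seminorm_def by blast

lemma open_cs_ball: "cs p \<Longrightarrow> open {x. p x < e}"
  unfolding continuous_seminorm_def by (intro open_Collect_less) auto

lemma eventually_nhds_seminorm:
  fixes a :: "'e::locally_convex_space"
  assumes "eventually Q (nhds a)"
  obtains q where "cs q" "\<And>x. q (x - a) < 1 \<Longrightarrow> Q x"
proof -
  obtain S where S: "open S" "a \<in> S" "\<And>x. x \<in> S \<Longrightarrow> Q x"
    using assms unfolding eventually_nhds by blast
  have "open ((\<lambda>x. x + a) -` S)" "0 \<in> (\<lambda>x. x + a) -` S"
    using S by (auto intro!: open_vimage continuous_on_add continuous_on_id continuous_on_const)
  then obtain q where q: "cs q" "{x. q x < 1} \<subseteq> (\<lambda>x. x + a) -` S"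
    by (rule cs_ballE)
  show ?thesis
  proof (rule that[OF q(1)])
    fix x assume "q (x - a) < 1"
    then have "x - a \<in> (\<lambda>x. x + a) -` S" using q(2) by blast
    then show "Q x" using S(3) by simp
  qed
qed

lemma cs_eq_zeroI:
  assumes "\<And>p. cs p \<Longrightarrow> p x = 0"
  shows "x = 0"
proof (rule ccontr)
  assume "x \<noteq> 0"
  then obtain A where A: "open A" "0 \<in> A" "x \<notin> A" using separation_t1[of 0 x] by auto
  obtain p where p: "cs p" "{x. p x < 1} \<subseteq> A" by (rule cs_ballE[OF A(1,2)])
  have "x \<in> {x. p x < 1}" using assms[OF p(1)] by simp
  then show False using p(2) A(3) by blast
qed

lemma cs_eqI:
  assumes "\<And>p. cs p \<Longrightarrow> p (x - y) = 0"
  shows "x = y"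
  using cs_eq_zeroI[of "x - y"] assms by simp

lemma cs_tendsto: "cs p \<Longrightarrow> (f \<longlongrightarrow> l) F \<Longrightarrow> ((\<lambda>x. p (f x)) \<longlongrightarrow> p l) F"
  unfolding continuous_seminorm_def by (auto intro: continuous_on_tendsto_compose)

lemma tendsto_seminormI:
  fixes f :: "'b \<Rightarrow> 'e::locally_convex_space"
  assumes "\<And>p e. cs p \<Longrightarrow> e > 0 \<Longrightarrow> eventually (\<lambda>x. p (f x - l) < e) F"
  shows "(f \<longlongrightarrow> l) F"
proof (rule topological_tendstoI)
  fix S assume "open S" "l \<in> S"
  then obtain p where p: "cs p" "\<And>x. p (x - l) < 1 \<Longrightarrow> x \<in> S"
    by (rule eventually_nhds_seminorm[OF eventually_nhds_in_open]) (rule that)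
  show "eventually (\<lambda>x. f x \<in> S) F"
    using assms[OF p(1) zero_less_one] by eventually_elim (rule p(2))
qed

lemma tendsto_iff_seminorms:
  fixes f :: "'b \<Rightarrow> 'e::locally_convex_space"
  shows "(f \<longlongrightarrow> l) F \<longleftrightarrow> (\<forall>p. cs p \<longrightarrow> ((\<lambda>x. p (f x - l)) \<longlongrightarrow> 0) F)"
proof (intro iffI allI impI)
  fix p :: "'e \<Rightarrow> real"
  assume l: "(f \<longlongrightarrow> l) F" and p: "cs p"
  have "((\<lambda>x. f x - l) \<longlongrightarrow> 0) F" using tendsto_add[OF l tendsto_const[of "- l"]] by simp
  from cs_tendsto[OF p this] show "((\<lambda>x. p (f x - l)) \<longlongrightarrow> 0) F" by (simp add: cs_zero[OF p])
next
  assume *: "\<forall>p. cs p \<longrightarrow> ((\<lambda>x. p (f x - l)) \<longlongrightarrow> 0) F"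
  show "(f \<longlongrightarrow> l) F"
    by (rule tendsto_seminormI, rule order_tendstoD(2), rule *[rule_format])
qed

lemma tendsto_seminormD:
  fixes f :: "'b \<Rightarrow> 'e::locally_convex_space"
  assumes "(f \<longlongrightarrow> l) F" "cs p" "e > 0"
  shows "eventually (\<lambda>x. p (f x - l) < e) F"
  by (rule order_tendstoD(2)[OF iffD1[OF tendsto_iff_seminorms assms(1), rule_format, OF assms(2)] assms(3)])

lemma continuous_seminormI:
  fixes p :: "'e::locally_convex_space \<Rightarrow> real"
  assumes p: "seminorm scaleR p" and q: "cs q" and le: "\<And>x. p x \<le> c * q x"
  shows "cs p"
  unfolding continuous_seminorm_def continuous_on_def
proof (intro conjI ballI p)
  fix x
  have "((\<lambda>y. p y - p x) \<longlongrightarrow> 0) (at x)"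
  proof (rule Lim_null_comparison)
    have ab: "\<bar>p y - p x\<bar> \<le> c * q (y - x)" for y
      using seminorm_add[OF p, of "y - x" x] seminorm_add[OF p, of "- (y - x)" y]
        seminorm_minus[OF p, of "y - x"] le[of "y - x"] by simp
    then show "eventually (\<lambda>y. norm (p y - p x) \<le> c * q (y - x)) (at x)" by simp
    have "((\<lambda>y. q (y - x)) \<longlongrightarrow> 0) (at x)"
      using iffD1[OF tendsto_iff_seminorms tendsto_ident_at[of x UNIV]] q by blast
    then show "((\<lambda>y. c * q (y - x)) \<longlongrightarrow> 0) (at x)"
      by (rule tendsto_mult_right_zero)
  qed
  then show "(p \<longlongrightarrow> p x) (at x)" by (simp add: LIM_zero_iff)
qed

section \<open>Derivatives of curves and a mean value inequality\<close>

lemma diff_quotient_scaleR: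
  fixes w v :: "'a::real_vector"
  shows "c \<noteq> 0 \<Longrightarrow> w - c *\<^sub>R v = c *\<^sub>R (w /\<^sub>R c - v)"
  by (simp add: scaleR_diff_right)

text \<open>Multiplied out, the derivative needs no quotient and also covers \<open>y = x\<close>;
  the estimates below use it, and its converse \<open>curve_deriv_seminormI\<close>, in this
  form.\<close>

lemma curve_deriv_seminormD:
  assumes "has_curve_deriv F v x" "cs p" "e > 0"
  obtains d where "d > 0"
    "\<And>y. y \<in> {0..1} \<Longrightarrow> \<bar>y - x\<bar> < d \<Longrightarrow> p (F y - F x - (y - x) *\<^sub>R v) \<le> e * \<bar>y - x\<bar>"
proof -
  have "eventually (\<lambda>s. p ((F s - F x) /\<^sub>R (s - x) - v) < e) (at x within {0..1})"
    using assms unfolding has_curve_deriv_def by (rule tendsto_seminormD)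
  then obtain d where d: "d > 0"
    "\<And>y. y \<in> {0..1} \<Longrightarrow> y \<noteq> x \<Longrightarrow> dist y x < d \<Longrightarrow> p ((F y - F x) /\<^sub>R (y - x) - v) < e"
    unfolding eventually_at by blast
  show ?thesis
  proof (rule that[OF d(1)])
    fix y assume y: "y \<in> {0..1}" "\<bar>y - x\<bar> < d"
    show "p (F y - F x - (y - x) *\<^sub>R v) \<le> e * \<bar>y - x\<bar>"
    proof (cases "y = x")
      case False
      have "F y - F x - (y - x) *\<^sub>R v = (y - x) *\<^sub>R ((F y - F x) /\<^sub>R (y - x) - v)"
        by (rule diff_quotient_scaleR) (use False in simp)
      then have "p (F y - F x - (y - x) *\<^sub>R v) = p ((y - x) *\<^sub>R ((F y - F x) /\<^sub>R (y - x) - v))"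
        by (rule arg_cong)
      also have "\<dots> = \<bar>y - x\<bar> * p ((F y - F x) /\<^sub>R (y - x) - v)"
        by (rule cs_scaleR[OF assms(2)])
      also have "\<dots> \<le> \<bar>y - x\<bar> * e"
        by (intro mult_left_mono less_imp_le d(2)[OF y(1) False]) (simp_all add: dist_real_def y(2) False)
      finally show ?thesis by (simp only: mult.commute)
    qed (simp add: cs_zero[OF assms(2)])
  qed
qed

lemma curve_deriv_seminormI:
  fixes F :: "real \<Rightarrow> 'e::locally_convex_space"
  assumes *: "\<And>p e. cs p \<Longrightarrow> e > 0 \<Longrightarrow>
    \<exists>d>0. \<forall>y\<in>{0..1::real}. \<bar>y - x\<bar> < d \<longrightarrow> p (F y - F x - (y - x) *\<^sub>R v) \<le> e * \<bar>y - x\<bar>"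
  shows "has_curve_deriv F v x"
  unfolding has_curve_deriv_def
proof (rule tendsto_seminormI)
  fix p :: "'e \<Rightarrow> real" and e :: real
  assume p: "cs p" and e: "e > 0"
  \<comment> \<open>The hypothesis yields a weak inequality and the limit asks for a strict one,
    hence \<open>e/2\<close>.\<close>
  have "e/2 > 0" using e by simp
  from *[OF p this] obtain d where d: "d > 0"
    "\<And>y. y\<in>{0..1} \<Longrightarrow> \<bar>y - x\<bar> < d \<Longrightarrow> p (F y - F x - (y - x) *\<^sub>R v) \<le> e/2 * \<bar>y - x\<bar>"
    by blast
  show "eventually (\<lambda>s. p ((F s - F x) /\<^sub>R (s - x) - v) < e) (at x within {0..1})"
    unfolding eventually_at
  proof (intro exI[of _ d] conjI d(1) ballI impI)
    fix y assume y: "y \<in> {0..1}" "y \<noteq> x \<and> dist y x < d"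
    have "(F y - F x) /\<^sub>R (y - x) - v = inverse (y - x) *\<^sub>R (F y - F x - (y - x) *\<^sub>R v)"
      by (subst diff_quotient_scaleR) (use y in auto)
    then have "p ((F y - F x) /\<^sub>R (y - x) - v) = p (inverse (y - x) *\<^sub>R (F y - F x - (y - x) *\<^sub>R v))"
      by (rule arg_cong)
    also have "\<dots> = \<bar>inverse (y - x)\<bar> * p (F y - F x - (y - x) *\<^sub>R v)"
      by (rule cs_scaleR[OF p])
    also have "\<dots> \<le> \<bar>inverse (y - x)\<bar> * (e/2 * \<bar>y - x\<bar>)"
      using y by (intro mult_left_mono d(2)) (simp_all only: dist_real_def abs_ge_zero)
    also have "\<dots> = e/2 * (inverse \<bar>y - x\<bar> * \<bar>y - x\<bar>)" by simp
    also have "\<dots> = e/2" using y by (subst left_inverse) auto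
    finally show "p ((F y - F x) /\<^sub>R (y - x) - v) < e" using e by simp
  qed
qed

lemma has_curve_deriv_tendsto:
  fixes F :: "real \<Rightarrow> 'e::locally_convex_space"
  assumes "has_curve_deriv F v x"
  shows "(F \<longlongrightarrow> F x) (at x within {0..1})"
proof (rule tendsto_seminormI)
  fix p :: "'e \<Rightarrow> real" and e :: real
  assume p: "cs p" and e: "e > 0"
  obtain d where d: "d > 0"
    "\<And>y. y \<in> {0..1} \<Longrightarrow> \<bar>y - x\<bar> < d \<Longrightarrow> p (F y - F x - (y - x) *\<^sub>R v) \<le> 1 * \<bar>y - x\<bar>"
    using curve_deriv_seminormD[OF assms p, of 1] by auto
  let ?d = "min d (e / (1 + p v))"
  have pos: "1 + p v > 0" using cs_nonneg[OF p, of "v"] by simp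
  show "eventually (\<lambda>y. p (F y - F x) < e) (at x within {0..1})"
    unfolding eventually_at
  proof (intro exI[of _ ?d] conjI ballI impI)
    show "0 < ?d" using d e pos by simp
    fix y assume y: "y \<in> {0..1}" "y \<noteq> x \<and> dist y x < ?d"
    have "p (F y - F x) \<le> p (F y - F x - (y - x) *\<^sub>R v) + p ((y - x) *\<^sub>R v)"
      using cs_add[OF p, of "F y - F x - (y - x) *\<^sub>R v" "(y - x) *\<^sub>R v"] by simp
    also have "\<dots> \<le> \<bar>y - x\<bar> + \<bar>y - x\<bar> * p v"
      using d(2)[of y] y by (simp add: cs_scaleR[OF p] dist_real_def)
    also have "\<dots> = \<bar>y - x\<bar> * (1 + p v)" by (simp add: algebra_simps)
    also have "\<dots> < e" using y pos by (simp add: dist_real_def field_simps)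
    finally show "p (F y - F x) < e" .
  qed
qed

text \<open>With slack \<open>e\<close> the inequality adds up over adjacent intervals and holds on
  short intervals around each point, so bisection (\<open>Bolzano\<close>) extends it to all of
  \<open>{a..b}\<close>. A general majorant \<open>g\<close>, rather than a linear one, is what
  later gives the powers \<open>t ^ n\<close> in the Picard bounds.\<close>

lemma curve_mean_value:
  fixes g :: "real \<Rightarrow> real"
  assumes F: "\<And>t. t \<in> {0..1} \<Longrightarrow> has_curve_deriv F (f t) t" and p: "cs p"
    and g: "\<And>t. t \<in> {0..1} \<Longrightarrow> (g has_real_derivative g' t) (at t within {0..1})"
    and le: "\<And>t. t \<in> {0..1} \<Longrightarrow> p (f t) \<le> g' t"
    and ab: "0 \<le> a" "a \<le> b" "b \<le> 1"
  shows "p (F b - F a) \<le> g b - g a"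
proof (rule field_le_epsilon)
  fix e :: real assume e: "e > 0"
  \<comment> \<open>Membership in the unit interval is a premise inside \<open>P\<close>, because
    the local condition of \<open>Bolzano\<close> quantifies over all \<open>u\<close>,
    \<open>v\<close> around \<open>x\<close>, also outside \<open>{0..1}\<close>.\<close>
  define P where "P u v \<longleftrightarrow> u \<in> {0..1} \<longrightarrow> v \<in> {0..1} \<longrightarrow> u \<le> v \<longrightarrow> p (F v - F u) \<le> g v - g u + e * (v - u)" for u v
  have "P a b"
  proof (rule Bolzano[OF ab(2)])
    fix u v w assume P: "P u v" "P v w" and le: "u \<le> v" "v \<le> w"
    show "P u w"
      unfolding P_def
    proof (intro impI)
      assume "u \<in> {0..1}" "w \<in> {0..1}"
      then have "p (F v - F u) \<le> g v - g u + e * (v - u)" "p (F w - F v) \<le> g w - g v + e * (w - v)"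
        using P le unfolding P_def by auto
      then show "p (F w - F u) \<le> g w - g u + e * (w - u)"
        using cs_triangle[OF p, of "F w" "F u" "F v"] by (simp add: algebra_simps)
    qed
  next
    fix x assume "a \<le> x" "x \<le> b"
    then have x: "x \<in> {0..1}" using ab by auto
    obtain d where d: "d > 0"
      "\<And>y. y \<in> {0..1} \<Longrightarrow> \<bar>y - x\<bar> < d \<Longrightarrow> p (F y - F x - (y - x) *\<^sub>R f x) \<le> e/2 * \<bar>y - x\<bar>"
      using curve_deriv_seminormD[OF F[OF x] p, of "e/2"] e by auto
    have "has_curve_deriv g (g' x) x"
      using g[OF x] by (simp add: has_curve_deriv_def has_field_derivative_iff divide_inverse mult.commute)
    moreover have "cs (\<lambda>x::real. \<bar>x\<bar>)"
      by (auto simp: continuous_seminorm_def seminorm_def abs_mult intro: continuous_intros)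
    ultimately obtain d' where d': "d' > 0"
      "\<And>y. y \<in> {0..1} \<Longrightarrow> \<bar>y - x\<bar> < d' \<Longrightarrow> \<bar>g y - g x - (y - x) *\<^sub>R g' x\<bar> \<le> e/2 * \<bar>y - x\<bar>"
      using curve_deriv_seminormD[of g "g' x" x abs "e/2"] e by auto
    have "P u v" if uv: "u \<le> x" "x \<le> v" "v - u < min d d'" and uv': "u \<in> {0..1}" "v \<in> {0..1}" for u v
    proof -
      \<comment> \<open>Both increments are measured from \<open>x\<close>. The error is
        \<open>e/2 * (v - u)\<close> for \<open>F\<close> and once more for
        \<open>g\<close>.\<close>
      have "F v - F u = (F v - F x - (v - x) *\<^sub>R f x) - (F u - F x - (u - x) *\<^sub>R f x) + (v - u) *\<^sub>R f x"
        by (simp add: algebra_simps)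
      then have "p (F v - F u) \<le> p (F v - F x - (v - x) *\<^sub>R f x) + p (F u - F x - (u - x) *\<^sub>R f x) + p ((v - u) *\<^sub>R f x)"
        by (simp only:) (intro order_trans[OF cs_add[OF p]] add_right_mono cs_diff[OF p])
      also have "\<dots> \<le> e/2 * (v - x) + e/2 * (x - u) + (v - u) * g' x"
        using d(2)[OF uv'(1)] d(2)[OF uv'(2)] uv le[OF x]
        by (intro add_mono) (auto simp: cs_scaleR[OF p] mult_left_mono)
      also have "(v - u) * g' x \<le> g v - g u + e/2 * (v - x) + e/2 * (x - u)"
      proof -
        have "- (e/2 * (v - x)) \<le> g v - g x - (v - x) * g' x"
        proof -
          have "\<bar>g v - g x - (v - x) * g' x\<bar> \<le> e/2 * (v - x)"
            using d'(2)[OF uv'(2)] uv by simp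
          then show ?thesis by linarith
        qed
        moreover have "g u - g x - (u - x) * g' x \<le> e/2 * (x - u)"
        proof -
          have "\<bar>g u - g x - (u - x) * g' x\<bar> \<le> e/2 * (x - u)"
            using d'(2)[OF uv'(1)] uv by simp
          then show ?thesis by linarith
        qed
        moreover have "(v - u) * g' x = (v - x) * g' x - (u - x) * g' x"
          by (simp add: algebra_simps)
        ultimately show ?thesis by linarith
      qed
      finally have "p (F v - F u) \<le> g v - g u + e * (v - u)" by (simp add: algebra_simps)
      then show ?thesis unfolding P_def by simp
    qed
    then show "\<exists>d>0. \<forall>u v. u \<le> x \<and> x \<le> v \<and> v - u < d \<longrightarrow> P u v"
      using d(1) d'(1) by (intro exI[of _ "min d d'"]) (auto simp: P_def)
  qed
  then have "p (F b - F a) \<le> g b - g a + e * (b - a)" using ab unfolding P_def by simp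
  also have "e * (b - a) \<le> e * 1" using ab e by (intro mult_left_mono) auto
  finally show "p (F b - F a) \<le> g b - g a + e" by simp
qed

lemma curve_mean_value_const:
  assumes "\<And>t. t \<in> {0..1} \<Longrightarrow> has_curve_deriv F (f t) t" "cs p"
    and "\<And>t. t \<in> {0..1} \<Longrightarrow> p (f t) \<le> K" and "s \<in> {0..1}" "t \<in> {0..1}"
  shows "p (F t - F s) \<le> K * \<bar>t - s\<bar>"
proof -
  have *: "p (F b - F a) \<le> K * (b - a)" if "0 \<le> a" "a \<le> b" "b \<le> 1" for a b
  proof -
    have "p (F b - F a) \<le> K * b - K * a"
      by (rule curve_mean_value[OF assms(1,2), where g' = "\<lambda>_. K"])
        (use that assms(3) in \<open>auto intro!: derivative_eq_intros\<close>)
    then show ?thesis by (simp add: algebra_simps)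
  qed
  show ?thesis
    using *[of s t] *[of t s] assms(4,5) cs_minus_commute[OF assms(2), of "F t" "F s"]
    by (cases "s \<le> t") auto
qed

lemma curve_deriv_zero_const:
  assumes "\<And>t. t \<in> {0..1} \<Longrightarrow> has_curve_deriv F 0 t" "t \<in> {0..1}"
  shows "F t = F 0"
proof (rule cs_eqI)
  fix p :: "'a \<Rightarrow> real" assume p: "cs p"
  have "p (F t - F 0) \<le> 0 * \<bar>t - 0\<bar>"
    by (rule curve_mean_value_const[OF assms(1) p]) (use assms cs_zero[OF p] in auto)
  then show "p (F t - F 0) = 0" using cs_nonneg[OF p, of "F t - F 0"] by simp
qed

lemma has_curve_deriv_const: "has_curve_deriv (\<lambda>_. c) 0 t"
  by (simp add: has_curve_deriv_def)

lemma has_curve_deriv_add: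
  "has_curve_deriv F v t \<Longrightarrow> has_curve_deriv G w t \<Longrightarrow> has_curve_deriv (\<lambda>s. F s + G s) (v + w) t"
  using has_curve_deriv_lincomb[of F v t G w 1 1] by simp

lemma has_curve_deriv_diff:
  "has_curve_deriv F v t \<Longrightarrow> has_curve_deriv G w t \<Longrightarrow> has_curve_deriv (\<lambda>s. F s - G s) (v - w) t"
  using has_curve_deriv_lincomb[of F v t G w 1 "-1"] by simp

lemma has_curve_deriv_scaleR:
  "has_curve_deriv F v t \<Longrightarrow> has_curve_deriv (\<lambda>s. c *\<^sub>R F s) (c *\<^sub>R v) t"
  using has_curve_deriv_lincomb[of F v t F v c 0] by simp

lemma has_curve_deriv_sum:
  "(\<And>i. i \<in> A \<Longrightarrow> has_curve_deriv (F i) (v i) t) \<Longrightarrow>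
    has_curve_deriv (\<lambda>s. \<Sum>i\<in>A. F i s) (\<Sum>i\<in>A. v i) t"
  by (induction A rule: infinite_finite_induct)
    (auto intro: has_curve_deriv_add has_curve_deriv_const)


section \<open>Lipschitz curves\<close>

text \<open>Boundedness of the difference quotients, tested seminorm by seminorm. The product form
  includes \<open>s = t\<close> and suits sums and products; \<open>lip_imp_lipschitz_curve\<close>
  connects it with Mackey completeness.\<close>

definition lip :: "(real \<Rightarrow> 'e::locally_convex_space) \<Rightarrow> bool"
  where "lip f \<longleftrightarrow> (\<forall>p. cs p \<longrightarrow>
    (\<exists>L. \<forall>s\<in>{0..1}. \<forall>t\<in>{0..1}. p (f t - f s) \<le> L * \<bar>t - s\<bar>))"

lemma lipI:
  assumes "\<And>p. cs p \<Longrightarrow>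
    \<exists>L. \<forall>s\<in>{0..1}. \<forall>t\<in>{0..1}. p (f t - f s) \<le> L * \<bar>t - s\<bar>"
  shows "lip f"
  using assms unfolding lip_def by blast

lemma lipE:
  assumes "lip f" "cs p"
  obtains L where "L \<ge> 0"
    "\<And>s t. s \<in> {0..1} \<Longrightarrow> t \<in> {0..1} \<Longrightarrow> p (f t - f s) \<le> L * \<bar>t - s\<bar>"
proof -
  obtain L where L: "\<And>s t. s \<in> {0..1} \<Longrightarrow> t \<in> {0..1} \<Longrightarrow> p (f t - f s) \<le> L * \<bar>t - s\<bar>"
    using assms unfolding lip_def by blast
  have "0 \<le> p (f 1 - f 0)" by (rule cs_nonneg[OF assms(2)])
  also have "\<dots> \<le> L * \<bar>1 - 0\<bar>" by (rule L) auto
  finally show ?thesis using that[OF _ L] by simp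
qed

lemma lip_boundedE:
  assumes "lip f" "cs p"
  obtains M where "M \<ge> 0" "\<And>t. t \<in> {0..1} \<Longrightarrow> p (f t) \<le> M"
proof -
  obtain L where L: "L \<ge> 0"
    "\<And>s t. s \<in> {0..1} \<Longrightarrow> t \<in> {0..1} \<Longrightarrow> p (f t - f s) \<le> L * \<bar>t - s\<bar>"
    by (rule lipE[OF assms]) (rule that)
  show ?thesis
  proof (rule that)
    show "0 \<le> p (f 0) + L" using L(1) cs_nonneg[OF assms(2)] by simp
    fix t :: real assume t: "t \<in> {0..1}"
    have "p (f t) \<le> p (f t - f 0) + p (f 0)" using cs_add[OF assms(2), of "f t - f 0" "f 0"] by simp
    also have "p (f t - f 0) \<le> L * \<bar>t - 0\<bar>" by (rule L(2)) (use t in auto)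
    also have "\<dots> \<le> L * 1" using t L(1) by (intro mult_left_mono) auto
    finally show "p (f t) \<le> p (f 0) + L" by simp
  qed
qed

lemma lip_const: "lip (\<lambda>_. c)"
  by (rule lipI, rule exI[of _ 0]) (simp add: cs_zero)

lemma lip_add:
  assumes "lip f" "lip g"
  shows "lip (\<lambda>t. f t + g t)"
proof (rule lipI)
  fix p :: "'a \<Rightarrow> real" assume p: "cs p"
  obtain L where L: "\<forall>s\<in>{0..1}. \<forall>t\<in>{0..1}. p (f t - f s) \<le> L * \<bar>t - s\<bar>"
    using assms(1) p unfolding lip_def by blast
  obtain M where M: "\<forall>s\<in>{0..1}. \<forall>t\<in>{0..1}. p (g t - g s) \<le> M * \<bar>t - s\<bar>"
    using assms(2) p unfolding lip_def by blast
  have "p (f t + g t - (f s + g s)) \<le> (L + M) * \<bar>t - s\<bar>" if "s \<in> {0..1}" "t \<in> {0..1}" for s t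
    using cs_add[OF p, of "f t - f s" "g t - g s"] bspec[OF bspec[OF L that(1)] that(2)]
      bspec[OF bspec[OF M that(1)] that(2)] by (simp add: algebra_simps)
  then show "\<exists>L. \<forall>s\<in>{0..1}. \<forall>t\<in>{0..1}. p (f t + g t - (f s + g s)) \<le> L * \<bar>t - s\<bar>" by blast
qed

lemma lip_scaleR:
  assumes "lip f"
  shows "lip (\<lambda>t. c *\<^sub>R f t)"
proof (rule lipI)
  fix p :: "'a \<Rightarrow> real" assume p: "cs p"
  obtain L where "\<forall>s\<in>{0..1}. \<forall>t\<in>{0..1}. p (f t - f s) \<le> L * \<bar>t - s\<bar>"
    using assms p unfolding lip_def by blast
  then show "\<exists>L. \<forall>s\<in>{0..1}. \<forall>t\<in>{0..1}. p (c *\<^sub>R f t - c *\<^sub>R f s) \<le> L * \<bar>t - s\<bar>"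
    by (intro exI[of _ "\<bar>c\<bar> * L"])
      (auto simp: cs_scaleR[OF p] mult.assoc simp flip: scaleR_diff_right intro!: mult_left_mono)
qed

lemma lip_minus: "lip f \<Longrightarrow> lip (\<lambda>t. - f t)"
  using lip_scaleR[of f "-1"] by simp

lemma lip_diff: "lip f \<Longrightarrow> lip g \<Longrightarrow> lip (\<lambda>t. f t - g t)"
  using lip_add[of f "\<lambda>t. - g t"] lip_minus[of g] by simp

lemma lip_imp_continuous:
  assumes "lip f"
  shows "continuous_on {0..1} f"
  unfolding continuous_on_def
proof (intro ballI, rule iffD2[OF tendsto_iff_seminorms], intro allI impI)
  fix x and p :: "'a \<Rightarrow> real"
  assume x: "x \<in> {0..1::real}" and p: "cs p"
  obtain L where L: "\<And>s t. s \<in> {0..1} \<Longrightarrow> t \<in> {0..1} \<Longrightarrow> p (f t - f s) \<le> L * \<bar>t - s\<bar>"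
    by (rule lipE[OF assms p]) (rule that)
  show "((\<lambda>y. p (f y - f x)) \<longlongrightarrow> 0) (at x within {0..1})"
  proof (rule Lim_null_comparison)
    show "eventually (\<lambda>y. norm (p (f y - f x)) \<le> L * \<bar>y - x\<bar>) (at x within {0..1})"
      using L[OF x] cs_nonneg[OF p] by (auto simp: eventually_at_filter)
    show "((\<lambda>y. L * \<bar>y - x\<bar>) \<longlongrightarrow> 0) (at x within {0..1})"
      by (rule tendsto_eq_intros refl | simp)+
  qed
qed

lemma has_curve_deriv_imp_lip:
  assumes "\<And>t. t \<in> {0..1} \<Longrightarrow> has_curve_deriv F (f t) t"
    and "\<And>p. cs p \<Longrightarrow> \<exists>K. \<forall>t\<in>{0..1}. p (f t) \<le> K"
  shows "lip F"
proof (rule lipI)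
  fix p :: "'a \<Rightarrow> real" assume p: "cs p"
  then obtain K where "\<forall>t\<in>{0..1}. p (f t) \<le> K" using assms(2) by blast
  then show "\<exists>L. \<forall>s\<in>{0..1}. \<forall>t\<in>{0..1}. p (F t - F s) \<le> L * \<bar>t - s\<bar>"
    using curve_mean_value_const[OF assms(1) p, where K=K] by blast
qed

lemma has_curve_deriv_lip_imp_lip:
  assumes "\<And>t. t \<in> {0..1} \<Longrightarrow> has_curve_deriv F (f t) t" "lip f"
  shows "lip F"
proof (rule has_curve_deriv_imp_lip[OF assms(1)])
  fix p :: "'a \<Rightarrow> real" assume p: "cs p"
  obtain M where "\<And>t. t \<in> {0..1} \<Longrightarrow> p (f t) \<le> M"
    by (rule lip_boundedE[OF assms(2) p]) (rule that)
  then show "\<exists>K. \<forall>t\<in>{0..1}. p (f t) \<le> K" by blast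
qed

lemma vn_boundedI:
  fixes B :: "'e::locally_convex_space set"
  assumes "\<And>p. cs p \<Longrightarrow> \<exists>M. \<forall>x\<in>B. p x \<le> M"
  shows "vn_bounded B"
  unfolding vn_bounded_def
proof (intro allI impI)
  fix U :: "'e set" assume "open U \<and> 0 \<in> U"
  then obtain p where p: "cs p" "{x. p x < 1} \<subseteq> U"
    using cs_ballE by blast
  obtain M where M: "\<And>x. x \<in> B \<Longrightarrow> p x \<le> M" using assms[OF p(1)] by blast
  let ?r = "\<bar>M\<bar> + 1"
  show "\<exists>r>0. B \<subseteq> (\<lambda>x. r *\<^sub>R x) ` U"
  proof (intro exI[of _ ?r] conjI subsetI)
    fix x assume x: "x \<in> B"
    have "p (inverse ?r *\<^sub>R x) = inverse ?r * p x" by (simp add: cs_scaleR[OF p(1)])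
    also have "\<dots> < 1" using M[OF x] by (simp add: field_simps)
    finally have "x /\<^sub>R ?r \<in> U" using p(2) by blast
    moreover have "x = ?r *\<^sub>R (x /\<^sub>R ?r)" by simp
    ultimately show "x \<in> (\<lambda>x. ?r *\<^sub>R x) ` U" by (rule rev_image_eqI)
  qed simp
qed

lemma lip_imp_lipschitz_curve:
  assumes "lip f"
  shows "lipschitz_curve f"
  unfolding lipschitz_curve_def
proof (rule vn_boundedI)
  fix p :: "'a \<Rightarrow> real" assume p: "cs p"
  obtain L where L: "\<And>s t. s \<in> {0..1} \<Longrightarrow> t \<in> {0..1} \<Longrightarrow> p (f t - f s) \<le> L * \<bar>t - s\<bar>"
    by (rule lipE[OF assms p]) (rule that)
  have "p ((f t - f s) /\<^sub>R (t - s)) \<le> L" if st: "s \<in> {0..1}" "t \<in> {0..1}" "s \<noteq> t" for s t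
  proof -
    have "p ((f t - f s) /\<^sub>R (t - s)) = inverse \<bar>t - s\<bar> * p (f t - f s)"
      by (simp add: cs_scaleR[OF p])
    also have "\<dots> \<le> inverse \<bar>t - s\<bar> * (L * \<bar>t - s\<bar>)"
      by (intro mult_left_mono L st) simp
    also have "\<dots> = L" using st by (simp add: field_simps)
    finally show ?thesis .
  qed
  then show "\<exists>M. \<forall>x\<in>{(f t - f s) /\<^sub>R (t - s) |s t. s \<in> {0..1} \<and> t \<in> {0..1} \<and> s \<noteq> t}. p x \<le> M"
    by blast
qed

section \<open>Riemann integrals and primitives\<close>

text \<open>The scalar functions \<open>a\<close>, \<open>b\<close> are integrated in the gauge
  sense, so step functions may be used without a separate proof of Riemann integrability. A division
  that is fine for both gauges and has mesh below \<open>d\<close> makes the three sums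
  simultaneously close to their limits, and for the sums the inequality is just the triangle
  inequality.\<close>

lemma riemann_estimate:
  fixes f :: "real \<Rightarrow> 'e::locally_convex_space" and a b :: "real \<Rightarrow> real"
  assumes I: "has_riemann_integral f I" and p: "cs p"
    and a: "(a has_integral A) {0..1}" and b: "(b has_integral B) {0..1}"
    and le: "\<And>s. s \<in> {0..1} \<Longrightarrow> p (f s - a s *\<^sub>R v) \<le> b s"
  shows "p (I - A *\<^sub>R v) \<le> B"
proof (rule field_le_epsilon)
  fix e :: real assume e: "e > 0"
  \<comment> \<open>\<open>2 + p v\<close> counts the errors: \<open>h\<close> for the sum of
    \<open>f\<close>, \<open>h\<close> for the sum of \<open>b\<close>, and \<open>h * p v\<close>
    for the sum of \<open>a\<close>, which multiplies \<open>v\<close>.\<close>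
  define h where "h = e / (2 + p v)"
  have pv: "0 \<le> p v" by (rule cs_nonneg[OF p])
  have h: "h > 0" using e pv by (simp add: h_def)
  have V: "open {x. p x < h} \<and> 0 \<in> {x. p x < h}"
    using h by (simp add: open_cs_ball[OF p] cs_zero[OF p])
  from I[unfolded has_riemann_integral_def, rule_format, OF V] obtain d where d: "d > 0"
    "\<And>D. D tagged_division_of {0..1} \<Longrightarrow> (\<forall>(t, K)\<in>D. measure lborel K < d) \<Longrightarrow>
        (\<Sum>(t, K)\<in>D. measure lborel K *\<^sub>R f t) - I \<in> {x. p x < h}"
    by blast
  from a[unfolded has_integral_real, rule_format, OF h] obtain ga where ga: "gauge ga"
    "\<forall>D. D tagged_division_of {0..1} \<and> ga fine D \<longrightarrow>
      norm ((\<Sum>(x,k)\<in>D. measure lborel k *\<^sub>R a x) - A) < h"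
    by (elim exE conjE) (rule that)
  from b[unfolded has_integral_real, rule_format, OF h] obtain gb where gb: "gauge gb"
    "\<forall>D. D tagged_division_of {0..1} \<and> gb fine D \<longrightarrow>
      norm ((\<Sum>(x,k)\<in>D. measure lborel k *\<^sub>R b x) - B) < h"
    by (elim exE conjE) (rule that)
  \<comment> \<open>Pieces inside a ball of radius \<open>d/2\<close> about their tag have length
    below \<open>d\<close>, so fineness also controls the mesh.\<close>
  define g where "g x = ga x \<inter> gb x \<inter> ball x (d/2)" for x
  have "gauge g" unfolding g_def using ga gb d by (intro gauge_Int gauge_ball) auto
  then obtain D where D: "D tagged_division_of {0..1}" "g fine D"
    using fine_division_exists_real by blast
  have fine: "ga fine D" "gb fine D" "(\<lambda>x. ball x (d/2)) fine D"
    using D(2) unfolding g_def fine_def by blast+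
  have "measure lborel K < d" if K: "(t, K) \<in> D" for t K
  proof -
    obtain l u where lu: "K = cbox l u" using D(1) K by blast
    have t: "t \<in> K" using D(1) K by blast
    have "K \<subseteq> ball t (d/2)" using fine(3) K unfolding fine_def by blast
    moreover have "l \<in> K" "u \<in> K" using lu t by auto
    ultimately have "dist t l < d/2" "dist t u < d/2" by auto
    then show ?thesis using lu t by (auto simp: dist_real_def)
  qed
  note small = this
  let ?F = "\<Sum>(t, K)\<in>D. measure lborel K *\<^sub>R f t" and ?A = "\<Sum>(t, K)\<in>D. measure lborel K * a t"
    and ?B = "\<Sum>(t, K)\<in>D. measure lborel K * b t"
  have 1: "p (?F - I) < h" using d(2)[OF D(1)] small by blast
  have 2: "\<bar>?A - A\<bar> < h" using ga(2)[rule_format, OF conjI[OF D(1) fine(1)]] by simp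
  have 3: "?B < B + h" using gb(2)[rule_format, OF conjI[OF D(1) fine(2)]] by (simp add: abs_if split: if_splits)
  have "?F - ?A *\<^sub>R v =
      (\<Sum>(t, K)\<in>D. measure lborel K *\<^sub>R (f t - a t *\<^sub>R v))"
    by (simp add: scaleR_sum_left scaleR_diff_right sum_subtractf case_prod_unfold)
  also have "p \<dots> \<le> (\<Sum>(t, K)\<in>D. p (measure lborel K *\<^sub>R (f t - a t *\<^sub>R v)))"
    using cs_sum[OF p, of "\<lambda>(t, K). measure lborel K *\<^sub>R (f t - a t *\<^sub>R v)" D]
    by (simp add: case_prod_unfold)
  also have "\<dots> \<le> ?B"
  proof (rule sum_mono, clarify)
    fix t K assume K: "(t, K) \<in> D"
    then have "t \<in> {0..1}" using D(1) by (meson subsetD tagged_division_ofD(2,3))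
    then show "p (measure lborel K *\<^sub>R (f t - a t *\<^sub>R v)) \<le> measure lborel K * b t"
      using le by (simp add: cs_scaleR[OF p] mult_left_mono)
  qed
  finally have 4: "p (?F - ?A *\<^sub>R v) < B + h"
    using 3 by simp
  have "p (I - A *\<^sub>R v) \<le> p (I - ?F) +
      p (?F - A *\<^sub>R v)"
    by (rule cs_triangle[OF p])
  also have "p (?F - A *\<^sub>R v) \<le>
      p (?F - ?A *\<^sub>R v) +
      p (?A *\<^sub>R v - A *\<^sub>R v)"
    by (rule cs_triangle[OF p])
  also have "p (?A *\<^sub>R v - A *\<^sub>R v) \<le> h * p v"
    using 2 pv by (simp add: cs_scaleR[OF p] mult_right_mono flip: scaleR_diff_left)
  also have "p (I - ?F) < h"
    using 1 by (simp add: cs_minus_commute[OF p])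
  finally have "p (I - A *\<^sub>R v) \<le> h + (B + h + h * p v)"
    using 4 by simp
  also have "\<dots> = B + h * (2 + p v)" by (simp add: algebra_simps)
  also have "h * (2 + p v) = e" using pv by (simp add: h_def)
  finally show "p (I - A *\<^sub>R v) \<le> B + e" .
qed

lemma riemann_seminorm_le:
  assumes "has_riemann_integral f I" "cs p"
    and "\<And>s. s \<in> {0..1} \<Longrightarrow> p (f s - c) \<le> B"
  shows "p (I - c) \<le> B"
proof -
  have "p (I - 1 *\<^sub>R c) \<le> B"
    by (rule riemann_estimate[OF assms(1,2), where a = "\<lambda>_. 1" and b = "\<lambda>_. B"])
      (use has_integral_const_real[of _ 0 1] assms(3) in auto)
  then show ?thesis by simp
qed

lemma has_riemann_integral_diff:
  fixes f :: "real \<Rightarrow> 'e::locally_convex_space"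
  assumes "has_riemann_integral f I" "has_riemann_integral g J"
  shows "has_riemann_integral (\<lambda>s. f s - g s) (I - J)"
  unfolding has_riemann_integral_def
proof (intro allI impI)
  fix U :: "'e set" assume "open U \<and> 0 \<in> U"
  then obtain p where p: "cs p" "{x. p x < 1} \<subseteq> U"
    using cs_ballE by blast
  have V: "open {x. p x < 1/2} \<and> 0 \<in> {x. p x < 1/2}"
    by (intro conjI open_cs_ball[OF p(1)]) (simp add: cs_zero[OF p(1)])
  from assms(1)[unfolded has_riemann_integral_def, rule_format, OF V] obtain d1 where d1: "d1 > 0"
    "\<And>D. D tagged_division_of {0..1} \<Longrightarrow> (\<forall>(t, K)\<in>D. measure lborel K < d1) \<Longrightarrow>
        p ((\<Sum>(t, K)\<in>D. measure lborel K *\<^sub>R f t) - I) < 1/2"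
    by blast
  from assms(2)[unfolded has_riemann_integral_def, rule_format, OF V] obtain d2 where d2: "d2 > 0"
    "\<And>D. D tagged_division_of {0..1} \<Longrightarrow> (\<forall>(t, K)\<in>D. measure lborel K < d2) \<Longrightarrow>
        p ((\<Sum>(t, K)\<in>D. measure lborel K *\<^sub>R g t) - J) < 1/2"
    by blast
  have "(\<Sum>(t, K)\<in>D. measure lborel K *\<^sub>R (f t - g t)) - (I - J) \<in> U"
    if D: "D tagged_division_of {0..1} \<and> (\<forall>(t, K)\<in>D. measure lborel K < min d1 d2)" for D
  proof -
    let ?F = "\<Sum>(t, K)\<in>D. measure lborel K *\<^sub>R f t" and ?G = "\<Sum>(t, K)\<in>D. measure lborel K *\<^sub>R g t"
    have "(\<Sum>(t, K)\<in>D. measure lborel K *\<^sub>R (f t - g t)) - (I - J) =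
        (?F - I) - (?G - J)"
      by (simp add: scaleR_diff_right sum_subtractf case_prod_unfold)
    also have "p \<dots> \<le> p (?F - I) + p (?G - J)"
      by (rule cs_diff[OF p(1)])
    also have "\<dots> < 1/2 + 1/2"
      by (intro add_strict_mono d1(2) d2(2)) (use D in auto)
    finally show ?thesis using p(2) by auto
  qed
  then show "\<exists>\<delta>>0. \<forall>D. D tagged_division_of {0..1} \<and> (\<forall>(t, K)\<in>D. measure lborel K < \<delta>) \<longrightarrow>
      (\<Sum>(t, K)\<in>D. measure lborel K *\<^sub>R (f t - g t)) - (I - J) \<in> U"
    using d1(1) d2(1) by (intro exI[of _ "min d1 d2"]) auto
qed

text \<open>Only integrals over the whole of \<open>{0..1}\<close> are available, and cutting
  \<open>f\<close> off at \<open>t\<close> would destroy the Lipschitz property. Freezing it there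
  instead keeps \<open>f (min s t)\<close> Lipschitz; its integral differs from that of
  \<open>f\<close> over \<open>{0..t}\<close> by \<open>1 - t\<close> times \<open>f t\<close>,
  which is subtracted.\<close>

lemma primitive_exists:
  fixes f :: "real \<Rightarrow> 'e::locally_convex_space"
  assumes mc: "mackey_complete TYPE('e)" and f: "lip f"
  shows "\<exists>F. F 0 = 0 \<and> (\<forall>t\<in>{0..1}. has_curve_deriv F (f t) t)"
proof -
  have "lip (\<lambda>s. f (min s t))" if t: "t \<in> {0..1}" for t
  proof (rule lipI)
    fix p :: "'e \<Rightarrow> real" assume p: "cs p"
    obtain L where L: "L \<ge> 0"
      "\<And>s t. s \<in> {0..1} \<Longrightarrow> t \<in> {0..1} \<Longrightarrow> p (f t - f s) \<le> L * \<bar>t - s\<bar>"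
      by (rule lipE[OF f p]) (rule that)
    have "p (f (min r t) - f (min s t)) \<le> L * \<bar>r - s\<bar>" if "r \<in> {0..1}" "s \<in> {0..1}" for r s
    proof -
      have "p (f (min r t) - f (min s t)) \<le> L * \<bar>min r t - min s t\<bar>"
        by (rule L(2)) (use that t in auto)
      also have "\<dots> \<le> L * \<bar>r - s\<bar>" by (rule mult_left_mono[OF _ L(1)]) auto
      finally show ?thesis .
    qed
    then show "\<exists>L. \<forall>s\<in>{0..1}. \<forall>r\<in>{0..1}. p (f (min r t) - f (min s t)) \<le> L * \<bar>r - s\<bar>" by blast
  qed
  then have "\<forall>t\<in>{0..1}. \<exists>I. has_riemann_integral (\<lambda>s. f (min s t)) I"
    using mc lip_imp_lipschitz_curve unfolding mackey_complete_def by blast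
  then obtain R where R: "\<And>t. t \<in> {0..1} \<Longrightarrow> has_riemann_integral (\<lambda>s. f (min s t)) (R t)"
    by (meson bchoice)
  define F where "F t = R t - (1 - t) *\<^sub>R f t" for t
  have est: "p (F u - F t - (u - t) *\<^sub>R f t) \<le> L * (u - t) * (u - t)"
    if p: "cs p" and tu: "t \<in> {0..1}" "u \<in> {0..1}" "t \<le> u" and L: "L \<ge> 0"
      "\<And>s t. s \<in> {0..1} \<Longrightarrow> t \<in> {0..1} \<Longrightarrow> p (f t - f s) \<le> L * \<bar>t - s\<bar>"
    for p L t u
  proof -
    \<comment> \<open>After subtracting the contribution of \<open>{u..1}\<close>, the integrand
      vanishes outside \<open>{t..u}\<close> and is at most \<open>L * (u - t)\<close>
      inside.\<close>
    have eq: "F u - F t - (u - t) *\<^sub>R f t = (R u - R t) - (1 - u) *\<^sub>R (f u - f t)"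
      by (simp add: F_def algebra_simps)
    show ?thesis
      unfolding eq
    proof (rule riemann_estimate[OF has_riemann_integral_diff[OF R R] p])
      show "((\<lambda>s. if s \<in> {u..1} then 1 else 0) has_integral (1 - u)) {0..1}"
        using has_integral_const_real[of "1::real" u 1] tu by (subst has_integral_restrict) auto
      show "((\<lambda>s. if s \<in> {t..u} then L * (u - t) else 0) has_integral L * (u - t) * (u - t)) {0..1}"
        using has_integral_const_real[of "L * (u - t)" t u] tu
        by (subst has_integral_restrict) (auto simp: mult_ac)
      fix s :: real assume s: "s \<in> {0..1}"
      consider "s < t" | "t \<le> s" "s < u" | "t \<le> s" "u \<le> s" by linarith
      then show "p (f (min s u) - f (min s t) - (if s \<in> {u..1} then 1 else 0) *\<^sub>R (f u - f t)) \<le>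
          (if s \<in> {t..u} then L * (u - t) else 0)"
      proof cases
        case 1 then show ?thesis using tu by (simp add: cs_zero[OF p])
      next
        case 2
        have "p (f s - f t) \<le> L * \<bar>s - t\<bar>" by (rule L(2)) (use tu s in auto)
        also have "\<dots> \<le> L * (u - t)" using 2 by (intro mult_left_mono L(1)) auto
        finally show ?thesis using 2 by (simp add: min_absorb1 min_absorb2)
      next
        case 3
        then show ?thesis using tu s L(1) by (simp add: cs_zero[OF p] min_def)
      qed
    qed (use tu in auto)
  qed
  show ?thesis
  proof (intro exI[of _ F] conjI ballI curve_deriv_seminormI)
    show "F 0 = 0"
    proof (rule cs_eq_zeroI)
      fix p :: "'e \<Rightarrow> real" assume p: "cs p"
      have "p (R 0 - f 0) \<le> 0"
        by (rule riemann_seminorm_le[OF R p]) (auto simp: cs_zero[OF p])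
      then show "p (F 0) = 0" using cs_nonneg[OF p, of "R 0 - f 0"] by (simp add: F_def)
    qed
  next
    fix x :: real and p :: "'e \<Rightarrow> real" and e :: real
    assume x: "x \<in> {0..1}" and p: "cs p" and e: "e > 0"
    obtain L where L: "L \<ge> 0"
      "\<And>s t. s \<in> {0..1} \<Longrightarrow> t \<in> {0..1} \<Longrightarrow> p (f t - f s) \<le> L * \<bar>t - s\<bar>"
      by (rule lipE[OF f p]) (rule that)
    have bound: "p (F y - F x - (y - x) *\<^sub>R f x) \<le> (2 * L * \<bar>y - x\<bar>) * \<bar>y - x\<bar>"
      if y: "y \<in> {0..1}" for y
    proof (cases "x \<le> y")
      case True
      then have "p (F y - F x - (y - x) *\<^sub>R f x) \<le> L * (y - x) * (y - x)"
        by (intro est p x y L)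
      also have "\<dots> \<le> (2 * L * \<bar>y - x\<bar>) * \<bar>y - x\<bar>"
        using True L(1) by (intro mult_mono) auto
      finally show ?thesis .
    next
      case False
      \<comment> \<open>\<open>est\<close> has the left end as base point. For \<open>y < x\<close>
        the base point is moved from \<open>y\<close> to \<open>x\<close>, which costs a second term
        \<open>L * (x - y) * (x - y)\<close>.\<close>
      then have "p (F x - F y - (x - y) *\<^sub>R f y) \<le> L * (x - y) * (x - y)"
        by (intro est p x y L) auto
      moreover have "F y - F x - (y - x) *\<^sub>R f x = (x - y) *\<^sub>R (f x - f y) - (F x - F y - (x - y) *\<^sub>R f y)"
        by (simp add: algebra_simps)
      then have "p (F y - F x - (y - x) *\<^sub>R f x) \<le> p ((x - y) *\<^sub>R (f x - f y)) + p (F x - F y - (x - y) *\<^sub>R f y)"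
        by (simp only: cs_diff[OF p])
      moreover have "p ((x - y) *\<^sub>R (f x - f y)) \<le> L * (x - y) * (x - y)"
      proof -
        have "p (f x - f y) \<le> L * (x - y)" using L(2)[OF y x] False by simp
        then have "\<bar>x - y\<bar> * p (f x - f y) \<le> \<bar>x - y\<bar> * (L * (x - y))"
          by (rule mult_left_mono) simp
        then show ?thesis using False by (simp add: cs_scaleR[OF p] mult_ac)
      qed
      moreover have "(2 * L * \<bar>y - x\<bar>) * \<bar>y - x\<bar> = L * (x - y) * (x - y) + L * (x - y) * (x - y)"
        using False by simp
      ultimately show ?thesis by linarith
    qed
    show "\<exists>d>0. \<forall>y\<in>{0..1}. \<bar>y - x\<bar> < d \<longrightarrow> p (F y - F x - (y - x) *\<^sub>R f x) \<le> e * \<bar>y - x\<bar>"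
    proof (intro exI[of _ "e / (2 * L + 1)"] conjI ballI impI)
      show "0 < e / (2 * L + 1)" using e L(1) by simp
      fix y assume y: "y \<in> {0..1}" "\<bar>y - x\<bar> < e / (2 * L + 1)"
      have "2 * L * \<bar>y - x\<bar> \<le> (2 * L + 1) * \<bar>y - x\<bar>" by (simp add: algebra_simps)
      also have "\<dots> \<le> e" using y(2) L(1) by (simp add: field_simps)
      finally have "(2 * L * \<bar>y - x\<bar>) * \<bar>y - x\<bar> \<le> e * \<bar>y - x\<bar>" by (rule mult_right_mono) simp
      then show "p (F y - F x - (y - x) *\<^sub>R f x) \<le> e * \<bar>y - x\<bar>" using bound[OF y(1)] by simp
    qed
  qed
qed

definition primitive :: "(real \<Rightarrow> 'e::locally_convex_space) \<Rightarrow> real \<Rightarrow> 'e"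
  where "primitive f = (SOME F. F 0 = 0 \<and> (\<forall>t\<in>{0..1}. has_curve_deriv F (f t) t))"

lemma
  fixes f :: "real \<Rightarrow> 'e::locally_convex_space"
  assumes "mackey_complete TYPE('e)" "lip f"
  shows primitive_0: "primitive f 0 = 0"
    and primitive_deriv: "t \<in> {0..1} \<Longrightarrow> has_curve_deriv (primitive f) (f t) t"
proof -
  have *: "primitive f 0 = 0 \<and> (\<forall>t\<in>{0..1}. has_curve_deriv (primitive f) (f t) t)"
    unfolding primitive_def by (rule someI_ex[OF primitive_exists[OF assms]])
  then show "primitive f 0 = 0" ..
  show "t \<in> {0..1} \<Longrightarrow> has_curve_deriv (primitive f) (f t) t" by (rule bspec[OF conjunct2[OF *]])
qed

lemma primitive_unique:
  fixes f :: "real \<Rightarrow> 'e::locally_convex_space"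
  assumes "mackey_complete TYPE('e)" "lip f" "t \<in> {0..1}"
    and F: "\<And>t. t \<in> {0..1} \<Longrightarrow> has_curve_deriv F (f t) t"
  shows "primitive f t = F t - F 0"
proof -
  have "primitive f t - F t = primitive f 0 - F 0"
  proof (rule curve_deriv_zero_const[OF _ assms(3)])
    fix t :: real assume "t \<in> {0..1}"
    from has_curve_deriv_diff[OF primitive_deriv[OF assms(1,2) this] F[OF this]]
    show "has_curve_deriv (\<lambda>t. primitive f t - F t) 0 t" by simp
  qed
  then show ?thesis by (simp add: primitive_0[OF assms(1,2)] algebra_simps)
qed

lemma lip_primitive:
  fixes f :: "real \<Rightarrow> 'e::locally_convex_space"
  assumes "mackey_complete TYPE('e)" "lip f"
  shows "lip (primitive f)"
  by (rule has_curve_deriv_lip_imp_lip[OF primitive_deriv[OF assms] assms(2)])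

lemma primitive_bound:
  fixes f :: "real \<Rightarrow> 'e::locally_convex_space"
  assumes "mackey_complete TYPE('e)" "lip f" "cs p" "t \<in> {0..1}"
    and "\<And>t. t \<in> {0..1} \<Longrightarrow> p (f t) \<le> K"
  shows "p (primitive f t) \<le> K"
proof -
  have "0 \<le> p (f 0)" by (rule cs_nonneg[OF assms(3)])
  then have K: "K \<ge> 0" using assms(5)[of 0] by simp
  have "p (primitive f t - primitive f 0) \<le> K * \<bar>t - 0\<bar>"
    by (rule curve_mean_value_const[OF primitive_deriv[OF assms(1,2)] assms(3,5)])
      (use assms(4) in auto)
  also have "\<dots> \<le> K * 1" using K assms(4) by (intro mult_left_mono) auto
  finally show ?thesis by (simp add: primitive_0[OF assms(1,2)])
qed

section \<open>Series summed by integration\<close>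

text \<open>The positive part of a parabola with zeros \<open>(1/2) ^ Suc n\<close> and
  \<open>(1/2) ^ n\<close>. Different \<open>n\<close> have disjoint supports, the Lipschitz
  constant \<open>2\<close> serves all \<open>n\<close>, and the integral is a sixth of the cube of
  the length \<open>(1/2) ^ Suc n\<close>, which is where the powers of \<open>8\<close> come
  from.\<close>

definition bump :: "nat \<Rightarrow> real \<Rightarrow> real"
  where "bump n t = max 0 ((t - (1/2) ^ Suc n) * ((1/2) ^ n - t))"

lemma half_power:
  "0 \<le> (1/2::real) ^ n" "(1/2::real) ^ n \<le> 1" "(1/2::real) ^ Suc n \<le> (1/2) ^ n"
  using power_le_one[of "1/2::real" n] by auto

text \<open>\<open>max 0\<close> does not increase distances, and the difference of the two
  quadratic values factors as \<open>(t - s) * (l + u - t - s)\<close> with a second factor between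
  \<open>-2\<close> and \<open>2\<close>.\<close>

lemma bump_lipschitz:
  assumes "s \<in> {0..1}" "t \<in> {0..1}"
  shows "\<bar>bump n t - bump n s\<bar> \<le> 2 * \<bar>t - s\<bar>"
proof -
  define l u :: real where "l = (1/2) ^ Suc n" and "u = (1/2) ^ n"
  have lu: "0 \<le> l" "0 \<le> u" "l \<le> 1" "u \<le> 1" unfolding l_def u_def by (intro half_power)+
  have "\<bar>bump n t - bump n s\<bar> \<le> \<bar>(t - l) * (u - t) - (s - l) * (u - s)\<bar>"
    unfolding bump_def l_def[symmetric] u_def[symmetric] by linarith
  also have "(t - l) * (u - t) - (s - l) * (u - s) = (t - s) * (l + u - t - s)"
    by (simp add: algebra_simps)
  also have "\<bar>\<dots>\<bar> = \<bar>t - s\<bar> * \<bar>l + u - t - s\<bar>" by (rule abs_mult)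
  also have "\<dots> \<le> \<bar>t - s\<bar> * 2"
    by (rule mult_left_mono) (use assms lu in \<open>auto simp: abs_le_iff\<close>)
  finally show ?thesis by simp
qed

lemma bump_nonneg: "0 \<le> bump n t"
  by (simp add: bump_def)

lemma bump_le_1:
  assumes "t \<in> {0..1}"
  shows "bump n t \<le> 1"
proof -
  define l u :: real where "l = (1/2) ^ Suc n" and "u = (1/2) ^ n"
  have lu: "0 \<le> l" "0 \<le> u" "l \<le> 1" "u \<le> 1" unfolding l_def u_def by (intro half_power)+
  have "\<bar>(t - l) * (u - t)\<bar> \<le> 1 * 1"
    unfolding abs_mult by (intro mult_mono) (use assms lu in \<open>auto simp: abs_le_iff\<close>)
  then show ?thesis by (simp add: bump_def l_def u_def abs_le_iff)
qed

lemma bump_nonzeroD: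
  assumes "bump n t \<noteq> 0"
  shows "(1/2) ^ Suc n < t" "t < (1/2) ^ n"
proof -
  have "(t - (1/2) ^ Suc n) * ((1/2) ^ n - t) > 0" using assms unfolding bump_def by linarith
  then show "(1/2) ^ Suc n < t" "t < (1/2) ^ n"
    unfolding zero_less_mult_iff using half_power(3)[of n] by linarith+
qed

lemma bump_support: "\<exists>N. \<forall>n\<ge>N. bump n t = 0"
proof (cases "t > 0")
  case True
  then obtain N where N: "(1/2) ^ N < t" using real_arch_pow_inv[of t "1/2"] by auto
  have "bump n t = 0" if "n \<ge> N" for n
  proof (rule ccontr)
    assume "bump n t \<noteq> 0"
    then have "t < (1/2) ^ n" by (rule bump_nonzeroD)
    also have "\<dots> \<le> (1/2) ^ N" using that by (intro power_decreasing) auto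
    finally show False using N by simp
  qed
  then show ?thesis by blast
next
  case False
  have "bump n t = 0" for n
  proof (rule ccontr)
    assume "bump n t \<noteq> 0"
    then have "(1/2) ^ Suc n < t" by (rule bump_nonzeroD)
    moreover have "0 < (1/2::real) ^ Suc n" by simp
    ultimately show False using False by linarith
  qed
  then show ?thesis by blast
qed

lemma has_integral_bump: "(bump n has_integral (1 / (6 * 8 ^ Suc n))) {0..1}"
proof -
  define l u :: real where "l = (1/2) ^ Suc n" and "u = (1/2) ^ n"
  have lu: "0 \<le> l" "l \<le> u" "u \<le> 1" unfolding l_def u_def by (intro half_power)+
  define G where "G t = (l + u) * t ^ 2 / 2 - l * u * t - t ^ 3 / 3" for t
  have "((\<lambda>t. (t - l) * (u - t)) has_integral (G u - G l)) {l..u}"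
  proof (rule fundamental_theorem_of_calculus[OF lu(2)])
    fix t assume "t \<in> {l..u}"
    have "(G has_real_derivative (t - l) * (u - t)) (at t within {l..u})"
      unfolding G_def by (auto intro!: derivative_eq_intros simp: algebra_simps power2_eq_square simp del: power_Suc)
    then show "(G has_vector_derivative (t - l) * (u - t)) (at t within {l..u})"
      by (simp only: has_real_derivative_iff_has_vector_derivative)
  qed
  also have "G u - G l = (u - l) ^ 3 / 6"
    by (simp add: G_def field_simps power2_eq_square power3_eq_cube del: power_Suc)
  also have "(u - l) ^ 3 / 6 = 1 / (6 * 8 ^ Suc n)"
  proof -
    have "u - l = (1/2) ^ Suc n" by (simp add: l_def u_def)
    then have "(u - l) ^ 3 = ((1/2) ^ 3) ^ Suc n" by (simp only: power_mult[symmetric] mult.commute)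
    also have "(1/2::real) ^ 3 = 1 / 8" by (simp add: power3_eq_cube)
    finally show ?thesis by (simp add: power_divide del: power_Suc)
  qed
  finally have "((\<lambda>t. (t - l) * (u - t)) has_integral (1 / (6 * 8 ^ Suc n))) {l..u}" .
  then have "((\<lambda>t. if t \<in> {l..u} then (t - l) * (u - t) else 0) has_integral (1 / (6 * 8 ^ Suc n))) {0..1}"
    using lu by (subst has_integral_restrict) auto
  moreover have "(\<lambda>t. if t \<in> {l..u} then (t - l) * (u - t) else 0) = bump n"
  proof
    fix t show "(if t \<in> {l..u} then (t - l) * (u - t) else 0) = bump n t"
    proof (cases "t \<in> {l..u}")
      case True then show ?thesis by (simp add: bump_def l_def[symmetric] u_def[symmetric] del: power_Suc)
    next
      case False
      have "bump n t = 0"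
      proof (rule ccontr)
        assume "bump n t \<noteq> 0"
        from bump_nonzeroD[OF this] show False
          using False unfolding l_def u_def by simp
      qed
      then show ?thesis using False by auto
    qed
  qed
  ultimately show ?thesis by simp
qed

text \<open>Mackey completeness provides some Riemann integral, and \<open>riemann_estimate\<close>
  with \<open>b = 0\<close> identifies it through the gauge integral of the scalar factor.\<close>

lemma has_riemann_integral_scaleR_const:
  fixes v :: "'e::locally_convex_space"
  assumes mc: "mackey_complete TYPE('e)" and A: "(a has_integral A) {0..1}"
    and lip: "\<And>s t. s \<in> {0..1} \<Longrightarrow> t \<in> {0..1} \<Longrightarrow> \<bar>a t - a s\<bar> \<le> L * \<bar>t - s\<bar>"
  shows "has_riemann_integral (\<lambda>s. a s *\<^sub>R v) (A *\<^sub>R v)"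
proof -
  have "lip (\<lambda>s. a s *\<^sub>R v)"
  proof (rule lipI)
    fix p :: "'e \<Rightarrow> real" assume p: "cs p"
    have "p (a t *\<^sub>R v - a s *\<^sub>R v) \<le> (L * p v) * \<bar>t - s\<bar>" if "s \<in> {0..1}" "t \<in> {0..1}" for s t
    proof -
      have "p (a t *\<^sub>R v - a s *\<^sub>R v) = \<bar>a t - a s\<bar> * p v"
        by (simp add: cs_scaleR[OF p] flip: scaleR_diff_left)
      also have "\<dots> \<le> (L * \<bar>t - s\<bar>) * p v" by (intro mult_right_mono lip that cs_nonneg[OF p])
      finally show ?thesis by (simp add: mult_ac)
    qed
    then show "\<exists>L. \<forall>s\<in>{0..1}. \<forall>t\<in>{0..1}. p (a t *\<^sub>R v - a s *\<^sub>R v) \<le> L * \<bar>t - s\<bar>" by blast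
  qed
  then obtain J where J: "has_riemann_integral (\<lambda>s. a s *\<^sub>R v) J"
    using mc lip_imp_lipschitz_curve unfolding mackey_complete_def by blast
  have "J = A *\<^sub>R v"
  proof (rule cs_eqI)
    fix p :: "'e \<Rightarrow> real" assume p: "cs p"
    have "p (J - A *\<^sub>R v) \<le> 0"
      by (rule riemann_estimate[OF J p A, of "\<lambda>_. 0"]) (auto simp: cs_zero[OF p])
    then show "p (J - A *\<^sub>R v) = 0" using cs_nonneg[OF p, of "J - A *\<^sub>R v"] by simp
  qed
  then show ?thesis using J by simp
qed

text \<open>The sum is the Riemann integral of a Lipschitz curve that runs through multiples of the terms,
  the \<open>n\<close>-th one on the interval from \<open>2\<^sup>-\<^sup>n\<^sup>-\<^sup>1\<close> to \<open>2\<^sup>-\<^sup>n\<close>.\<close>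

lemma fast_series_converges:
  fixes x :: "nat \<Rightarrow> 'e::locally_convex_space"
  assumes mc: "mackey_complete TYPE('e)"
    and sm: "\<And>p. cs p \<Longrightarrow> summable (\<lambda>n. 8 ^ n * p (x n))"
  shows "\<exists>s. (\<lambda>N. \<Sum>n<N. x n) \<longlonglongrightarrow> s"
proof -
  \<comment> \<open>The reciprocal of the integral of \<open>bump n\<close>, so that the
    \<open>n\<close>-th summand of \<open>f\<close> integrates to exactly
    \<open>x n\<close>.\<close>
  define c :: "nat \<Rightarrow> real" where "c n = 6 * 8 ^ Suc n" for n
  have c0: "c n \<ge> 0" for n by (simp add: c_def)
  define f where "f t = (\<Sum>n | bump n t \<noteq> 0. (c n * bump n t) *\<^sub>R x n)" for t
  define S where "S M t = (\<Sum>n<M. (c n * bump n t) *\<^sub>R x n)" for M t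
  have f_eq: "\<exists>M0. \<forall>M\<ge>M0. f t = S M t" for t
  proof -
    obtain N where N: "\<And>n. n \<ge> N \<Longrightarrow> bump n t = 0" using bump_support[of t] by blast
    have "f t = S M t" if "M \<ge> N" for M
      unfolding f_def S_def
    proof (rule sum.mono_neutral_left)
      show "{n. bump n t \<noteq> 0} \<subseteq> {..<M}"
      proof
        fix n assume "n \<in> {n. bump n t \<noteq> 0}"
        then have "\<not> n \<ge> N" using N by blast
        then show "n \<in> {..<M}" using that by simp
      qed
    qed auto
    then show ?thesis by blast
  qed
  \<comment> \<open>The factor is \<open>48 = 6 * 8\<close>, since
    \<open>c n = 48 * 8 ^ n\<close>.\<close>
  have sc: "summable (\<lambda>n. c n * p (x n))" if "cs p" for p
    using summable_mult[OF sm[OF that], of 48] by (simp add: c_def mult_ac)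
  have cp0: "0 \<le> c n * p (x n)" if "cs p" for p n
    by (intro mult_nonneg_nonneg c0 cs_nonneg[OF that])
  have "lip f"
  proof (rule lipI)
    fix p :: "'e \<Rightarrow> real" assume p: "cs p"
    have "p (f t - f s) \<le> (2 * (\<Sum>n. c n * p (x n))) * \<bar>t - s\<bar>" if st: "s \<in> {0..1}" "t \<in> {0..1}" for s t
    proof -
      obtain M1 where M1: "\<And>M. M \<ge> M1 \<Longrightarrow> f s = S M s" using f_eq by blast
      obtain M2 where M2: "\<And>M. M \<ge> M2 \<Longrightarrow> f t = S M t" using f_eq by blast
      let ?M = "max M1 M2"
      have "f t - f s = (\<Sum>n<?M. (c n * (bump n t - bump n s)) *\<^sub>R x n)"
        by (simp add: M1[of ?M] M2[of ?M] S_def right_diff_distrib scaleR_diff_left sum_subtractf)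
      also have "p \<dots> \<le> (\<Sum>n<?M. p ((c n * (bump n t - bump n s)) *\<^sub>R x n))" by (rule cs_sum[OF p])
      also have "\<dots> \<le> (\<Sum>n<?M. (2 * \<bar>t - s\<bar>) * (c n * p (x n)))"
      proof (rule sum_mono)
        fix n
        have "p ((c n * (bump n t - bump n s)) *\<^sub>R x n) = \<bar>bump n t - bump n s\<bar> * (c n * p (x n))"
          using c0[of n] by (simp add: cs_scaleR[OF p] abs_mult)
        also have "\<dots> \<le> (2 * \<bar>t - s\<bar>) * (c n * p (x n))"
          by (intro mult_right_mono bump_lipschitz st cp0 p)
        finally show "p ((c n * (bump n t - bump n s)) *\<^sub>R x n) \<le> (2 * \<bar>t - s\<bar>) * (c n * p (x n))" .
      qed
      also have "\<dots> = (2 * \<bar>t - s\<bar>) * (\<Sum>n<?M. c n * p (x n))" by (simp add: sum_distrib_left)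
      also have "\<dots> \<le> (2 * \<bar>t - s\<bar>) * (\<Sum>n. c n * p (x n))"
        by (intro mult_left_mono sum_le_suminf sc p) (auto intro: cp0 p)
      finally show ?thesis by (simp add: mult_ac)
    qed
    then show "\<exists>L. \<forall>s\<in>{0..1}. \<forall>t\<in>{0..1}. p (f t - f s) \<le> L * \<bar>t - s\<bar>" by blast
  qed
  then obtain I where I: "has_riemann_integral f I"
    using mc lip_imp_lipschitz_curve unfolding mackey_complete_def by blast
  \<comment> \<open>Removing finitely many bumps turns the error of a partial sum into the integral
    of a tail, which is estimated pointwise; limit and integral are never exchanged.\<close>
  have part: "has_riemann_integral (\<lambda>s. f s - S N s) (I - (\<Sum>n<N. x n))" for N
  proof (induction N)
    case (Suc N)
    have "((\<lambda>s. c N * bump N s) has_integral c N * (1 / (6 * 8 ^ Suc N))) {0..1}"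
      by (rule has_integral_mult_right[OF has_integral_bump])
    then have int: "((\<lambda>s. c N * bump N s) has_integral 1) {0..1}" by (simp add: c_def)
    have "has_riemann_integral (\<lambda>s. (c N * bump N s) *\<^sub>R x N) (1 *\<^sub>R x N)"
    proof (rule has_riemann_integral_scaleR_const[OF mc int])
      fix s t :: real assume st: "s \<in> {0..1}" "t \<in> {0..1}"
      have "\<bar>c N * bump N t - c N * bump N s\<bar> = c N * \<bar>bump N t - bump N s\<bar>"
        using c0[of N] by (simp add: abs_mult flip: right_diff_distrib)
      also have "\<dots> \<le> c N * (2 * \<bar>t - s\<bar>)" by (intro mult_left_mono bump_lipschitz st c0)
      finally show "\<bar>c N * bump N t - c N * bump N s\<bar> \<le> (2 * c N) * \<bar>t - s\<bar>" by simp
    qed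
    from has_riemann_integral_diff[OF Suc.IH this] show ?case by (simp add: S_def algebra_simps)
  qed (use I in \<open>simp add: S_def\<close>)
  have "(\<lambda>N. \<Sum>n<N. x n) \<longlonglongrightarrow> I"
  proof (rule iffD2[OF tendsto_iff_seminorms], intro allI impI)
    fix p :: "'e \<Rightarrow> real" assume p: "cs p"
    let ?S = "\<Sum>n. c n * p (x n)"
    have bound: "p ((\<Sum>n<N. x n) - I) \<le> ?S - (\<Sum>n<N. c n * p (x n))" for N
    proof -
      have "p (I - (\<Sum>n<N. x n) - 0) \<le> ?S - (\<Sum>n<N. c n * p (x n))"
      proof (rule riemann_seminorm_le[OF part p])
        fix s :: real assume s: "s \<in> {0..1}"
        obtain M1 where M1: "\<And>M. M \<ge> M1 \<Longrightarrow> f s = S M s" using f_eq by blast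
        let ?M = "max M1 N"
        have split: "(\<Sum>n<?M. h n) = (\<Sum>n<N. h n) + (\<Sum>n\<in>{N..<?M}. h n)" for h :: "nat \<Rightarrow> 'e"
          unfolding atLeast0LessThan[symmetric] by (rule sum.atLeastLessThan_concat[symmetric]) auto
        have split': "(\<Sum>n<?M. h n) = (\<Sum>n<N. h n) + (\<Sum>n\<in>{N..<?M}. h n)" for h :: "nat \<Rightarrow> real"
          unfolding atLeast0LessThan[symmetric] by (rule sum.atLeastLessThan_concat[symmetric]) auto
        have "f s - S N s - 0 = (\<Sum>n\<in>{N..<?M}. (c n * bump n s) *\<^sub>R x n)"
          by (simp add: M1[of ?M] S_def split)
        also have "p \<dots> \<le> (\<Sum>n\<in>{N..<?M}. p ((c n * bump n s) *\<^sub>R x n))" by (rule cs_sum[OF p])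
        also have "\<dots> \<le> (\<Sum>n\<in>{N..<?M}. c n * p (x n))"
        proof (rule sum_mono)
          fix n
          have "p ((c n * bump n s) *\<^sub>R x n) = bump n s * (c n * p (x n))"
            using c0[of n] bump_nonneg[of n s] by (simp add: cs_scaleR[OF p] abs_mult)
          also have "\<dots> \<le> 1 * (c n * p (x n))" by (intro mult_right_mono bump_le_1 s cp0 p)
          finally show "p ((c n * bump n s) *\<^sub>R x n) \<le> c n * p (x n)" by simp
        qed
        also have "\<dots> = (\<Sum>n<?M. c n * p (x n)) - (\<Sum>n<N. c n * p (x n))" by (simp add: split')
        also have "\<dots> \<le> ?S - (\<Sum>n<N. c n * p (x n))"
          by (intro diff_right_mono sum_le_suminf sc p) (auto intro: cp0 p)
        finally show "p (f s - S N s - 0) \<le> ?S - (\<Sum>n<N. c n * p (x n))" .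
      qed
      then show ?thesis by (simp add: cs_minus_commute[OF p])
    qed
    show "(\<lambda>N. p ((\<Sum>n<N. x n) - I)) \<longlonglongrightarrow> 0"
    proof (rule Lim_null_comparison)
      show "eventually (\<lambda>N. norm (p ((\<Sum>n<N. x n) - I)) \<le> ?S - (\<Sum>n<N. c n * p (x n))) sequentially"
        using bound cs_nonneg[OF p] by simp
      have "(\<lambda>N. ?S - (\<Sum>n<N. c n * p (x n))) \<longlonglongrightarrow> ?S - ?S"
        by (intro tendsto_diff tendsto_const summable_LIMSEQ sc p)
      then show "(\<lambda>N. ?S - (\<Sum>n<N. c n * p (x n))) \<longlonglongrightarrow> 0" by simp
    qed
  qed
  then show ?thesis by blast
qed

section \<open>Linear differential equations\<close>

text \<open>In the algebra, \<open>P\<close> will consist of the continuous submultiplicative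
  seminorms, in which products can be estimated. Domination allows Lipschitz conditions, equality
  and uniform limits to be checked on \<open>P\<close> alone.\<close>

locale dominating_seminorms =
  fixes P :: "('e::locally_convex_space \<Rightarrow> real) set"
  assumes P_cs: "r \<in> P \<Longrightarrow> cs r"
    and dominating: "cs p \<Longrightarrow> \<exists>r\<in>P. \<forall>x. p x \<le> r x"
begin

lemma lipI_dominating:
  assumes "\<And>r. r \<in> P \<Longrightarrow> \<exists>L. \<forall>s\<in>{0..1}. \<forall>t\<in>{0..1}. r (f t - f s) \<le> L * \<bar>t - s\<bar>"
  shows "lip f"
proof (rule lipI)
  fix p :: "'e \<Rightarrow> real" assume "cs p"
  then obtain r where r: "r \<in> P" "\<And>x. p x \<le> r x" using dominating by blast
  then obtain L where "\<forall>s\<in>{0..1}. \<forall>t\<in>{0..1}. r (f t - f s) \<le> L * \<bar>t - s\<bar>" using assms by blast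
  then show "\<exists>L. \<forall>s\<in>{0..1}. \<forall>t\<in>{0..1}. p (f t - f s) \<le> L * \<bar>t - s\<bar>"
    using r(2) order_trans by blast
qed

lemma eq_dominating:
  assumes "\<And>r. r \<in> P \<Longrightarrow> r (x - y) \<le> 0"
  shows "x = y"
proof (rule cs_eqI)
  fix p :: "'e \<Rightarrow> real" assume p: "cs p"
  then obtain r where r: "r \<in> P" "\<And>x. p x \<le> r x" using dominating by blast
  have "p (x - y) \<le> 0" using r(2)[of "x - y"] assms[OF r(1)] by linarith
  then show "p (x - y) = 0" using cs_nonneg[OF p, of "x - y"] by linarith
qed

text \<open>\<open>L_bound\<close> has the same seminorm on both sides, so \<open>n\<close>
  iterations give \<open>C ^ n / fact n\<close> instead of a growing chain of seminorms. Against
  this decay the weight \<open>8 ^ n\<close> of \<open>fast_series_converges\<close> is harmless: it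
  merely turns \<open>C\<close> into \<open>8 * C\<close>.\<close>

lemma linear_ode_exists:
  fixes L :: "real \<Rightarrow> 'e \<Rightarrow> 'e" and x0 :: 'e
  assumes mc: "mackey_complete TYPE('e)"
    and L_diff: "\<And>t x y. L t (x - y) = L t x - L t y"
    and L_bound: "\<And>r. r \<in> P \<Longrightarrow> \<exists>C\<ge>0. \<forall>t\<in>{0..1}. \<forall>x. r (L t x) \<le> C * r x"
    and L_lip: "\<And>r. r \<in> P \<Longrightarrow>
      \<exists>K. \<forall>s\<in>{0..1}. \<forall>t\<in>{0..1}. \<forall>x. r (L t x - L s x) \<le> K * \<bar>t - s\<bar> * r x"
  shows "\<exists>\<eta>. \<eta> 0 = x0 \<and> lip \<eta> \<and> (\<forall>t\<in>{0..1}. has_curve_deriv \<eta> (L t (\<eta> t)) t)"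
proof -
  have L0: "L t 0 = 0" for t using L_diff[of t 0 0] by simp
  have L_add: "L t (x + y) = L t x + L t y" for t x y
    using L_diff[of t "x + y" y] by (simp add: algebra_simps)
  have L_sum: "L t (sum f A) = (\<Sum>i\<in>A. L t (f i))" for t and f :: "nat \<Rightarrow> 'e" and A
    by (induction A rule: infinite_finite_induct) (simp_all add: L0 L_add)
  have lipL: "lip (\<lambda>t. L t (f t))" if f: "lip f" for f
  proof (rule lipI_dominating)
    fix r assume r: "r \<in> P"
    note cs = P_cs[OF r]
    obtain C where C: "C \<ge> 0" "\<And>t x. t \<in> {0..1} \<Longrightarrow> r (L t x) \<le> C * r x" using L_bound[OF r] by blast
    obtain K where K: "\<And>s t x. s \<in> {0..1} \<Longrightarrow> t \<in> {0..1} \<Longrightarrow> r (L t x - L s x) \<le> K * \<bar>t - s\<bar> * r x"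
      using L_lip[OF r] by blast
    obtain M where M: "M \<ge> 0" "\<And>t. t \<in> {0..1} \<Longrightarrow> r (f t) \<le> M"
      by (rule lip_boundedE[OF f cs]) (rule that)
    obtain A where A: "A \<ge> 0" "\<And>s t. s \<in> {0..1} \<Longrightarrow> t \<in> {0..1} \<Longrightarrow> r (f t - f s) \<le> A * \<bar>t - s\<bar>"
      by (rule lipE[OF f cs]) (rule that)
    have "r (L t (f t) - L s (f s)) \<le> (C * A + \<bar>K\<bar> * M) * \<bar>t - s\<bar>" if st: "s \<in> {0..1}" "t \<in> {0..1}" for s t
    proof -
      have "r (L t (f t) - L s (f s)) \<le> r (L t (f t) - L t (f s)) + r (L t (f s) - L s (f s))"
        by (rule cs_triangle[OF cs])
      also have "r (L t (f t) - L t (f s)) \<le> C * (A * \<bar>t - s\<bar>)"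
        unfolding L_diff[symmetric] by (intro order_trans[OF C(2)] mult_left_mono A C st)
      also have "r (L t (f s) - L s (f s)) \<le> \<bar>K\<bar> * \<bar>t - s\<bar> * M"
        by (rule order_trans[OF K], intro st, intro st)
          (intro mult_mono M st abs_ge_self order_refl, auto intro: cs_nonneg[OF cs])
      finally show ?thesis by (simp add: algebra_simps)
    qed
    then show "\<exists>K. \<forall>s\<in>{0..1}. \<forall>t\<in>{0..1}. r (L t (f t) - L s (f s)) \<le> K * \<bar>t - s\<bar>" by blast
  qed
  \<comment> \<open>\<open>it n\<close> is the \<open>n\<close>-th term of the Picard series, an
    \<open>n\<close>-fold iterated integral applied to \<open>x0\<close>; the partial sums are
    \<open>s N\<close> below.\<close>
  define it where "it n = ((\<lambda>f. primitive (\<lambda>t. L t (f t))) ^^ n) (\<lambda>_. x0)" for n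
  have it_0: "it 0 = (\<lambda>_. x0)" and it_Suc: "it (Suc n) = primitive (\<lambda>t. L t (it n t))" for n
    by (simp_all add: it_def)
  have lip_it: "lip (it n)" for n
    by (induction n) (auto simp: it_0 it_Suc intro: lip_const lip_primitive[OF mc] lipL)
  have it_Suc_0: "it (Suc n) 0 = 0" for n
    unfolding it_Suc by (rule primitive_0[OF mc lipL[OF lip_it]])
  have it_deriv: "has_curve_deriv (it (Suc n)) (L t (it n t)) t" if "t \<in> {0..1}" for n t
    unfolding it_Suc by (rule primitive_deriv[OF mc lipL[OF lip_it] that])
  define a where "a r C n = r x0 * C ^ n / fact n" for r :: "'e \<Rightarrow> real" and C :: real and n
  have it_bound': "r (it n t) \<le> a r C n * t ^ n"
    if r: "r \<in> P" and C: "C \<ge> 0" "\<And>t x. t \<in> {0..1} \<Longrightarrow> r (L t x) \<le> C * r x" and t: "t \<in> {0..1}" for r C n t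
    using t
  proof (induction n arbitrary: t)
    case (Suc n)
    \<comment> \<open>The majorant \<open>a r C (Suc n) * t ^ Suc n\<close> has derivative
      \<open>C * (a r C n * t ^ n)\<close>, exactly the bound that the induction hypothesis gives
      for the integrand.\<close>
    have "r (it (Suc n) t - it (Suc n) 0) \<le> a r C (Suc n) * t ^ Suc n - a r C (Suc n) * 0 ^ Suc n"
    proof (rule curve_mean_value[OF it_deriv P_cs[OF r], where g' = "\<lambda>t. C * (a r C n * t ^ n)"])
      fix s :: real assume s: "s \<in> {0..1}"
      show "r (L s (it n s)) \<le> C * (a r C n * s ^ n)"
        by (rule order_trans[OF C(2)[OF s]]) (intro mult_left_mono Suc.IH s C)
      have "((\<lambda>t. a r C (Suc n) * t ^ Suc n) has_real_derivative a r C (Suc n) * (real (Suc n) * s ^ n)) (at s within {0..1})"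
        using DERIV_cmult[OF DERIV_pow[of "Suc n" s "{0..1}"], of "a r C (Suc n)"]
        by (simp only: diff_Suc_Suc diff_zero)
      also have "a r C (Suc n) * (real (Suc n) * s ^ n) = C * (a r C n * s ^ n)"
        unfolding a_def fact_Suc power_Suc by (simp add: field_simps del: of_nat_Suc)
      finally show "((\<lambda>t. a r C (Suc n) * t ^ Suc n) has_real_derivative C * (a r C n * s ^ n)) (at s within {0..1})" .
    qed (use Suc.prems in auto)
    then show ?case by (simp add: it_Suc_0)
  qed (simp add: it_0 a_def)
  have a_nonneg: "0 \<le> a r C n" if "r \<in> P" "C \<ge> 0" for r C n
    using that cs_nonneg[OF P_cs[OF that(1)]] by (simp add: a_def)
  have it_bound: "r (it n t) \<le> a r C n"
    if r: "r \<in> P" and C: "C \<ge> 0" "\<And>t x. t \<in> {0..1} \<Longrightarrow> r (L t x) \<le> C * r x" and t: "t \<in> {0..1}" for r C n t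
  proof -
    have "r (it n t) \<le> a r C n * t ^ n" by (rule it_bound'[OF that])
    also have "\<dots> \<le> a r C n * 1" using t by (intro mult_left_mono a_nonneg r C) (auto intro: power_le_one)
    finally show ?thesis by simp
  qed
  have a_summable: "summable (\<lambda>n. 8 ^ n * a r C n)" for r C
    using summable_mult[OF summable_exp[of "8 * C"], of "r x0"]
    by (simp add: a_def power_mult_distrib divide_inverse mult_ac)
  have a_summable1: "summable (a r C)" for r C
  proof -
    have "a r C = (\<lambda>n. r x0 * (inverse (fact n) * C ^ n))"
      by (rule ext) (simp add: a_def divide_inverse mult_ac)
    then show ?thesis using summable_mult[OF summable_exp[of C], of "r x0"] by simp
  qed
  have "\<forall>t\<in>{0..1}. \<exists>s. (\<lambda>N. \<Sum>n<N. it n t) \<longlonglongrightarrow> s"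
  proof (intro ballI fast_series_converges[OF mc])
    fix t :: real and p :: "'e \<Rightarrow> real" assume t: "t \<in> {0..1}" and p: "cs p"
    obtain r where r: "r \<in> P" "\<And>x. p x \<le> r x" using dominating[OF p] by blast
    obtain C where C: "C \<ge> 0" "\<And>t x. t \<in> {0..1} \<Longrightarrow> r (L t x) \<le> C * r x" using L_bound[OF r(1)] by blast
    show "summable (\<lambda>n. 8 ^ n * p (it n t))"
    proof (rule summable_comparison_test'[OF a_summable[of r C]])
      fix n
      have "p (it n t) \<le> a r C n" using r(2)[of "it n t"] it_bound[OF r(1) C t, of n] by linarith
      then show "norm (8 ^ n * p (it n t)) \<le> 8 ^ n * a r C n" using cs_nonneg[OF p, of "it n t"] by simp
    qed
  qed
  from bchoice[OF this] obtain \<eta>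
    where \<eta>: "\<And>t. t \<in> {0..1} \<Longrightarrow> (\<lambda>N. \<Sum>n<N. it n t) \<longlonglongrightarrow> \<eta> t"
    by (elim exE) (rule that, erule bspec)
  define s where "s N t = (\<Sum>n<N. it n t)" for N t
  note \<eta> = \<eta>[folded s_def]
  \<comment> \<open>The constant term \<open>x0\<close> differentiates to zero, hence the shift from
    \<open>Suc N\<close> to \<open>N\<close>.\<close>
  have s_Suc_deriv: "has_curve_deriv (s (Suc N)) (L t (s N t)) t" if t: "t \<in> {0..1}" for N t
  proof -
    have "has_curve_deriv (\<lambda>t. x0 + (\<Sum>n<N. it (Suc n) t)) (0 + (\<Sum>n<N. L t (it n t))) t"
      by (intro has_curve_deriv_add has_curve_deriv_const has_curve_deriv_sum it_deriv t)
    moreover have "s (Suc N) = (\<lambda>t. x0 + (\<Sum>n<N. it (Suc n) t))"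
      by (simp add: s_def sum.lessThan_Suc_shift it_0 fun_eq_iff del: sum.lessThan_Suc)
    ultimately show ?thesis by (simp add: s_def L_sum)
  qed
  \<comment> \<open>The partial sums of positive length share a Lipschitz constant, which passes to
    the pointwise limit; this makes \<open>L t (\<eta> t)\<close> integrable.\<close>
  have lip_\<eta>: "lip \<eta>"
  proof (rule lipI_dominating)
    fix r assume r: "r \<in> P"
    note cs = P_cs[OF r]
    obtain C where C: "C \<ge> 0" "\<And>t x. t \<in> {0..1} \<Longrightarrow> r (L t x) \<le> C * r x" using L_bound[OF r] by blast
    let ?K = "C * suminf (a r C)"
    have "r (\<eta> t - \<eta> u) \<le> ?K * \<bar>t - u\<bar>" if tu: "u \<in> {0..1}" "t \<in> {0..1}" for t u
    proof (rule LIMSEQ_le_const2)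
      show "(\<lambda>N. r (s (Suc N) t - s (Suc N) u)) \<longlonglongrightarrow> r (\<eta> t - \<eta> u)"
        using cs_tendsto[OF cs tendsto_add[OF LIMSEQ_Suc[OF \<eta>[OF tu(2)]] tendsto_minus[OF LIMSEQ_Suc[OF \<eta>[OF tu(1)]]]]]
        by simp
      show "\<exists>N. \<forall>n\<ge>N. r (s (Suc n) t - s (Suc n) u) \<le> ?K * \<bar>t - u\<bar>"
      proof (intro exI allI impI)
        fix N
        show "r (s (Suc N) t - s (Suc N) u) \<le> ?K * \<bar>t - u\<bar>"
        proof (rule curve_mean_value_const[OF s_Suc_deriv cs _ tu])
          fix v :: real assume v: "v \<in> {0..1}"
          have "r (L v (s N v)) \<le> C * r (s N v)" by (rule C(2)[OF v])
          also have "r (s N v) \<le> (\<Sum>n<N. r (it n v))" unfolding s_def by (rule cs_sum[OF cs])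
          also have "\<dots> \<le> (\<Sum>n<N. a r C n)" by (intro sum_mono it_bound r C v)
          also have "\<dots> \<le> suminf (a r C)" by (intro sum_le_suminf a_summable1) (auto intro: a_nonneg r C)
          finally show "r (L v (s N v)) \<le> ?K" using C(1) by (simp add: mult_left_mono)
        qed
      qed
    qed
    then show "\<exists>K. \<forall>u\<in>{0..1}. \<forall>t\<in>{0..1}. r (\<eta> t - \<eta> u) \<le> K * \<bar>t - u\<bar>" by blast
  qed
  \<comment> \<open>Instead of differentiating the series term by term, the true primitive
    \<open>H\<close> is compared with the partial sums, whose derivatives converge uniformly to that
    of \<open>H\<close>.\<close>
  define H where "H = primitive (\<lambda>t. L t (\<eta> t))"
  have H_deriv: "has_curve_deriv H (L t (\<eta> t)) t" if "t \<in> {0..1}" for t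
    unfolding H_def by (rule primitive_deriv[OF mc lipL[OF lip_\<eta>] that])
  have H_0: "H 0 = 0" unfolding H_def by (rule primitive_0[OF mc lipL[OF lip_\<eta>]])
  have s_Suc_0: "s (Suc N) 0 = x0" for N
    by (simp add: s_def sum.lessThan_Suc_shift it_0 it_Suc_0 del: sum.lessThan_Suc)
  have H_eq: "\<eta> t = H t + x0" if t: "t \<in> {0..1}" for t
  proof -
    have "H t + x0 = \<eta> t"
    proof (rule eq_dominating)
      fix r assume r: "r \<in> P"
      note cs = P_cs[OF r]
      obtain C where C: "C \<ge> 0" "\<And>t x. t \<in> {0..1} \<Longrightarrow> r (L t x) \<le> C * r x" using L_bound[OF r] by blast
      \<comment> \<open>The tail of the majorant series bounds the error of \<open>s N\<close>
        uniformly in time.\<close>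
      define T where "T N = suminf (a r C) - (\<Sum>n<N. a r C n)" for N
      have T: "r (\<eta> u - s N u) \<le> T N" if u: "u \<in> {0..1}" for u N
      proof (rule LIMSEQ_le_const2)
        show "(\<lambda>M. r (s M u - s N u)) \<longlonglongrightarrow> r (\<eta> u - s N u)"
          using cs_tendsto[OF cs tendsto_add[OF \<eta>[OF u] tendsto_const[of "- s N u"]]] by simp
        have "r (s M u - s N u) \<le> T N" if "M \<ge> N" for M
        proof -
          have 1: "s M u = s N u + (\<Sum>n\<in>{N..<M}. it n u)"
            unfolding s_def atLeast0LessThan[symmetric]
            by (rule sum.atLeastLessThan_concat[symmetric]) (use that in auto)
          have 2: "(\<Sum>n<M. a r C n) = (\<Sum>n<N. a r C n) + (\<Sum>n\<in>{N..<M}. a r C n)"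
            unfolding atLeast0LessThan[symmetric]
            by (rule sum.atLeastLessThan_concat[symmetric]) (use that in auto)
          have "r (s M u - s N u) \<le> (\<Sum>n\<in>{N..<M}. r (it n u))"
            unfolding 1 using cs_sum[OF cs, of "\<lambda>n. it n u" "{N..<M}"] by simp
          also have "\<dots> \<le> (\<Sum>n\<in>{N..<M}. a r C n)" by (intro sum_mono it_bound r C u)
          also have "\<dots> = (\<Sum>n<M. a r C n) - (\<Sum>n<N. a r C n)" using 2 by simp
          also have "(\<Sum>n<M. a r C n) \<le> suminf (a r C)"
            by (intro sum_le_suminf a_summable1) (auto intro: a_nonneg r C)
          finally show ?thesis by (simp add: T_def)
        qed
        then show "\<exists>M0. \<forall>M\<ge>M0. r (s M u - s N u) \<le> T N" by blast
      qed
      have est: "r (H t + x0 - \<eta> t) \<le> C * T N + T (Suc N)" for N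
      proof -
        have "r ((H t - s (Suc N) t) - (H 0 - s (Suc N) 0)) \<le> (C * T N) * \<bar>t - 0\<bar>"
        proof (rule curve_mean_value_const[OF has_curve_deriv_diff[OF H_deriv s_Suc_deriv] cs _ _ t])
          fix v :: real assume v: "v \<in> {0..1}"
          have "r (L v (\<eta> v) - L v (s N v)) \<le> C * r (\<eta> v - s N v)"
            unfolding L_diff[symmetric] by (rule C(2)[OF v])
          also have "\<dots> \<le> C * T N" by (intro mult_left_mono T v C)
          finally show "r (L v (\<eta> v) - L v (s N v)) \<le> C * T N" .
        qed auto
        also have "\<dots> \<le> (C * T N) * 1"
        proof (rule mult_left_mono)
          have "0 \<le> T N" using T[OF t, of N] cs_nonneg[OF cs, of "\<eta> t - s N t"] by linarith
          then show "0 \<le> C * T N" using C(1) by simp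
        qed (use t in auto)
        finally have "r (H t + x0 - s (Suc N) t) \<le> C * T N"
          by (simp add: H_0 s_Suc_0 algebra_simps)
        moreover have "r (s (Suc N) t - \<eta> t) \<le> T (Suc N)"
          using T[OF t, of "Suc N"] by (simp add: cs_minus_commute[OF cs])
        ultimately show ?thesis using cs_triangle[OF cs, of "H t + x0" "\<eta> t" "s (Suc N) t"] by linarith
      qed
      have "T \<longlonglongrightarrow> suminf (a r C) - suminf (a r C)"
        unfolding T_def by (intro tendsto_diff tendsto_const summable_LIMSEQ a_summable1)
      then have T0: "T \<longlonglongrightarrow> 0" by simp
      have "(\<lambda>N. C * T N + T (Suc N)) \<longlonglongrightarrow> C * 0 + 0"
        by (intro tendsto_add tendsto_mult tendsto_const T0 LIMSEQ_Suc[OF T0])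
      then show "r (H t + x0 - \<eta> t) \<le> 0"
        using est by (intro LIMSEQ_le_const[of "\<lambda>N. C * T N + T (Suc N)"]) auto
    qed
    then show ?thesis ..
  qed
  show ?thesis
  proof (intro exI[of _ \<eta>] conjI ballI lip_\<eta>)
    show "\<eta> 0 = x0" by (simp add: H_eq H_0)
    fix t :: real assume t: "t \<in> {0..1}"
    have "has_curve_deriv (\<lambda>t. H t + x0) (L t (\<eta> t)) t"
      using has_curve_deriv_add[OF H_deriv[OF t] has_curve_deriv_const[of x0]] by simp
    then show "has_curve_deriv \<eta> (L t (\<eta> t)) t"
      using has_curve_deriv_cong[of \<eta> "\<lambda>t. H t + x0", OF H_eq t] by blast
  qed
qed

end

section \<open>Submultiplicative seminorms\<close>

definition submult :: "('a::times \<Rightarrow> real) \<Rightarrow> bool"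
  where "submult r \<longleftrightarrow> (\<forall>x y. r (x * y) \<le> r x * r y)"

abbreviation alg_units :: "'a::monoid_mult set"
  where "alg_units \<equiv> Units mult_monoid"

abbreviation alg_inv :: "'a::monoid_mult \<Rightarrow> 'a"
  where "alg_inv \<equiv> m_inv mult_monoid"

lemma monoid_mult_monoid: "monoid (mult_monoid :: 'a::monoid_mult monoid)"
  by (rule monoidI) (simp_all add: mult_monoid_def mult.assoc)

lemma alg_units_iff: "x \<in> alg_units \<longleftrightarrow> (\<exists>y. y * x = 1 \<and> x * y = 1)" for x :: "'a::monoid_mult"
  by (simp add: Units_def mult_monoid_def)

lemma alg_unitsI: "x * y = 1 \<Longrightarrow> y * x = 1 \<Longrightarrow> x \<in> alg_units" for x :: "'a::monoid_mult"
  unfolding alg_units_iff by blast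

lemma alg_inv_left: "x \<in> alg_units \<Longrightarrow> alg_inv x * x = 1" for x :: "'a::monoid_mult"
  using monoid.Units_l_inv[OF monoid_mult_monoid, of x] by (simp add: mult_monoid_def)

lemma alg_inv_right: "x \<in> alg_units \<Longrightarrow> x * alg_inv x = 1" for x :: "'a::monoid_mult"
  using monoid.Units_r_inv[OF monoid_mult_monoid, of x] by (simp add: mult_monoid_def)

lemma alg_inv_eqI:
  fixes x :: "'a::monoid_mult"
  assumes "x \<in> alg_units" "x * y = 1"
  shows "alg_inv x = y"
proof -
  have "alg_inv x = alg_inv x * (x * y)" using assms(2) by simp
  also have "\<dots> = y" by (simp add: mult.assoc[symmetric] alg_inv_left[OF assms(1)])
  finally show ?thesis .
qed

lemma one_in_alg_units: "(1::'a::monoid_mult) \<in> alg_units"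
  by (rule alg_unitsI[of _ 1]) auto

lemma alg_inv_one: "alg_inv (1::'a::monoid_mult) = 1"
  by (rule alg_inv_eqI[OF one_in_alg_units]) simp

lemma mult_continuous_seminorm:
  fixes a b :: "'a::{locally_convex_space, topological_semigroup_mult}"
  assumes p: "cs p" and e: "e > 0"
  obtains q where "cs q"
    "\<And>x y. q (x - a) < 1 \<Longrightarrow> q (y - b) < 1 \<Longrightarrow> p (x * y - a * b) < e"
proof -
  have "eventually (\<lambda>x. p (fst x * snd x - a * b) < e) (nhds a \<times>\<^sub>F nhds b)"
    by (rule tendsto_seminormD[OF tendsto_mult_Pair p e])
  then obtain A B where AB: "eventually A (nhds a)" "eventually B (nhds b)"
    "\<And>x y. A x \<Longrightarrow> B y \<Longrightarrow> p (x * y - a * b) < e"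
    unfolding eventually_prod_filter by auto
  obtain q1 where q1: "cs q1" "\<And>x. q1 (x - a) < 1 \<Longrightarrow> A x"
    by (rule eventually_nhds_seminorm[OF AB(1)]) (rule that)
  obtain q2 where q2: "cs q2" "\<And>x. q2 (x - b) < 1 \<Longrightarrow> B x"
    by (rule eventually_nhds_seminorm[OF AB(2)]) (rule that)
  show ?thesis
  proof (rule that[OF continuous_seminorm_sum2[OF q1(1) q2(1)]])
    fix x y assume "q1 (x - a) + q2 (x - a) < 1" "q1 (y - b) + q2 (y - b) < 1"
    then have "q1 (x - a) < 1" "q2 (y - b) < 1"
      using cs_nonneg[OF q1(1), of "y - b"] cs_nonneg[OF q2(1), of "x - a"] by linarith+
    then show "p (x * y - a * b) < e" using AB(3) q1(2) q2(2) by blast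
  qed
qed

text \<open>Using the scalar inequality for \<open>c\<close> and for its inverse gives
  equality.\<close>

lemma seminormI_le:
  fixes r :: "'a::real_vector \<Rightarrow> real"
  assumes add: "\<And>x y. r (x + y) \<le> r x + r y" and sc: "\<And>c x. r (c *\<^sub>R x) \<le> \<bar>c\<bar> * r x"
    and nn: "\<And>x. 0 \<le> r x"
  shows "seminorm scaleR r"
proof -
  have "r (c *\<^sub>R x) = \<bar>c\<bar> * r x" for c x
  proof (cases "c = 0")
    case True
    then show ?thesis using sc[of 0 x] nn[of 0] by simp
  next
    case False
    have "r x = r (inverse c *\<^sub>R (c *\<^sub>R x))" using False by simp
    also have "\<dots> \<le> \<bar>inverse c\<bar> * r (c *\<^sub>R x)" by (rule sc)
    finally have "\<bar>c\<bar> * r x \<le> r (c *\<^sub>R x)" using False by (simp add: field_simps)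
    then show ?thesis using sc[of c x] by simp
  qed
  then show ?thesis using add by (simp add: seminorm_def)
qed

text \<open>The infimum of all \<open>a\<close> with \<open>(a, x)\<close> in this set is the gauge of the absolutely convex hull of \<open>W\<close>.\<close>

inductive_set combinations :: "'a::real_vector set \<Rightarrow> (real \<times> 'a) set" for W :: "'a set"
  where
    zero: "(0, 0) \<in> combinations W"
  | step: "w \<in> W \<Longrightarrow> (a, x) \<in> combinations W \<Longrightarrow> (\<bar>c\<bar> + a, c *\<^sub>R w + x) \<in> combinations W"

lemma combinations_add:
  assumes "(a, x) \<in> combinations W" "(b, y) \<in> combinations W"
  shows "(a + b, x + y) \<in> combinations W"
  using assms(1)
proof (induction rule: combinations.induct)
  case (step w a x c)
  from combinations.step[OF step(1) step(3), of c] show ?case by (simp add: add.assoc)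
qed (use assms(2) in simp)

lemma combinations_scaleR:
  assumes "(a, x) \<in> combinations W"
  shows "(\<bar>c\<bar> * a, c *\<^sub>R x) \<in> combinations W"
  using assms
proof (induction rule: combinations.induct)
  case (step w a x d)
  from combinations.step[OF step(1) step(3), of "c * d"] show ?case
    by (simp add: algebra_simps abs_mult)
qed (simp add: combinations.zero)

lemma combinations_nonneg: "(a, x) \<in> combinations W \<Longrightarrow> 0 \<le> a"
  by (induction rule: combinations.induct) auto

text \<open>The gauge of the absolutely convex hull of a set closed under multiplication is
  submultiplicative, since weights multiply when combinations are multiplied out. That
  \<open>W\<close> contains the unit ball of \<open>q\<close> gives \<open>r \<le> q\<close> and so
  continuity, while \<open>p \<le> 1\<close> on \<open>W\<close> gives
  \<open>p \<le> r\<close>.\<close>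

lemma submult_gauge:
  fixes W :: "'a::{locally_convex_space, ring} set"
  assumes sl: "\<And>c x y::'a. (c *\<^sub>R x) * y = c *\<^sub>R (x * y)" and sr: "\<And>c x y::'a. x * (c *\<^sub>R y) = c *\<^sub>R (x * y)"
    and W_mult: "\<And>v w. v \<in> W \<Longrightarrow> w \<in> W \<Longrightarrow> v * w \<in> W"
    and q: "cs q" and qW: "\<And>x. q x \<le> 1 \<Longrightarrow> x \<in> W"
    and p: "cs p" and pW: "\<And>x. x \<in> W \<Longrightarrow> p x \<le> 1"
  shows "\<exists>r. cs r \<and> submult r \<and> (\<forall>x. p x \<le> r x)"
proof -
  define R where "R x = {a. (a, x) \<in> combinations W}" for x
  define r where "r x = Inf (R x)" for x
  have bdd: "bdd_below (R x)" for x
    unfolding R_def by (rule bdd_belowI[of _ 0]) (auto dest: combinations_nonneg)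
  \<comment> \<open>The summand \<open>e\<close> keeps the weight positive where
    \<open>q x = 0\<close>.\<close>
  have mem: "q x + e \<in> R x" if e: "e > 0" for x e
  proof -
    have qe: "q x + e > 0" using cs_nonneg[OF q, of x] e by linarith
    have "q (inverse (q x + e) *\<^sub>R x) = inverse (q x + e) * q x"
      using qe by (simp add: cs_scaleR[OF q])
    also have "\<dots> \<le> 1" using qe e by (simp add: field_simps)
    finally have "inverse (q x + e) *\<^sub>R x \<in> W" by (rule qW)
    from combinations.step[OF this combinations.zero, of "q x + e"] show ?thesis
      using qe by (simp add: R_def)
  qed
  then have ne: "R x \<noteq> {}" for x using zero_less_one by blast
  have r_le: "r x \<le> a" if "(a, x) \<in> combinations W" for a x
    unfolding r_def by (rule cInf_lower[OF _ bdd]) (use that in \<open>simp add: R_def\<close>)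
  have le_r: "z \<le> r x" if "\<And>a. (a, x) \<in> combinations W \<Longrightarrow> z \<le> a" for z x
    unfolding r_def by (rule cInf_greatest[OF ne]) (use that in \<open>simp add: R_def\<close>)
  have nn: "0 \<le> r x" for x by (rule le_r) (rule combinations_nonneg)
  have r_q: "r x \<le> q x" for x
  proof (rule field_le_epsilon)
    fix e :: real assume "e > 0"
    from mem[OF this] show "r x \<le> q x + e" by (intro r_le) (simp add: R_def)
  qed
  have add: "r (x + y) \<le> r x + r y" for x y
  proof -
    have "r (x + y) - r x \<le> r y"
    proof (rule le_r)
      fix b assume b: "(b, y) \<in> combinations W"
      have "r (x + y) - b \<le> r x"
      proof (rule le_r)
        fix a assume "(a, x) \<in> combinations W"
        from r_le[OF combinations_add[OF this b]] show "r (x + y) - b \<le> a" by simp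
      qed
      then show "r (x + y) - r x \<le> b" by simp
    qed
    then show ?thesis by simp
  qed
  have sc: "r (c *\<^sub>R x) \<le> \<bar>c\<bar> * r x" for c x
  proof (cases "c = 0")
    case True
    then show ?thesis using r_le[OF combinations.zero] by simp
  next
    case False
    have "r (c *\<^sub>R x) / \<bar>c\<bar> \<le> r x"
    proof (rule le_r)
      fix a assume "(a, x) \<in> combinations W"
      from r_le[OF combinations_scaleR[OF this, of c]] show "r (c *\<^sub>R x) / \<bar>c\<bar> \<le> a"
        using False by (simp add: field_simps)
    qed
    then show ?thesis using False by (simp add: field_simps)
  qed
  have comb_mult_left: "(a, v * x) \<in> combinations W" if "v \<in> W" "(a, x) \<in> combinations W" for v a x
    using that(2)
  proof (induction rule: combinations.induct)
    case (step w a x c)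
    from combinations.step[OF W_mult[OF that(1) step(1)] step(3), of c] show ?case
      by (simp add: distrib_left sr)
  qed (simp add: combinations.zero)
  have comb_mult: "(a * b, x * y) \<in> combinations W"
    if "(a, x) \<in> combinations W" "(b, y) \<in> combinations W" for a b x y
    using that(1)
  proof (induction rule: combinations.induct)
    case (step w a x c)
    from combinations_add[OF combinations_scaleR[OF comb_mult_left[OF step(1) that(2)], of c] step(3)]
    show ?case by (simp add: distrib_right sl)
  qed (simp add: combinations.zero)
  have mult: "r (x * y) \<le> r x * r y" for x y
  proof -
    \<comment> \<open>The infimum is taken over the weights of \<open>x\<close> and then over those
      of \<open>y\<close>. Each passage divides by the other factor, so the value zero is treated
      apart.\<close>
    have *: "r (x * y) \<le> r x * b" if b: "(b, y) \<in> combinations W" for b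
    proof (cases "b = 0")
      case True
      obtain a where "(a, x) \<in> combinations W" using ne[of x] unfolding R_def by blast
      from r_le[OF comb_mult[OF this b]] show ?thesis using True by simp
    next
      case False
      then have b0: "b > 0" using combinations_nonneg[OF b] by simp
      have "r (x * y) / b \<le> r x"
      proof (rule le_r)
        fix a assume "(a, x) \<in> combinations W"
        from r_le[OF comb_mult[OF this b]] show "r (x * y) / b \<le> a" using b0 by (simp add: field_simps)
      qed
      then show ?thesis using b0 by (simp add: field_simps)
    qed
    show ?thesis
    proof (cases "r x = 0")
      case True
      obtain b where "(b, y) \<in> combinations W" using ne[of y] unfolding R_def by blast
      from *[OF this] show ?thesis using True by simp
    next
      case False
      then have x0: "r x > 0" using nn[of x] by simp
      have "r (x * y) / r x \<le> r y"
      proof (rule le_r)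
        fix b assume "(b, y) \<in> combinations W"
        from *[OF this] show "r (x * y) / r x \<le> b" using x0 by (simp add: field_simps)
      qed
      then show ?thesis using x0 by (simp add: field_simps)
    qed
  qed
  have "p x \<le> a" if "(a, x) \<in> combinations W" for a x
    using that
  proof (induction rule: combinations.induct)
    case (step w a x c)
    have "p (c *\<^sub>R w + x) \<le> \<bar>c\<bar> * p w + p x"
      using cs_add[OF p, of "c *\<^sub>R w" x] by (simp add: cs_scaleR[OF p])
    also have "\<dots> \<le> \<bar>c\<bar> * 1 + a" by (intro add_mono mult_left_mono pW step) auto
    finally show ?case by simp
  qed (simp add: cs_zero[OF p])
  then have "p x \<le> r x" for x by (rule le_r)
  moreover have "cs r"
    by (rule continuous_seminormI[OF seminormI_le[OF add sc nn] q, of 1]) (use r_q in simp)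
  ultimately show ?thesis using mult unfolding submult_def by blast
qed

lemma submult_max:
  fixes r s :: "'a::{locally_convex_space, ring} \<Rightarrow> real"
  assumes r: "cs r" "submult r" and s: "cs s" "submult s"
  shows "cs (\<lambda>x. max (r x) (s x))" "submult (\<lambda>x. max (r x) (s x))"
proof -
  have nn: "0 \<le> r x" "0 \<le> s x" for x using r(1) s(1) by (simp_all add: cs_nonneg)
  have "seminorm scaleR (\<lambda>x. max (r x) (s x))"
  proof (rule seminormI_le)
    fix x y
    show "max (r (x + y)) (s (x + y)) \<le> max (r x) (s x) + max (r y) (s y)"
      using cs_add[OF r(1), of x y] cs_add[OF s(1), of x y] by linarith
    show "max (r (c *\<^sub>R x)) (s (c *\<^sub>R x)) \<le> \<bar>c\<bar> * max (r x) (s x)" for c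
      by (simp add: cs_scaleR[OF r(1)] cs_scaleR[OF s(1)] mult_left_mono)
    show "0 \<le> max (r x) (s x)" using nn(1)[of x] by simp
  qed
  then show "cs (\<lambda>x. max (r x) (s x))"
    using r(1) s(1) unfolding continuous_seminorm_def by (auto intro: continuous_on_max)
  show "submult (\<lambda>x. max (r x) (s x))"
    unfolding submult_def
  proof (intro allI max.boundedI)
    fix x y
    have "r (x * y) \<le> r x * r y" using r(2) by (simp add: submult_def)
    also have "\<dots> \<le> max (r x) (s x) * max (r y) (s y)"
      using nn[of x] nn[of y] by (intro mult_mono) auto
    finally show "r (x * y) \<le> max (r x) (s x) * max (r y) (s y)" .
    have "s (x * y) \<le> s x * s y" using s(2) by (simp add: submult_def)
    also have "\<dots> \<le> max (r x) (s x) * max (r y) (s y)"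
      using nn[of x] nn[of y] by (intro mult_mono) auto
    finally show "s (x * y) \<le> max (r x) (s x) * max (r y) (s y)" .
  qed
qed

text \<open>Stretching preserves submultiplicativity because \<open>c \<le> c * c\<close> for
  \<open>c \<ge> 1\<close>.\<close>

lemma submult_scale:
  fixes r :: "'a::{locally_convex_space, ring} \<Rightarrow> real"
  assumes r: "cs r" "submult r" and c: "c \<ge> 1"
  shows "cs (\<lambda>x. c * r x)" "submult (\<lambda>x. c * r x)"
proof -
  have "seminorm scaleR (\<lambda>x. c * r x)"
  proof (rule seminormI_le)
    fix x y
    have "c * r (x + y) \<le> c * (r x + r y)"
      using c by (intro mult_left_mono cs_add[OF r(1)]) auto
    then show "c * r (x + y) \<le> c * r x + c * r y" by (simp add: distrib_left)
    show "0 \<le> c * r x" using c cs_nonneg[OF r(1), of x] by simp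
  qed (simp add: cs_scaleR[OF r(1)])
  then show "cs (\<lambda>x. c * r x)" by (rule continuous_seminormI[OF _ r(1), of _ c]) simp
  show "submult (\<lambda>x. c * r x)"
    unfolding submult_def
  proof (intro allI)
    fix x y
    have nn: "0 \<le> r x * r y" using cs_nonneg[OF r(1)] by simp
    have "c * r (x * y) \<le> c * (r x * r y)"
      using r(2) c by (intro mult_left_mono) (auto simp: submult_def)
    also have "\<dots> \<le> c * (c * (r x * r y))"
      using c nn by (intro mult_left_mono) (auto simp: mult_le_cancel_right1)
    finally show "c * r (x * y) \<le> c * r x * (c * r y)" by (simp add: mult_ac)
  qed
qed

lemma (in continuous_inverse_algebra) mult_scaleR_left: "(r *\<^sub>R x) * y = r *\<^sub>R (x * y)" for x y :: 'a
  using scale_mult_left[of "of_real r" x y] by (simp add: scale_of_real)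

lemma (in continuous_inverse_algebra) mult_scaleR_right: "x * (r *\<^sub>R y) = r *\<^sub>R (x * y)" for x y :: 'a
  using scale_mult_right[of x "of_real r" y] by (simp add: scale_of_real)

text \<open>The unit ball of \<open>p\<close> contains a finite intersection of
  \<open>e\<close>-balls of seminorms from \<open>Q\<close>. Their maximum is again
  submultiplicative and dominates \<open>p\<close> up to a factor, which is absorbed by
  rescaling.\<close>

lemma (in continuous_inverse_algebra) locally_m_convex_dominating:
  fixes p :: "'a \<Rightarrow> real"
  assumes lmc: "locally_m_convex smul" and p: "cs p"
  shows "\<exists>r. cs r \<and> submult r \<and> (\<forall>x. p x \<le> r x)"
proof -
  obtain Q where Q: "\<And>q. q \<in> Q \<Longrightarrow> seminorm smul q"
    "\<And>q x y. q \<in> Q \<Longrightarrow> q (x * y) \<le> q x * q y" "topology_from_seminorms Q"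
    using lmc unfolding locally_m_convex_def by blast
  note top = Q(3)[unfolded topology_from_seminorms_def, rule_format]
  have snQ: "seminorm scaleR q" if "q \<in> Q" for q
  proof -
    have "q (c *\<^sub>R x) = \<bar>c\<bar> * q x" for c x
    proof -
      have "q (smul (of_real c) x) = norm (of_real c :: 'k) * q x"
        using Q(1)[OF that] unfolding seminorm_def by blast
      then show ?thesis by (simp add: scale_of_real)
    qed
    then show ?thesis using Q(1)[OF that] unfolding seminorm_def by simp
  qed
  \<comment> \<open>Continuity of the members of \<open>Q\<close> comes from their balls being open
    in the topology that \<open>Q\<close> generates.\<close>
  have csQ: "cs q" if "q \<in> Q" for q
  proof -
    note sn = snQ[OF that]
    have "open {y. q (y - x) < e}" for x e
    proof (rule iffD2[OF top], intro ballI)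
      fix z assume z: "z \<in> {y. q (y - x) < e}"
      have "{y. \<forall>q\<in>{q}. q (y - z) < e - q (z - x)} \<subseteq> {y. q (y - x) < e}"
      proof
        fix y assume "y \<in> {y. \<forall>q\<in>{q}. q (y - z) < e - q (z - x)}"
        then show "y \<in> {y. q (y - x) < e}"
          using seminorm_add[OF sn, of "y - z" "z - x"] by simp
      qed
      then show "\<exists>F \<epsilon>. finite F \<and> F \<subseteq> Q \<and> \<epsilon> > 0 \<and> {y. \<forall>q\<in>F. q (y - z) < \<epsilon>} \<subseteq> {y. q (y - x) < e}"
        using z that by (intro exI[of _ "{q}"] exI[of _ "e - q (z - x)"]) auto
    qed
    note op = this
    have "(q \<longlongrightarrow> q x) (at x)" for x
    proof (rule tendstoI)
      fix e :: real assume e: "e > 0"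
      have "eventually (\<lambda>y. y \<in> {y. q (y - x) < e}) (at x)"
        by (rule topological_tendstoD[OF tendsto_ident_at op]) (simp add: e seminorm_zero[OF sn])
      then show "eventually (\<lambda>y. dist (q y) (q x) < e) (at x)"
      proof eventually_elim
        case (elim y)
        then show ?case
          using seminorm_add[OF sn, of "y - x" x] seminorm_add[OF sn, of "- (y - x)" y]
            seminorm_minus[OF sn, of "y - x"] by (simp add: dist_real_def abs_less_iff)
      qed
    qed
    then show ?thesis using sn unfolding continuous_seminorm_def continuous_on_def by auto
  qed
  have "open {x. p x < 1}" by (rule open_cs_ball[OF p])
  moreover have "0 \<in> {x. p x < 1}" by (simp add: cs_zero[OF p])
  ultimately have "\<exists>F \<epsilon>. finite F \<and> F \<subseteq> Q \<and> \<epsilon> > 0 \<and> {y. \<forall>q\<in>F. q (y - 0) < \<epsilon>} \<subseteq> {x. p x < 1}"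
    by (rule bspec[OF iffD1[OF top]])
  then obtain F e where F: "finite F" "F \<subseteq> Q" "e > 0" "{y. \<forall>q\<in>F. q (y - 0) < e} \<subseteq> {x. p x < 1}"
    by (elim exE conjE) (rule that)
  have "\<exists>r. cs r \<and> submult r \<and> (\<forall>q\<in>F. \<forall>x. q x \<le> r x)"
    using F(1,2)
  proof (induction F rule: finite_induct)
    case empty
    then show ?case
      by (intro exI[of _ "\<lambda>_. 0"]) (simp add: continuous_seminorm_def seminorm_def submult_def)
  next
    case (insert q F)
    from insert have "\<exists>r. cs r \<and> submult r \<and> (\<forall>q\<in>F. \<forall>x. q x \<le> r x)" by simp
    then obtain r where r: "cs r" "submult r" "\<forall>q\<in>F. \<forall>x. q x \<le> r x"
      by (elim exE conjE) (rule that)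
    have qQ: "q \<in> Q" using insert.prems by simp
    have q: "cs q" "submult q"
      using csQ[OF qQ] Q(2)[OF qQ] by (simp_all add: submult_def)
    have "\<forall>q'\<in>insert q F. \<forall>x. q' x \<le> max (q x) (r x)"
      using r(3) by (simp add: le_max_iff_disj)
    then show ?case
      using submult_max[OF q r(1,2)] by (intro exI[of _ "\<lambda>x. max (q x) (r x)"] conjI)
  qed
  then obtain r where r: "cs r" "submult r" "\<forall>q\<in>F. \<forall>x. q x \<le> r x"
    by (elim exE conjE) (rule that)
  \<comment> \<open>\<open>1 / e\<close> makes up for the radius \<open>e\<close>, and
    \<open>1\<close> is the least factor that \<open>submult_scale\<close> accepts.\<close>
  define c where "c = max 1 (1 / e)"
  have c: "c \<ge> 1" "c \<ge> 1 / e" by (auto simp: c_def)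
  have "p x \<le> c * r x" for x
  proof (rule field_le_epsilon)
    fix d :: real assume d: "d > 0"
    have rx: "0 \<le> r x" by (rule cs_nonneg[OF r(1)])
    \<comment> \<open>The summand \<open>d\<close> keeps \<open>u\<close> positive when
      \<open>r x = 0\<close>.\<close>
    define u where "u = c * r x + d"
    have u: "u > 0" using d rx c(1) by (simp add: u_def add_nonneg_pos)
    have "inverse u *\<^sub>R x \<in> {y. \<forall>q\<in>F. q (y - 0) < e}"
    proof (intro CollectI ballI)
      fix q assume q: "q \<in> F"
      have "q (inverse u *\<^sub>R x - 0) = inverse u * q x"
        using csQ q F(2) u by (subst diff_0_right, subst cs_scaleR) auto
      also have "\<dots> \<le> inverse u * r x" using u r(3) q by (intro mult_left_mono) auto
      also have "\<dots> < e"
      proof -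
        have "1 \<le> e * c" using c(2) F(3) by (simp add: field_simps)
        then have "1 * r x \<le> (e * c) * r x" by (rule mult_right_mono) (rule rx)
        also have "(e * c) * r x < e * u" using F(3) d by (simp add: u_def mult.assoc)
        finally have "r x < e * u" by simp
        then have "r x / u < e" by (subst pos_divide_less_eq[OF u])
        then show ?thesis by (simp only: divide_inverse mult.commute)
      qed
      finally show "q (inverse u *\<^sub>R x - 0) < e" .
    qed
    then have "p (inverse u *\<^sub>R x) < 1" using F(4) by blast
    then have "inverse u * p x < 1" using u by (simp add: cs_scaleR[OF p])
    then have "p x / u < 1" by (simp only: divide_inverse mult.commute)
    then have "p x < u" using pos_divide_less_eq[OF u, of "p x" 1] by simp
    then show "p x \<le> c * r x + d" by (simp add: u_def)
  qed
  then show ?thesis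
    using submult_scale[OF r(1,2) c(1)] by (intro exI[of _ "\<lambda>x. c * r x"] conjI allI)
qed

section \<open>Powers of small elements in the commutative case\<close>

text \<open>For \<open>0 < j < N\<close> the number \<open>w\<close> is an \<open>N\<close>-th root
  of unity other than \<open>1\<close>, so its first \<open>N\<close> powers sum to zero; the claim
  is the real part of this.\<close>

lemma sum_cos_multiples:
  fixes N j :: nat
  assumes "j < N" "j > 0"
  shows "(\<Sum>k<N. cos (real j * (2 * pi * real k / real N))) = 0"
proof -
  define w where "w = cis (2 * pi * real j / real N)"
  have "w \<noteq> 1"
  proof
    assume "w = 1"
    then have "cos (2 * pi * real j / real N) = 1"
      by (simp add: w_def complex_eq_iff)
    then obtain m :: int where m: "2 * pi * real j / real N = of_int m * (2 * pi)"
      unfolding cos_one_2pi_int by auto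
    then have "(2 * pi) * (real j / real N) = (2 * pi) * of_int m" by (simp add: mult.commute)
    then have *: "real j / real N = of_int m" unfolding mult_cancel_left by simp
    have "0 < real j / real N" "real j / real N < 1" using assms by simp_all
    then show False unfolding * by simp
  qed
  have "w ^ N = cis (2 * pi * real j)"
    unfolding w_def Complex.DeMoivre by (rule arg_cong[of _ _ cis]) (use assms in simp)
  also have "\<dots> = 1" by (rule cis_multiple_2pi) simp
  finally have "w ^ N = 1" .
  then have "(\<Sum>k<N. w ^ k) = 0"
    using geometric_sum[OF \<open>w \<noteq> 1\<close>, of N] by simp
  then have "Re (\<Sum>k<N. w ^ k) = 0" by simp
  moreover have "Re (w ^ k) = cos (real j * (2 * pi * real k / real N))" for k
    unfolding w_def Complex.DeMoivre by (simp add: mult_ac)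
  ultimately show ?thesis by simp
qed

context continuous_inverse_algebra
begin

text \<open>Formally, the quadratic factor is the product of \<open>1 - \<omega> x\<close> and
  \<open>1 - x / \<omega>\<close> with \<open>\<omega> = cis \<theta>\<close>, and the sum is the
  real part of a geometric sum in \<open>\<omega> x\<close>. Multiplied out, only real coefficients
  occur, and the induction telescopes by the recursion for \<open>cos (n \<theta>)\<close>.\<close>

lemma cos_geometric_sum:
  fixes x :: 'a
  shows "(1 - (2 * cos \<theta>) *\<^sub>R x + x * x) * (\<Sum>j<n. cos (real j * \<theta>) *\<^sub>R x ^ j) =
    1 - cos \<theta> *\<^sub>R x - cos (real n * \<theta>) *\<^sub>R x ^ n + cos ((real n - 1) * \<theta>) *\<^sub>R x ^ Suc n"
proof (induction n)
  case (Suc n)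
  have "cos ((real n + 1) * \<theta>) + cos ((real n - 1) * \<theta>) = 2 * cos \<theta> * cos (real n * \<theta>)"
    by (simp add: distrib_right left_diff_distrib cos_add cos_diff)
  then have c: "2 * cos \<theta> * cos (real n * \<theta>) = cos ((real n + 1) * \<theta>) + cos ((real n - 1) * \<theta>)" ..
  have "(1 - (2 * cos \<theta>) *\<^sub>R x + x * x) * (cos (real n * \<theta>) *\<^sub>R x ^ n) =
      cos (real n * \<theta>) *\<^sub>R x ^ n - (2 * cos \<theta> * cos (real n * \<theta>)) *\<^sub>R x ^ Suc n +
      cos (real n * \<theta>) *\<^sub>R x ^ Suc (Suc n)"
    by (simp add: distrib_right left_diff_distrib mult_scaleR_left mult_scaleR_right mult.assoc mult_ac
        scaleR_right_distrib scaleR_right_diff_distrib)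
  then show ?case
    unfolding sum.lessThan_Suc distrib_left Suc c by (simp add: algebra_simps)
qed (simp add: algebra_simps)

lemma eventually_alg_inv:
  fixes p :: "'a \<Rightarrow> real"
  assumes p: "cs p" and a: "a \<in> alg_units"
  obtains q where "cs q"
    "\<And>x. q (x - a) < 1 \<Longrightarrow> x \<in> alg_units \<and> p (alg_inv x - alg_inv a) < 1"
proof -
  have "(alg_inv \<longlongrightarrow> alg_inv a) (at a within alg_units)"
    using continuous_inverse a unfolding continuous_on_def by blast
  then have "(alg_inv \<longlongrightarrow> alg_inv a) (at a)"
    using at_within_open[OF a open_units] by simp
  then have "eventually (\<lambda>x. p (alg_inv x - alg_inv a) < 1) (at a)"
    by (rule tendsto_seminormD[OF _ p]) simp
  then have "eventually (\<lambda>x. p (alg_inv x - alg_inv a) < 1) (nhds a)"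
    unfolding eventually_at_filter by eventually_elim (auto simp: cs_zero[OF p])
  moreover have "eventually (\<lambda>x. x \<in> alg_units) (nhds a)"
    by (rule eventually_nhds_in_open[OF open_units a])
  ultimately have "eventually (\<lambda>x. x \<in> alg_units \<and> p (alg_inv x - alg_inv a) < 1) (nhds a)"
    by eventually_elim blast
  then show ?thesis by (rule eventually_nhds_seminorm) (rule that)
qed

text \<open>With \<open>c\<^sub>k = cos (2 \<pi> k / N)\<close>, the inverse of \<open>1 - x ^ N\<close> is the mean over \<open>k\<close> of
  \<open>(1 - c\<^sub>k x) / (1 - 2 c\<^sub>k x + x\<^sup>2)\<close>, the real part of \<open>1 / (1 - \<omega>\<^sup>k x)\<close> for a primitive \<open>N\<close>-th root of
  unity \<open>\<omega>\<close>. All these terms are close to \<open>1\<close> when \<open>x\<close> is small, uniformly in \<open>N\<close>, hence so is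
  \<open>1 - x ^ N\<close>.\<close>

lemma power_bounded_near_0:
  fixes p :: "'a \<Rightarrow> real"
  assumes comm: "\<And>x y::'a. x * y = y * x" and p: "cs p"
  obtains q where "cs q" "\<And>x N. q x < 1 \<Longrightarrow> N > 0 \<Longrightarrow> p (x ^ N) \<le> 1"
proof -
  \<comment> \<open>The seminorms are chosen backwards along the computation: \<open>q1\<close>
    controls the inverse of the mean \<open>m\<close>, \<open>q3\<close> the products
    \<open>z k\<close>, \<open>q2\<close> the inverses of \<open>d k\<close>, and \<open>q4\<close>
    the square \<open>x * x\<close>.\<close>
  obtain q1 where q1: "cs q1"
    "\<And>x. q1 (x - 1) < 1 \<Longrightarrow> x \<in> alg_units \<and> p (alg_inv x - alg_inv 1) < 1"
    by (rule eventually_alg_inv[OF p one_in_alg_units]) (rule that)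
  obtain q3 where q3: "cs q3"
    "\<And>x y. q3 (x - 1) < 1 \<Longrightarrow> q3 (y - 1) < 1 \<Longrightarrow> q1 (x * y - 1 * 1) < 1"
    by (rule mult_continuous_seminorm[OF q1(1), of 1 1 1]) (simp, rule that)
  obtain q2 where q2: "cs q2"
    "\<And>x. q2 (x - 1) < 1 \<Longrightarrow> x \<in> alg_units \<and> q3 (alg_inv x - alg_inv 1) < 1"
    by (rule eventually_alg_inv[OF q3(1) one_in_alg_units]) (rule that)
  obtain q4 where q4: "cs q4"
    "\<And>x y. q4 (x - 0) < 1 \<Longrightarrow> q4 (y - 0) < 1 \<Longrightarrow> q2 (x * y - 0 * 0) < 1/2"
    by (rule mult_continuous_seminorm[OF q2(1), of "1/2" 0 0]) (simp, rule that)
  have q22: "cs (\<lambda>x. q2 x + q2 x)" by (intro continuous_seminorm_sum2 q2(1))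
  \<comment> \<open>The fourfold \<open>q2\<close> gives \<open>q2 x < 1/4\<close>, so that
    \<open>2 * cos (th k)\<close> times \<open>x\<close> and the square \<open>x * x\<close> each
    stay below \<open>1/2\<close> in \<open>q2\<close>.\<close>
  have Q: "cs (\<lambda>x. ((q2 x + q2 x) + (q2 x + q2 x)) + (q3 x + q4 x))"
    by (intro continuous_seminorm_sum2 q2(1) q3(1) q4(1))
  show ?thesis
  proof (rule that[OF Q])
    fix x :: 'a and N :: nat
    assume x: "((q2 x + q2 x) + (q2 x + q2 x)) + (q3 x + q4 x) < 1" and N: "N > 0"
    note nn = cs_nonneg[OF q2(1), of x] cs_nonneg[OF q3(1), of x] cs_nonneg[OF q4(1), of x]
    have x2: "q2 x < 1/4" and x3: "q3 x < 1" and x4: "q4 x < 1" using x nn by linarith+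
    define th where "th k = 2 * pi * real k / real N" for k
    define d where "d k = 1 - (2 * cos (th k)) *\<^sub>R x + x * x" for k
    define z where "z k = (1 - cos (th k) *\<^sub>R x) * alg_inv (d k)" for k
    have d: "d k \<in> alg_units \<and> q3 (alg_inv (d k) - 1) < 1" for k
    proof -
      have "q2 (d k - 1) \<le> q2 ((2 * cos (th k)) *\<^sub>R x) + q2 (x * x)"
        using cs_diff[OF q2(1), of "x * x" "(2 * cos (th k)) *\<^sub>R x"] by (simp add: d_def)
      also have "q2 ((2 * cos (th k)) *\<^sub>R x) = 2 * \<bar>cos (th k)\<bar> * q2 x"
        by (simp add: cs_scaleR[OF q2(1)] abs_mult)
      also have "2 * \<bar>cos (th k)\<bar> * q2 x \<le> 2 * 1 * q2 x"
        using nn by (intro mult_right_mono mult_left_mono) auto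
      also have "q2 (x * x) < 1/2" using q4(2)[of x x] x4 by simp
      finally have "q2 (d k - 1) < 1" using x2 by simp
      then show ?thesis using q2(2)[of "d k"] by (simp add: alg_inv_one)
    qed
    have z: "q1 (z k - 1) < 1" for k
    proof -
      have "q3 (1 - cos (th k) *\<^sub>R x - 1) = \<bar>cos (th k)\<bar> * q3 x"
        by (simp add: cs_minus[OF q3(1)] cs_scaleR[OF q3(1)])
      also have "\<dots> \<le> 1 * q3 x" using nn by (intro mult_right_mono) auto
      finally have "q3 (1 - cos (th k) *\<^sub>R x - 1) < 1" using x3 by simp
      from q3(2)[OF this] d[of k] show ?thesis by (simp add: z_def)
    qed
    have zx: "(1 - x ^ N) * z k = (\<Sum>j<N. cos (real j * th k) *\<^sub>R x ^ j)" for k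
    proof -
      define S where "S = (\<Sum>j<N. cos (real j * th k) *\<^sub>R x ^ j)"
      have cN: "real N * th k = 2 * pi * real k" using N by (simp add: th_def)
      have 1: "cos (real N * th k) = 1" and s: "sin (real N * th k) = 0"
        unfolding cN using sin_2pi_minus[of 0] by (simp_all add: cos_int_2pin[of "int k", simplified] sin_int_2pin[of "int k", simplified])
      have 2: "cos ((real N - 1) * th k) = cos (th k)"
        using 1 s by (simp add: left_diff_distrib cos_diff)
      \<comment> \<open>At the angle \<open>th k\<close> the geometric sum closes up:
        \<open>cos (N * th k) = 1\<close> and \<open>cos ((N - 1) * th k) = cos (th k)\<close>.
        Hence the right-hand side factors.\<close>
      have "d k * S = 1 - cos (th k) *\<^sub>R x - x ^ N + cos (th k) *\<^sub>R x ^ Suc N"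
        unfolding d_def S_def cos_geometric_sum 1 2 by simp
      also have "\<dots> = (1 - x ^ N) * (1 - cos (th k) *\<^sub>R x)"
        by (simp add: algebra_simps mult_scaleR_left mult_scaleR_right comm[of "x ^ N" x])
      finally have "(1 - x ^ N) * z k = d k * S * alg_inv (d k)"
        by (simp add: z_def mult.assoc)
      also have "\<dots> = S * (d k * alg_inv (d k))"
        by (simp add: comm[of "d k" S] mult.assoc)
      also have "\<dots> = S" by (simp only: alg_inv_right[OF conjunct1[OF d]] mult_1_right)
      finally show ?thesis by (simp add: S_def)
    qed
    define m where "m = (1 / real N) *\<^sub>R (\<Sum>k<N. z k)"
    have "m - 1 = (1 / real N) *\<^sub>R (\<Sum>k<N. z k - 1)"
      using N by (simp add: m_def sum_subtractf scaleR_diff_right sum_constant_scaleR)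
    then have "q1 (m - 1) = 1 / real N * q1 (\<Sum>k<N. z k - 1)" by (simp add: cs_scaleR[OF q1(1)])
    also have "\<dots> \<le> 1 / real N * (\<Sum>k<N. q1 (z k - 1))"
      by (intro mult_left_mono cs_sum[OF q1(1)]) simp
    also have "\<dots> < 1 / real N * (\<Sum>k<N. 1)"
      using N by (intro mult_strict_left_mono sum_strict_mono z) auto
    also have "\<dots> = 1" using N by simp
    finally have m: "m \<in> alg_units" "p (alg_inv m - 1) < 1" using q1(2)[of m] by (simp_all add: alg_inv_one)
    \<comment> \<open>Averaging over \<open>k\<close> kills every power except \<open>j = 0\<close>,
      so \<open>m\<close> is the inverse of \<open>1 - x ^ N\<close>.\<close>
    have "(1 - x ^ N) * m = (1 / real N) *\<^sub>R (\<Sum>k<N. \<Sum>j<N. cos (real j * th k) *\<^sub>R x ^ j)"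
      by (simp add: m_def mult_scaleR_right sum_distrib_left zx)
    also have "(\<Sum>k<N. \<Sum>j<N. cos (real j * th k) *\<^sub>R x ^ j) = (\<Sum>j<N. (\<Sum>k<N. cos (real j * th k)) *\<^sub>R x ^ j)"
      by (subst sum.swap) (simp add: scaleR_sum_left)
    also have "\<dots> = (\<Sum>j<N. (if j = 0 then real N else 0) *\<^sub>R x ^ j)"
      by (intro sum.cong refl) (use sum_cos_multiples[of _ N] in \<open>auto simp: th_def\<close>)
    also have "\<dots> = (\<Sum>j<N. if j = 0 then real N *\<^sub>R 1 else 0)"
      by (intro sum.cong) auto
    also have "\<dots> = real N *\<^sub>R 1" using N by simp
    finally have "m * (1 - x ^ N) = 1" using N by (simp add: comm[of m])
    then have "alg_inv m = 1 - x ^ N" by (rule alg_inv_eqI[OF m(1)])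
    then show "p (x ^ N) \<le> 1" using m(2) by (simp add: cs_minus[OF p])
  qed
qed

end

section \<open>Polarization: from powers to products\<close>

text \<open>Iterated forward differences along the directions in the list; applied to the power of
  matching degree they recover the product of the list, up to a factorial.\<close>

fun finite_differences :: "'a list \<Rightarrow> ('a \<Rightarrow> 'a) \<Rightarrow> 'a \<Rightarrow> 'a::ab_group_add"
  where
    "finite_differences [] f x = f x"
  | "finite_differences (h # hs) f x = finite_differences hs (\<lambda>y. f (y + h) - f y) x"

text \<open>The result is a signed sum of \<open>2 ^ length hs\<close> values of \<open>f\<close>,
  taken at \<open>x\<close> plus sums of sublists of \<open>hs\<close>, and all these points satisfy
  the bound on \<open>q (y - x)\<close>.\<close>

lemma finite_differences_bound:
  fixes p q :: "'a::locally_convex_space \<Rightarrow> real"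
  assumes p: "cs p" and q: "cs q"
    and "\<And>y. q (y - x) \<le> (\<Sum>h\<leftarrow>hs. q h) \<Longrightarrow> p (f y) \<le> B"
  shows "p (finite_differences hs f x) \<le> 2 ^ length hs * B"
  using assms(3)
proof (induction hs arbitrary: f B)
  case Nil
  then show ?case by (simp add: cs_zero[OF q])
next
  case (Cons h hs)
  have "p (finite_differences hs (\<lambda>y. f (y + h) - f y) x) \<le> 2 ^ length hs * (2 * B)"
  proof (rule Cons.IH)
    fix y assume y: "q (y - x) \<le> (\<Sum>h\<leftarrow>hs. q h)"
    have "q (y + h - x) \<le> q h + q (y - x)"
      using cs_add[OF q, of h "y - x"] by (simp add: algebra_simps)
    then have "p (f (y + h)) \<le> B" using y by (intro Cons.prems) simp
    moreover have "p (f y) \<le> B" using y cs_nonneg[OF q, of h] by (intro Cons.prems) simp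
    ultimately show "p (f (y + h) - f y) \<le> 2 * B" using cs_diff[OF p, of "f (y + h)" "f y"] by linarith
  qed
  then show ?case by simp
qed

text \<open>\<open>f\<close> is a polynomial function of degree at most \<open>n\<close>, in Horner form, and \<open>a\<close> is its coefficient
  of degree \<open>n\<close>.\<close>

fun poly_lead :: "nat \<Rightarrow> 'a \<Rightarrow> ('a \<Rightarrow> 'a::ring) \<Rightarrow> bool"
  where
    "poly_lead 0 a f \<longleftrightarrow> f = (\<lambda>_. a)"
  | "poly_lead (Suc n) a f \<longleftrightarrow> (\<exists>g b. poly_lead n a g \<and> f = (\<lambda>y. y * g y + b))"

lemma poly_lead_add: "poly_lead n a f \<Longrightarrow> poly_lead n b g \<Longrightarrow> poly_lead n (a + b) (\<lambda>y. f y + g y)"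
proof (induction n arbitrary: f g)
  case (Suc n)
  obtain f' c where f: "poly_lead n a f'" "f = (\<lambda>y. y * f' y + c)" using Suc.prems(1) by auto
  obtain g' d where g: "poly_lead n b g'" "g = (\<lambda>y. y * g' y + d)" using Suc.prems(2) by auto
  have "poly_lead n (a + b) (\<lambda>y. f' y + g' y)" by (rule Suc.IH[OF f(1) g(1)])
  moreover have "(\<lambda>y. f y + g y) = (\<lambda>y. y * (f' y + g' y) + (c + d))"
    by (simp add: f g fun_eq_iff algebra_simps)
  ultimately show ?case unfolding poly_lead.simps by blast
qed auto

text \<open>Padding by a zero leading coefficient, so that a term of lower degree can be added to
  those of top degree.\<close>

lemma poly_lead_raise: "poly_lead n a f \<Longrightarrow> poly_lead (Suc n) 0 f"
proof (induction n arbitrary: f)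
  case 0
  then have "poly_lead 0 0 (\<lambda>_::'a. 0::'a) \<and> f = (\<lambda>y. y * 0 + a)" by (simp add: fun_eq_iff)
  then show ?case unfolding poly_lead.simps by blast
next
  case (Suc n)
  obtain f' c where f: "poly_lead n a f'" "f = (\<lambda>y. y * f' y + c)" using Suc.prems by auto
  show ?case using Suc.IH[OF f(1)] f(2) unfolding poly_lead.simps(2)[of "Suc n"] by blast
qed

lemma poly_lead_mult_left:
  fixes f :: "'a::ring \<Rightarrow> 'a"
  assumes comm: "\<And>x y::'a. x * y = y * x"
  shows "poly_lead n a f \<Longrightarrow> poly_lead n (h * a) (\<lambda>y. h * f y)"
proof (induction n arbitrary: f)
  case (Suc n)
  obtain f' c where f: "poly_lead n a f'" "f = (\<lambda>y. y * f' y + c)" using Suc.prems by auto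
  have "h * (y * f' y + c) = y * (h * f' y) + h * c" for y
    using comm[of h y] by (simp add: distrib_left mult.assoc[symmetric])
  then have "(\<lambda>y. h * f y) = (\<lambda>y. y * (h * f' y) + h * c)" by (simp add: f fun_eq_iff)
  then show ?case using Suc.IH[OF f(1)] unfolding poly_lead.simps by blast
qed auto

context continuous_inverse_algebra
begin

text \<open>A discrete product rule: for \<open>f y = y * g y + b\<close> the difference is
  \<open>y * D y + h * g y + h * D y\<close>, where \<open>D\<close> is the difference of
  \<open>g\<close>. In the induction step the first two terms contribute \<open>Suc n\<close> copies
  and one copy of \<open>h * a\<close>, and the third has lower degree.\<close>

lemma poly_lead_difference:
  fixes f :: "'a \<Rightarrow> 'a"
  assumes comm: "\<And>x y::'a. x * y = y * x"
  shows "poly_lead (Suc n) a f \<Longrightarrow> poly_lead n (real (Suc n) *\<^sub>R (h * a)) (\<lambda>y. f (y + h) - f y)"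
proof (induction n arbitrary: f)
  case 0
  then obtain b where "f = (\<lambda>y. y * a + b)" by auto
  then show ?case by (simp add: fun_eq_iff algebra_simps)
next
  case (Suc n)
  then obtain g b where g: "poly_lead (Suc n) a g" "f = (\<lambda>y. y * g y + b)" 
    unfolding poly_lead.simps(2)[of "Suc n"] by blast
  let ?D = "\<lambda>y. g (y + h) - g y"
  have D: "poly_lead n (real (Suc n) *\<^sub>R (h * a)) ?D" by (rule Suc.IH[OF g(1)])
  have 1: "poly_lead (Suc n) (real (Suc n) *\<^sub>R (h * a)) (\<lambda>y. y * ?D y + 0)"
    using D unfolding poly_lead.simps by blast
  have 2: "poly_lead (Suc n) (h * a) (\<lambda>y. h * g y)" by (rule poly_lead_mult_left[OF comm g(1)])
  have 3: "poly_lead (Suc n) 0 (\<lambda>y. h * ?D y)"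
    by (rule poly_lead_raise[OF poly_lead_mult_left[OF comm D]])
  have "poly_lead (Suc n) (real (Suc n) *\<^sub>R (h * a) + h * a + 0) (\<lambda>y. (y * ?D y + 0) + h * g y + h * ?D y)"
    by (intro poly_lead_add 1 2 3)
  moreover have "(\<lambda>y. (y * ?D y + 0) + h * g y + h * ?D y) = (\<lambda>y. f (y + h) - f y)"
    by (simp only: g(2) fun_eq_iff) (simp add: algebra_simps)
  moreover have "real (Suc n) *\<^sub>R (h * a) + h * a + 0 = real (Suc (Suc n)) *\<^sub>R (h * a)"
    unfolding of_nat_Suc[of "Suc n"] scaleR_left_distrib by (simp only: scaleR_one add_0_right add_0_left add.commute)
  ultimately show ?case by (simp only:)
qed

text \<open>Each difference lowers the degree by one and multiplies the leading coefficient by the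
  old degree and by the direction. After as many differences as the degree only a constant is left,
  with the accumulated factorial.\<close>

lemma finite_differences_poly_lead:
  fixes f :: "'a \<Rightarrow> 'a"
  assumes comm: "\<And>x y::'a. x * y = y * x"
  shows "poly_lead (length hs) a f \<Longrightarrow>
    finite_differences hs f x = fact (length hs) *\<^sub>R (prod_list hs * a)"
proof (induction hs arbitrary: f a)
  case (Cons h hs)
  have "finite_differences hs (\<lambda>y. f (y + h) - f y) x =
      fact (length hs) *\<^sub>R (prod_list hs * (real (Suc (length hs)) *\<^sub>R (h * a)))"
    by (rule Cons.IH[OF poly_lead_difference[OF comm]]) (use Cons.prems in simp)
  also have "\<dots> = (fact (length hs) * real (Suc (length hs))) *\<^sub>R (prod_list hs * h * a)"
    by (simp only: mult_scaleR_right scaleR_scaleR mult.assoc)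
  also have "fact (length hs) * real (Suc (length hs)) = fact (length (h # hs))"
    by (simp add: mult.commute)
  also have "prod_list hs * h * a = prod_list (h # hs) * a" by (simp add: comm[of h])
  finally show ?case by simp
qed simp

lemma polarization:
  fixes x :: 'a
  assumes comm: "\<And>x y::'a. x * y = y * x"
  shows "finite_differences hs (\<lambda>y. y ^ length hs) x = fact (length hs) *\<^sub>R prod_list hs"
proof -
  have "poly_lead n 1 (\<lambda>y::'a. y ^ n)" for n
  proof (induction n)
    case (Suc n)
    have "(\<lambda>y::'a. y ^ Suc n) = (\<lambda>y. y * y ^ n + 0)" by simp
    then show ?case using Suc unfolding poly_lead.simps by blast
  qed simp
  from finite_differences_poly_lead[OF comm this] show ?thesis by simp
qed

lemma power_scaleR: "(c *\<^sub>R x) ^ n = c ^ n *\<^sub>R x ^ n" for x :: 'a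
  by (induction n) (simp_all add: mult_scaleR_left mult_scaleR_right)

lemma prod_list_scaleR: "prod_list (map (\<lambda>h. c *\<^sub>R h) hs) = c ^ length hs *\<^sub>R prod_list hs" for hs :: "'a list"
  by (induction hs) (simp_all add: mult_scaleR_left mult_scaleR_right)

text \<open>By \<open>polarization\<close>, \<open>fact n\<close> times a product of
  \<open>n\<close> elements is an iterated difference of the \<open>n\<close>-th power. The points
  involved have \<open>q\<close> at most \<open>n\<close>, so their powers cost
  \<open>(n + 1) ^ n\<close> after rescaling, and all constants together grow only like
  \<open>K ^ n\<close>.\<close>

lemma products_bounded_near_0:
  fixes p :: "'a \<Rightarrow> real"
  assumes comm: "\<And>x y::'a. x * y = y * x" and p: "cs p"
  obtains q where "cs q"
    "\<And>hs. hs \<noteq> [] \<Longrightarrow> \<forall>h\<in>set hs. q h \<le> 1 \<Longrightarrow> p (prod_list hs) \<le> 1"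
proof -
  obtain q where q: "cs q" "\<And>x N. q x < 1 \<Longrightarrow> N > 0 \<Longrightarrow> p (x ^ N) \<le> 1"
    by (rule power_bounded_near_0[OF comm p]) (rule that)
  \<comment> \<open>The \<open>2\<close> comes from the \<open>2 ^ n\<close> values in the iterated
    difference, \<open>exp 2\<close> from
    \<open>(n + 1) ^ n / fact n \<le> exp (n + 1) \<le> exp (2 * n)\<close>.\<close>
  define K :: real where "K = 2 * exp 2"
  have K: "K > 0" by (simp add: K_def)
  have bound: "p (prod_list hs) \<le> K ^ length hs"
    if ne: "hs \<noteq> []" and hs: "\<And>h. h \<in> set hs \<Longrightarrow> q h \<le> 1" for hs
  proof -
    define n where "n = length hs"
    have n: "n > 0" using ne by (simp add: n_def)
    have "(\<Sum>h\<leftarrow>hs. q h) \<le> (\<Sum>h\<leftarrow>hs. 1)" by (rule sum_list_mono) (rule hs)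
    then have sum: "(\<Sum>h\<leftarrow>hs. q h) \<le> real n" by (simp add: sum_list_triv n_def)
    have "p (finite_differences hs (\<lambda>y. y ^ n) 0) \<le> 2 ^ length hs * (real n + 1) ^ n"
    proof (rule finite_differences_bound[OF p q(1)])
      fix y :: 'a assume "q (y - 0) \<le> (\<Sum>h\<leftarrow>hs. q h)"
      then have y: "q y \<le> real n" using sum by simp
      \<comment> \<open>Division by \<open>n + 1\<close> rather than \<open>n\<close>, because the
        bound on powers requires \<open>q z < 1\<close> strictly.\<close>
      define z where "z = inverse (real n + 1) *\<^sub>R y"
      have "q z = inverse (real n + 1) * q y" by (simp add: z_def cs_scaleR[OF q(1)])
      also have "\<dots> \<le> inverse (real n + 1) * real n" by (intro mult_left_mono y) simp
      also have "\<dots> < 1" by (simp add: field_simps)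
      finally have "p (z ^ n) \<le> 1" by (intro q(2) n)
      have "y = (real n + 1) *\<^sub>R z" by (simp add: z_def)
      then have "p (y ^ n) = (real n + 1) ^ n * p (z ^ n)" by (simp add: power_scaleR cs_scaleR[OF p])
      also have "\<dots> \<le> (real n + 1) ^ n * 1" by (intro mult_left_mono \<open>p (z ^ n) \<le> 1\<close>) simp
      finally show "p (y ^ n) \<le> (real n + 1) ^ n" by simp
    qed
    then have 1: "fact n * p (prod_list hs) \<le> 2 ^ n * (real n + 1) ^ n"
      unfolding n_def polarization[OF comm] by (simp add: cs_scaleR[OF p])
    have "(real n + 1) ^ n / fact n \<le> exp (real n + 1)"
    proof -
      have "inverse (fact n) *\<^sub>R (real n + 1) ^ n \<le> (\<Sum>k. inverse (fact k) *\<^sub>R (real n + 1) ^ k)"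
        using sum_le_suminf[OF summable_exp_generic[of "real n + 1"], of "{n}"] by simp
      then show ?thesis by (simp only: exp_def divide_inverse mult.commute real_scaleR_def)
    qed
    also have "\<dots> \<le> exp (real n * 2)" using n by simp
    also have "\<dots> = exp 2 ^ n" by (rule exp_of_nat_mult)
    finally have 2: "(real n + 1) ^ n \<le> fact n * exp 2 ^ n" by (simp add: field_simps)
    have "fact n * p (prod_list hs) \<le> 2 ^ n * (fact n * exp 2 ^ n)"
      by (rule order_trans[OF 1]) (rule mult_left_mono[OF 2], simp)
    also have "\<dots> = fact n * K ^ n" by (simp add: K_def power_mult_distrib)
    finally show ?thesis by (simp add: n_def)
  qed
  \<comment> \<open>Under the seminorm \<open>K * q\<close> each factor may be multiplied by
    \<open>K\<close> before \<open>bound\<close> is applied, which cancels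
    \<open>K ^ n\<close>.\<close>
  have "cs (\<lambda>x. K * q x)"
  proof (rule continuous_seminormI[OF seminormI_le q(1), of _ K])
    fix x y
    show "K * q (x + y) \<le> K * q x + K * q y"
      using mult_left_mono[OF cs_add[OF q(1), of x y], of K] K by (simp add: distrib_left)
  qed (use K cs_nonneg[OF q(1)] in \<open>auto simp: cs_scaleR[OF q(1)]\<close>)
  then show ?thesis
  proof (rule that)
    fix hs :: "'a list" assume ne: "hs \<noteq> []" and hs: "\<forall>h\<in>set hs. K * q h \<le> 1"
    define gs where "gs = map (\<lambda>h. K *\<^sub>R h) hs"
    have "p (prod_list gs) \<le> K ^ length gs"
      by (rule bound) (use ne hs K in \<open>auto simp: gs_def cs_scaleR[OF q(1)]\<close>)
    moreover have "p (prod_list gs) = K ^ length hs * p (prod_list hs)"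
      using K by (simp add: gs_def prod_list_scaleR cs_scaleR[OF p])
    ultimately have "K ^ length hs * p (prod_list hs) \<le> K ^ length hs * 1" by (simp add: gs_def)
    then show "p (prod_list hs) \<le> 1" using K by (simp only: mult_le_cancel_left_pos zero_less_power)
  qed
qed

text \<open>The nonempty products of \<open>q\<close>-small elements form a multiplicatively closed
  set on which \<open>p \<le> 1\<close>, as \<open>submult_gauge\<close> requires. The empty product
  is excluded, since \<open>p 1\<close> may exceed \<open>1\<close>.\<close>

lemma commutative_dominating:
  fixes p :: "'a \<Rightarrow> real"
  assumes comm: "\<And>x y::'a. x * y = y * x" and p: "cs p"
  shows "\<exists>r. cs r \<and> submult r \<and> (\<forall>x. p x \<le> r x)"
proof -
  obtain q where q: "cs q"
    "\<And>hs. hs \<noteq> [] \<Longrightarrow> \<forall>h\<in>set hs. q h \<le> 1 \<Longrightarrow> p (prod_list hs) \<le> 1"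
    by (rule products_bounded_near_0[OF comm p]) (rule that)
  define W where "W = prod_list ` {hs. hs \<noteq> [] \<and> (\<forall>h\<in>set hs. q h \<le> 1)}"
  show ?thesis
  proof (rule submult_gauge[OF mult_scaleR_left mult_scaleR_right _ q(1) _ p, of W])
    fix v w assume "v \<in> W" "w \<in> W"
    then obtain hs gs where *: "hs \<noteq> []" "\<forall>h\<in>set hs. q h \<le> 1" "v = prod_list hs" "\<forall>h\<in>set gs. q h \<le> 1" "w = prod_list gs"
      unfolding W_def by auto
    then have "v * w = prod_list (hs @ gs)" "hs @ gs \<noteq> []" "\<forall>h\<in>set (hs @ gs). q h \<le> 1" by auto
    then show "v * w \<in> W" unfolding W_def by blast
  next
    fix x assume "q x \<le> 1"
    then have "x = prod_list [x]" "[x] \<noteq> []" "\<forall>h\<in>set [x]. q h \<le> 1" by auto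
    then show "x \<in> W" unfolding W_def by blast
  next
    fix x assume "x \<in> W"
    then obtain hs where "hs \<noteq> []" "\<forall>h\<in>set hs. q h \<le> 1" "x = prod_list hs" unfolding W_def by auto
    then show "p x \<le> 1" using q(2) by blast
  qed
qed

end

section \<open>Evolutions\<close>

abbreviation submult_seminorms :: "('a::{locally_convex_space, times} \<Rightarrow> real) set"
  where "submult_seminorms \<equiv> {r. cs r \<and> submult r}"

text \<open>The common ground of the two alternatives of the theorem: commutativity and local
  m-convexity serve only to establish \<open>submult_dominating\<close>.\<close>

locale m_convex_inverse_algebra = continuous_inverse_algebra smul
  for smul :: "'k::real_or_complex_field \<Rightarrow>
      'a::{locally_convex_space, ring, topological_monoid_mult} \<Rightarrow> 'a" +
  assumes mc: "mackey_complete TYPE('a)"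
    and submult_dominating: "cs (p :: 'a \<Rightarrow> real) \<Longrightarrow>
      \<exists>r. cs r \<and> submult r \<and> (\<forall>x. p x \<le> r x)"

sublocale m_convex_inverse_algebra \<subseteq>
  dominating_seminorms "submult_seminorms :: ('a \<Rightarrow> real) set"
  by unfold_locales (use submult_dominating in auto)

lemma submult_le: "submult r \<Longrightarrow> r (x * y) \<le> r x * r y"
  by (simp add: submult_def)

lemma submult_le_commute: "submult r \<Longrightarrow> r (x * a) \<le> r a * r x"
  using submult_le[of r x a] by (simp add: mult.commute)

lemma submult_minus_le:
  "cs r \<Longrightarrow> submult r \<Longrightarrow> r (- (a * x)) \<le> r a * r x"
  using submult_le[of r a x] cs_minus[of r "a * x"] by simp

text \<open>A substitute for Gronwall's inequality when \<open>C\<close> is small. At a maximum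
  \<open>u\<close> of \<open>r (F t)\<close> the mean value inequality gives
  \<open>r (F u) \<le> r (F 0) + C * r (F u)\<close>, and \<open>C \<le> 1/2\<close> absorbs the
  last term.\<close>

lemma gronwall_small:
  fixes r :: "'e::locally_convex_space \<Rightarrow> real"
  assumes r: "cs r"
    and F: "\<And>t. t \<in> {0..1} \<Longrightarrow> has_curve_deriv F (f t) t"
    and le: "\<And>t. t \<in> {0..1} \<Longrightarrow> r (f t) \<le> C * r (F t)" and C: "0 \<le> C" "C \<le> 1/2"
    and t: "t \<in> {0..1}"
  shows "r (F t - F 0) \<le> 2 * C * r (F 0)"
proof -
  have "continuous_on {0..1} F"
    unfolding continuous_on_def using has_curve_deriv_tendsto[OF F] by blast
  then have "continuous_on {0..1} (\<lambda>t. r (F t))"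
    using r unfolding continuous_seminorm_def by (auto intro: continuous_on_compose2)
  from continuous_attains_sup[OF compact_Icc _ this] obtain u
    where u: "u \<in> {0..1}" "\<And>t. t \<in> {0..1} \<Longrightarrow> r (F t) \<le> r (F u)" by auto
  have bound: "r (F s - F 0) \<le> C * r (F u)" if s: "s \<in> {0..1}" for s
  proof -
    have Cu: "0 \<le> C * r (F u)" using C(1) cs_nonneg[OF r, of "F u"] by simp
    have "r (F s - F 0) \<le> (C * r (F u)) * \<bar>s - 0\<bar>"
    proof (rule curve_mean_value_const[OF F r _ _ s])
      fix v :: real assume v: "v \<in> {0..1}"
      show "r (f v) \<le> C * r (F u)"
        by (rule order_trans[OF le[OF v]]) (intro mult_left_mono u(2) v C(1))
    qed auto
    also have "\<dots> \<le> (C * r (F u)) * 1" using s by (intro mult_left_mono Cu) auto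
    finally show ?thesis by simp
  qed
  have "r (F u) \<le> r (F u - F 0) + r (F 0)" using cs_add[OF r, of "F u - F 0" "F 0"] by simp
  also have "r (F u - F 0) \<le> 1/2 * r (F u)"
    by (rule order_trans[OF bound[OF u(1)]]) (intro mult_right_mono C(2) cs_nonneg[OF r])
  finally have "r (F u) \<le> 2 * r (F 0)" by simp
  then have "C * r (F u) \<le> C * (2 * r (F 0))" by (intro mult_left_mono C(1))
  then show ?thesis using bound[OF t] by simp
qed

context m_convex_inverse_algebra
begin

lemma lip_mult:
  fixes f g :: "real \<Rightarrow> 'a"
  assumes f: "lip f" and g: "lip g"
  shows "lip (\<lambda>t. f t * g t)"
proof (rule lipI_dominating)
  fix r :: "'a \<Rightarrow> real" assume "r \<in> submult_seminorms"
  then have r: "cs r" "submult r" by auto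
  obtain L where L: "L \<ge> 0" "\<And>s t. s \<in> {0..1} \<Longrightarrow> t \<in> {0..1} \<Longrightarrow> r (f t - f s) \<le> L * \<bar>t - s\<bar>"
    by (rule lipE[OF f r(1)]) (rule that)
  obtain K where K: "K \<ge> 0" "\<And>s t. s \<in> {0..1} \<Longrightarrow> t \<in> {0..1} \<Longrightarrow> r (g t - g s) \<le> K * \<bar>t - s\<bar>"
    by (rule lipE[OF g r(1)]) (rule that)
  obtain A where A: "A \<ge> 0" "\<And>t. t \<in> {0..1} \<Longrightarrow> r (f t) \<le> A"
    by (rule lip_boundedE[OF f r(1)]) (rule that)
  obtain B where B: "B \<ge> 0" "\<And>t. t \<in> {0..1} \<Longrightarrow> r (g t) \<le> B"
    by (rule lip_boundedE[OF g r(1)]) (rule that)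
  have "r (f t * g t - f s * g s) \<le> (L * B + A * K) * \<bar>t - s\<bar>" if st: "s \<in> {0..1}" "t \<in> {0..1}" for s t
  proof -
    have "f t * g t - f s * g s = (f t - f s) * g t + f s * (g t - g s)" by (simp add: algebra_simps)
    then have "r (f t * g t - f s * g s) \<le> r ((f t - f s) * g t) + r (f s * (g t - g s))"
      by (simp only: cs_add[OF r(1)])
    also have "r ((f t - f s) * g t) \<le> (L * \<bar>t - s\<bar>) * B"
      by (rule order_trans[OF submult_le[OF r(2)]])
        (intro mult_mono L(2) B(2) st cs_nonneg[OF r(1)] mult_nonneg_nonneg L(1) abs_ge_zero)
    also have "r (f s * (g t - g s)) \<le> A * (K * \<bar>t - s\<bar>)"
      by (rule order_trans[OF submult_le[OF r(2)]])
        (intro mult_mono K(2) A st cs_nonneg[OF r(1)])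
    finally show ?thesis by (simp add: algebra_simps)
  qed
  then show "\<exists>L. \<forall>s\<in>{0..1}. \<forall>t\<in>{0..1}. r (f t * g t - f s * g s) \<le> L * \<bar>t - s\<bar>" by blast
qed

lemma has_curve_deriv_mult:
  fixes f g :: "real \<Rightarrow> 'a"
  assumes f: "has_curve_deriv f v t" and g: "has_curve_deriv g w t"
  shows "has_curve_deriv (\<lambda>s. f s * g s) (v * g t + f t * w) t"
proof -
  have "((\<lambda>s. ((f s - f t) /\<^sub>R (s - t)) * g s + f t * ((g s - g t) /\<^sub>R (s - t)))
      \<longlongrightarrow> v * g t + f t * w) (at t within {0..1})"
    using f g has_curve_deriv_tendsto[OF g] unfolding has_curve_deriv_def
    by (intro tendsto_add tendsto_mult tendsto_const)
  moreover have "((f s - f t) /\<^sub>R (s - t)) * g s + f t * ((g s - g t) /\<^sub>R (s - t)) =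
      (f s * g s - f t * g t) /\<^sub>R (s - t)" for s
    by (simp only: mult_scaleR_left mult_scaleR_right scaleR_right_distrib[symmetric])
      (simp add: left_diff_distrib right_diff_distrib)
  ultimately show ?thesis unfolding has_curve_deriv_def by simp
qed

text \<open>\<open>\<phi> a\<close> will be right multiplication by \<open>a\<close> for the
  evolution and negated left multiplication for its inverse, so one existence proof serves both
  equations.\<close>

lemma bilinear_ode_exists:
  fixes \<gamma> :: "real \<Rightarrow> 'a" and \<phi> :: "'a \<Rightarrow> 'a \<Rightarrow> 'a"
  assumes \<gamma>: "lip \<gamma>"
    and diff_left: "\<And>a b x. \<phi> (a - b) x = \<phi> a x - \<phi> b x"
    and diff_right: "\<And>a x y. \<phi> a (x - y) = \<phi> a x - \<phi> a y"
    and le: "\<And>r a x. cs r \<Longrightarrow> submult r \<Longrightarrow> r (\<phi> a x) \<le> r a * r x"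
  shows "\<exists>\<eta>. \<eta> 0 = 1 \<and> lip \<eta> \<and> (\<forall>t\<in>{0..1}. has_curve_deriv \<eta> (\<phi> (\<gamma> t) (\<eta> t)) t)"
proof (rule linear_ode_exists[OF mc diff_right])
  fix r :: "'a \<Rightarrow> real" assume "r \<in> submult_seminorms"
  then have r: "cs r" "submult r" by auto
  obtain M where M: "M \<ge> 0" "\<And>t. t \<in> {0..1} \<Longrightarrow> r (\<gamma> t) \<le> M"
    by (rule lip_boundedE[OF \<gamma> r(1)]) (rule that)
  have "r (\<phi> (\<gamma> t) x) \<le> M * r x" if "t \<in> {0..1}" for t x
    by (rule order_trans[OF le[OF r] mult_right_mono[OF M(2)[OF that] cs_nonneg[OF r(1)]]])
  then show "\<exists>C\<ge>0. \<forall>t\<in>{0..1}. \<forall>x. r (\<phi> (\<gamma> t) x) \<le> C * r x" using M(1) by blast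
  obtain L where L: "L \<ge> 0" "\<And>s t. s \<in> {0..1} \<Longrightarrow> t \<in> {0..1} \<Longrightarrow> r (\<gamma> t - \<gamma> s) \<le> L * \<bar>t - s\<bar>"
    by (rule lipE[OF \<gamma> r(1)]) (rule that)
  have "r (\<phi> (\<gamma> t) x - \<phi> (\<gamma> s) x) \<le> L * \<bar>t - s\<bar> * r x" if "s \<in> {0..1}" "t \<in> {0..1}" for s t x
    unfolding diff_left[symmetric]
    by (rule order_trans[OF le[OF r] mult_right_mono[OF L(2)[OF that] cs_nonneg[OF r(1)]]])
  then show "\<exists>K. \<forall>s\<in>{0..1}. \<forall>t\<in>{0..1}. \<forall>x. r (\<phi> (\<gamma> t) x - \<phi> (\<gamma> s) x) \<le> K * \<bar>t - s\<bar> * r x"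
    by blast
qed

lemma evolution_pair_exists:
  fixes \<gamma> :: "real \<Rightarrow> 'a"
  assumes \<gamma>: "lip \<gamma>"
  shows "\<exists>e. case e of (\<eta>, \<zeta>) \<Rightarrow> \<eta> 0 = 1 \<and> \<zeta> 0 = 1 \<and> lip \<eta> \<and> lip \<zeta> \<and>
    (\<forall>t\<in>{0..1}. has_curve_deriv \<eta> (\<eta> t * \<gamma> t) t \<and> has_curve_deriv \<zeta> (- (\<gamma> t * \<zeta> t)) t \<and>
      \<eta> t * \<zeta> t = 1 \<and> \<zeta> t * \<eta> t = 1)"
proof -
  have "\<exists>\<eta>. \<eta> 0 = 1 \<and> lip \<eta> \<and> (\<forall>t\<in>{0..1}. has_curve_deriv \<eta> (\<eta> t * \<gamma> t) t)"
    by (rule bilinear_ode_exists[OF \<gamma>, of "\<lambda>a x. x * a"])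
      (auto simp: left_diff_distrib right_diff_distrib intro: submult_le_commute)
  then obtain \<eta> where \<eta>: "\<eta> 0 = 1" "lip \<eta>" "\<And>t. t \<in> {0..1} \<Longrightarrow> has_curve_deriv \<eta> (\<eta> t * \<gamma> t) t" by blast
  have "\<exists>\<zeta>. \<zeta> 0 = 1 \<and> lip \<zeta> \<and> (\<forall>t\<in>{0..1}. has_curve_deriv \<zeta> (- (\<gamma> t * \<zeta> t)) t)"
    by (rule bilinear_ode_exists[OF \<gamma>, of "\<lambda>a x. - (a * x)"])
      (auto simp: left_diff_distrib right_diff_distrib intro: submult_minus_le)
  then obtain \<zeta> where \<zeta>: "\<zeta> 0 = 1" "lip \<zeta>" "\<And>t. t \<in> {0..1} \<Longrightarrow> has_curve_deriv \<zeta> (- (\<gamma> t * \<zeta> t)) t" by blast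
  \<comment> \<open>In this order the two terms of the derivative cancel. In the other order they
    form the commutator of \<open>\<zeta> * \<eta>\<close> with \<open>\<gamma>\<close>, hence the
    separate argument with \<open>S\<close>.\<close>
  have \<eta>\<zeta>: "\<eta> t * \<zeta> t = 1" if "t \<in> {0..1}" for t
  proof -
    have "\<eta> t * \<zeta> t = \<eta> 0 * \<zeta> 0"
    proof (rule curve_deriv_zero_const[OF _ that])
      fix s :: real assume s: "s \<in> {0..1}"
      show "has_curve_deriv (\<lambda>t. \<eta> t * \<zeta> t) 0 s"
        using has_curve_deriv_mult[OF \<eta>(3)[OF s] \<zeta>(3)[OF s]] by (simp add: mult.assoc)
    qed
    then show ?thesis using \<eta>(1) \<zeta>(1) by simp
  qed
  \<comment> \<open>A one-sided inverse of a unit is two-sided, so \<open>S\<close> is the preimage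
    of the open set of units; it is also closed and contains \<open>0\<close>, hence is everything
    by connectedness.\<close>
  define S where "S = {t\<in>{0..1}. \<zeta> t * \<eta> t = 1}"
  have S_units: "S = {0..1} \<inter> \<eta> -` alg_units"
  proof (intro equalityI subsetI)
    fix t assume "t \<in> S"
    then show "t \<in> {0..1} \<inter> \<eta> -` alg_units"
      using \<eta>\<zeta>[of t] alg_unitsI[of "\<eta> t" "\<zeta> t"] by (simp add: S_def)
  next
    fix t assume t: "t \<in> {0..1} \<inter> \<eta> -` alg_units"
    then have u: "\<eta> t \<in> alg_units" and t': "t \<in> {0..1}" by auto
    have "\<zeta> t * \<eta> t = 1"
      using alg_inv_left[OF u] unfolding alg_inv_eqI[OF u \<eta>\<zeta>[OF t']] .
    then show "t \<in> S" using t' by (simp add: S_def)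
  qed
  have \<eta>_cont: "continuous_on {0..1} \<eta>" and \<zeta>_cont: "continuous_on {0..1} \<zeta>"
    by (intro lip_imp_continuous \<eta>(2) \<zeta>(2))+
  have "openin (top_of_set {0..1}) S"
    unfolding S_units by (rule continuous_openin_preimage_gen[OF \<eta>_cont open_units])
  moreover have "closedin (top_of_set {0..1}) S"
  proof -
    have "continuous_on {0..1} (\<lambda>t. \<zeta> t * \<eta> t)"
      using \<eta>_cont \<zeta>_cont unfolding continuous_on_def by (auto intro: tendsto_mult)
    from continuous_closedin_preimage_constant[OF this, of 1] show ?thesis by (simp add: S_def)
  qed
  moreover have "0 \<in> S" using \<eta>(1) \<zeta>(1) by (simp add: S_def)
  ultimately have "S = {0..1}"
    using connected_Icc[of "0::real" 1] unfolding connected_clopen by blast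
  then have "\<zeta> t * \<eta> t = 1" if "t \<in> {0..1}" for t using that unfolding S_def by blast
  then show ?thesis using \<eta> \<zeta> \<eta>\<zeta> by (intro exI[of _ "(\<eta>, \<zeta>)"]) simp
qed

definition evolution_pair :: "(real \<Rightarrow> 'a) \<Rightarrow> (real \<Rightarrow> 'a) \<times> (real \<Rightarrow> 'a)"
  where "evolution_pair \<gamma> = (SOME e. case e of (\<eta>, \<zeta>) \<Rightarrow> \<eta> 0 = 1 \<and> \<zeta> 0 = 1 \<and> lip \<eta> \<and> lip \<zeta> \<and>
    (\<forall>t\<in>{0..1}. has_curve_deriv \<eta> (\<eta> t * \<gamma> t) t \<and> has_curve_deriv \<zeta> (- (\<gamma> t * \<zeta> t)) t \<and>
      \<eta> t * \<zeta> t = 1 \<and> \<zeta> t * \<eta> t = 1))"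

definition Ev :: "(real \<Rightarrow> 'a) \<Rightarrow> real \<Rightarrow> 'a"
  where "Ev \<gamma> = fst (evolution_pair \<gamma>)"

definition Ev_inv :: "(real \<Rightarrow> 'a) \<Rightarrow> real \<Rightarrow> 'a"
  where "Ev_inv \<gamma> = snd (evolution_pair \<gamma>)"

lemma
  fixes \<gamma> :: "real \<Rightarrow> 'a"
  assumes "lip \<gamma>"
  shows Ev_0: "Ev \<gamma> 0 = 1" and Ev_inv_0: "Ev_inv \<gamma> 0 = 1" and lip_Ev: "lip (Ev \<gamma>)"
    and lip_Ev_inv: "lip (Ev_inv \<gamma>)"
    and Ev_deriv: "t \<in> {0..1} \<Longrightarrow> has_curve_deriv (Ev \<gamma>) (Ev \<gamma> t * \<gamma> t) t"
    and Ev_inv_deriv: "t \<in> {0..1} \<Longrightarrow> has_curve_deriv (Ev_inv \<gamma>) (- (\<gamma> t * Ev_inv \<gamma> t)) t"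
    and Ev_right_inv: "t \<in> {0..1} \<Longrightarrow> Ev \<gamma> t * Ev_inv \<gamma> t = 1"
    and Ev_left_inv: "t \<in> {0..1} \<Longrightarrow> Ev_inv \<gamma> t * Ev \<gamma> t = 1"
  using someI_ex[OF evolution_pair_exists[OF assms], folded evolution_pair_def]
  by (simp_all add: Ev_def Ev_inv_def case_prod_unfold)

section \<open>Uniqueness, the product formula and estimates near zero\<close>

text \<open>\<open>\<eta> * Ev_inv \<gamma>\<close> has derivative zero and starts at
  \<open>1\<close>; multiplying by \<open>Ev \<gamma>\<close> on the right gives the claim.\<close>

lemma Ev_unique:
  fixes \<gamma> \<eta> :: "real \<Rightarrow> 'a"
  assumes \<gamma>: "lip \<gamma>" and \<eta>: "\<eta> 0 = 1" "\<And>t. t \<in> {0..1} \<Longrightarrow> has_curve_deriv \<eta> (\<eta> t * \<gamma> t) t"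
    and t: "t \<in> {0..1}"
  shows "\<eta> t = Ev \<gamma> t"
proof -
  have "\<eta> t * Ev_inv \<gamma> t = \<eta> 0 * Ev_inv \<gamma> 0"
  proof (rule curve_deriv_zero_const[OF _ t])
    fix s :: real assume s: "s \<in> {0..1}"
    show "has_curve_deriv (\<lambda>t. \<eta> t * Ev_inv \<gamma> t) 0 s"
      using has_curve_deriv_mult[OF \<eta>(2)[OF s] Ev_inv_deriv[OF \<gamma> s]] by (simp add: mult.assoc)
  qed
  then have "\<eta> t * Ev_inv \<gamma> t * Ev \<gamma> t = Ev \<gamma> t" using \<eta>(1) Ev_inv_0[OF \<gamma>] by simp
  then show ?thesis by (simp add: mult.assoc Ev_left_inv[OF \<gamma> t])
qed

lemma Ev_inv_unique:
  fixes \<gamma> \<zeta> :: "real \<Rightarrow> 'a"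
  assumes \<gamma>: "lip \<gamma>" and \<zeta>: "\<zeta> 0 = 1" "\<And>t. t \<in> {0..1} \<Longrightarrow> has_curve_deriv \<zeta> (- (\<gamma> t * \<zeta> t)) t"
    and t: "t \<in> {0..1}"
  shows "\<zeta> t = Ev_inv \<gamma> t"
proof -
  have "Ev \<gamma> t * \<zeta> t = Ev \<gamma> 0 * \<zeta> 0"
  proof (rule curve_deriv_zero_const[OF _ t])
    fix s :: real assume s: "s \<in> {0..1}"
    show "has_curve_deriv (\<lambda>t. Ev \<gamma> t * \<zeta> t) 0 s"
      using has_curve_deriv_mult[OF Ev_deriv[OF \<gamma> s] \<zeta>(2)[OF s]] by (simp add: mult.assoc)
  qed
  then have "Ev_inv \<gamma> t * (Ev \<gamma> t * \<zeta> t) = Ev_inv \<gamma> t" using \<zeta>(1) Ev_0[OF \<gamma>] by simp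
  then show ?thesis by (simp add: mult.assoc[symmetric] Ev_left_inv[OF \<gamma> t])
qed

text \<open>\<open>w\<close> is chosen so that
  \<open>w * Ev \<gamma> = Ev \<gamma> * \<delta>\<close>. By this rule the product
  \<open>Ev w * Ev \<gamma>\<close> solves the equation for \<open>\<gamma> + \<delta>\<close>, and
  uniqueness identifies it.\<close>

lemma
  fixes \<gamma> \<delta> :: "real \<Rightarrow> 'a"
  assumes \<gamma>: "lip \<gamma>" and \<delta>: "lip \<delta>" and t: "t \<in> {0..1}"
  defines "w \<equiv> \<lambda>t. Ev \<gamma> t * \<delta> t * Ev_inv \<gamma> t"
  shows Ev_add: "Ev (\<lambda>t. \<gamma> t + \<delta> t) t = Ev w t * Ev \<gamma> t"
    and Ev_inv_add: "Ev_inv (\<lambda>t. \<gamma> t + \<delta> t) t = Ev_inv \<gamma> t * Ev_inv w t"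
proof -
  have w: "lip w" unfolding w_def by (intro lip_mult lip_Ev lip_Ev_inv \<gamma> \<delta>)
  have w1: "w s * Ev \<gamma> s = Ev \<gamma> s * \<delta> s" and w2: "Ev_inv \<gamma> s * w s = \<delta> s * Ev_inv \<gamma> s"
    if "s \<in> {0..1}" for s
    unfolding w_def using Ev_left_inv[OF \<gamma> that] by (simp add: mult.assoc)
      (simp add: mult.assoc[symmetric] Ev_left_inv[OF \<gamma> that])
  have "Ev w t * Ev \<gamma> t = Ev (\<lambda>t. \<gamma> t + \<delta> t) t"
  proof (rule Ev_unique[OF lip_add[OF \<gamma> \<delta>] _ _ t])
    show "Ev w 0 * Ev \<gamma> 0 = 1" by (simp add: Ev_0[OF w] Ev_0[OF \<gamma>])
    fix s :: real assume s: "s \<in> {0..1}"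
    have "Ev w s * w s * Ev \<gamma> s + Ev w s * (Ev \<gamma> s * \<gamma> s) = Ev w s * Ev \<gamma> s * (\<gamma> s + \<delta> s)"
      by (simp add: mult.assoc w1[OF s] distrib_left add.commute)
    then show "has_curve_deriv (\<lambda>t. Ev w t * Ev \<gamma> t) (Ev w s * Ev \<gamma> s * (\<gamma> s + \<delta> s)) s"
      using has_curve_deriv_mult[OF Ev_deriv[OF w s] Ev_deriv[OF \<gamma> s]] by simp
  qed
  then show "Ev (\<lambda>t. \<gamma> t + \<delta> t) t = Ev w t * Ev \<gamma> t" ..
  have "Ev_inv \<gamma> t * Ev_inv w t = Ev_inv (\<lambda>t. \<gamma> t + \<delta> t) t"
  proof (rule Ev_inv_unique[OF lip_add[OF \<gamma> \<delta>] _ _ t])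
    show "Ev_inv \<gamma> 0 * Ev_inv w 0 = 1" by (simp add: Ev_inv_0[OF w] Ev_inv_0[OF \<gamma>])
    fix s :: real assume s: "s \<in> {0..1}"
    have "Ev_inv \<gamma> s * (w s * Ev_inv w s) = \<delta> s * (Ev_inv \<gamma> s * Ev_inv w s)"
      by (simp only: mult.assoc[symmetric] w2[OF s])
    then have "- (\<gamma> s * Ev_inv \<gamma> s) * Ev_inv w s + Ev_inv \<gamma> s * - (w s * Ev_inv w s) =
        - ((\<gamma> s + \<delta> s) * (Ev_inv \<gamma> s * Ev_inv w s))"
      by (simp add: distrib_right mult.assoc)
    then show "has_curve_deriv (\<lambda>t. Ev_inv \<gamma> t * Ev_inv w t)
        (- ((\<gamma> s + \<delta> s) * (Ev_inv \<gamma> s * Ev_inv w s))) s"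
      using has_curve_deriv_mult[OF Ev_inv_deriv[OF \<gamma> s] Ev_inv_deriv[OF w s]] by simp
  qed
  then show "Ev_inv (\<lambda>t. \<gamma> t + \<delta> t) t = Ev_inv \<gamma> t * Ev_inv w t" ..
qed

text \<open>The first bound is \<open>gronwall_small\<close>. \<open>G\<close> is the part of
  \<open>F\<close> linear in \<open>w\<close>, and \<open>F - 1 - G\<close> has derivative
  \<open>\<phi> w (F - 1)\<close>: the first bound supplies one factor \<open>C\<close> and
  \<open>\<phi> w\<close> another.\<close>

lemma bilinear_ode_estimate:
  fixes F G w :: "real \<Rightarrow> 'a" and \<phi> :: "'a \<Rightarrow> 'a \<Rightarrow> 'a"
  assumes r: "cs r"
    and diff: "\<And>a x y. \<phi> a (x - y) = \<phi> a x - \<phi> a y" and \<phi>_le: "\<And>a x. r (\<phi> a x) \<le> r a * r x"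
    and le: "\<And>t. t \<in> {0..1} \<Longrightarrow> r (w t) \<le> C" and C: "C \<le> 1/2"
    and F: "F 0 = 1" "\<And>t. t \<in> {0..1} \<Longrightarrow> has_curve_deriv F (\<phi> (w t) (F t)) t"
    and G: "G 0 = 0" "\<And>t. t \<in> {0..1} \<Longrightarrow> has_curve_deriv G (\<phi> (w t) 1) t"
    and t: "t \<in> {0..1}"
  shows "r (F t - 1) \<le> 2 * C * r 1" "r (F t - 1 - G t) \<le> 2 * C * C * r 1"
proof -
  have C0: "0 \<le> C" using le[OF t] cs_nonneg[OF r, of "w t"] by linarith
  have \<phi>_w: "r (\<phi> (w s) x) \<le> C * r x" if "s \<in> {0..1}" for s x
    by (rule order_trans[OF \<phi>_le]) (intro mult_right_mono le that cs_nonneg[OF r])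
  have 1: "r (F s - 1) \<le> 2 * C * r 1" if "s \<in> {0..1}" for s
    using gronwall_small[OF r F(2) \<phi>_w C0 C that] by (simp add: F(1))
  show "r (F t - 1) \<le> 2 * C * r 1" by (rule 1[OF t])
  let ?K = "2 * C * C * r 1"
  have "r ((F t - 1 - G t) - (F 0 - 1 - G 0)) \<le> ?K * \<bar>t - 0\<bar>"
  proof (rule curve_mean_value_const[where f = "\<lambda>s. \<phi> (w s) (F s) - 0 - \<phi> (w s) 1", OF _ r _ _ t])
    fix s :: real assume s: "s \<in> {0..1}"
    show "has_curve_deriv (\<lambda>t. F t - 1 - G t) (\<phi> (w s) (F s) - 0 - \<phi> (w s) 1) s"
      by (intro has_curve_deriv_diff F(2) G(2) has_curve_deriv_const s)
    have "r (\<phi> (w s) (F s - 1)) \<le> C * (2 * C * r 1)"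
      by (rule order_trans[OF \<phi>_w[OF s] mult_left_mono[OF 1[OF s] C0]])
    then show "r (\<phi> (w s) (F s) - 0 - \<phi> (w s) 1) \<le> ?K" by (simp add: diff mult_ac)
  qed auto
  also have "\<dots> \<le> ?K * 1"
    using C0 cs_nonneg[OF r, of 1] t by (intro mult_left_mono) auto
  finally show "r (F t - 1 - G t) \<le> ?K" by (simp add: F(1) G(1))
qed

lemma
  fixes w :: "real \<Rightarrow> 'a"
  assumes w: "lip w" and r: "cs r" "submult r"
    and le: "\<And>t. t \<in> {0..1} \<Longrightarrow> r (w t) \<le> C" and C: "C \<le> 1/2" and t: "t \<in> {0..1}"
  shows Ev_first_order: "r (Ev w t - 1) \<le> 2 * C * r 1"
    and Ev_second_order: "r (Ev w t - 1 - primitive w t) \<le> 2 * C * C * r 1"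
proof -
  have G: "has_curve_deriv (primitive w) (1 * w t) t" if "t \<in> {0..1}" for t
    using primitive_deriv[OF mc w that] by simp
  note est = bilinear_ode_estimate[where \<phi> = "\<lambda>a x. x * a", OF r(1) left_diff_distrib
      submult_le_commute[OF r(2)] le C Ev_0[OF w] Ev_deriv[OF w] primitive_0[OF mc w] G t]
  show "r (Ev w t - 1) \<le> 2 * C * r 1" "r (Ev w t - 1 - primitive w t) \<le> 2 * C * C * r 1"
    by (rule est; assumption)+
qed

lemma
  fixes w :: "real \<Rightarrow> 'a"
  assumes w: "lip w" and r: "cs r" "submult r"
    and le: "\<And>t. t \<in> {0..1} \<Longrightarrow> r (w t) \<le> C" and C: "C \<le> 1/2" and t: "t \<in> {0..1}"
  shows Ev_inv_first_order: "r (Ev_inv w t - 1) \<le> 2 * C * r 1"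
    and Ev_inv_second_order: "r (Ev_inv w t - 1 - - primitive w t) \<le> 2 * C * C * r 1"
proof -
  have G0: "- primitive w 0 = 0" by (simp add: primitive_0[OF mc w])
  have G: "has_curve_deriv (\<lambda>t. - primitive w t) (- (w t * 1)) t" if "t \<in> {0..1}" for t
    using has_curve_deriv_scaleR[OF primitive_deriv[OF mc w that], of "- 1"] by simp
  have diff: "- (a * (x - y)) = - (a * x) - - (a * y)" for a x y :: 'a by (simp add: right_diff_distrib)
  note est = bilinear_ode_estimate[where \<phi> = "\<lambda>a x. - (a * x)" and G = "\<lambda>t. - primitive w t", OF r(1) diff
      submult_minus_le[OF r] le C Ev_inv_0[OF w] Ev_inv_deriv[OF w] G0 G t]
  show "r (Ev_inv w t - 1) \<le> 2 * C * r 1" "r (Ev_inv w t - 1 - - primitive w t) \<le> 2 * C * C * r 1"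
    by (rule est; assumption)+
qed

end

section \<open>Uniform limits of curves\<close>

definition ulim :: "('i \<Rightarrow> real \<Rightarrow> 'e::locally_convex_space) \<Rightarrow> (real \<Rightarrow> 'e) \<Rightarrow> 'i filter \<Rightarrow> bool"
  where "ulim g l F \<longleftrightarrow> (\<forall>p. cs p \<longrightarrow>
    (\<forall>e>0. eventually (\<lambda>i. \<forall>t\<in>{0..1}. p (g i t - l t) < e) F))"

lemma ulimI:
  assumes "\<And>p e. cs p \<Longrightarrow> e > 0 \<Longrightarrow> eventually (\<lambda>i. \<forall>t\<in>{0..1}. p (g i t - l t) < e) F"
  shows "ulim g l F"
  using assms unfolding ulim_def by blast

lemma ulimD:
  assumes "ulim g l F" "cs p" "e > 0"
  shows "eventually (\<lambda>i. \<forall>t\<in>{0..1}. p (g i t - l t) < e) F"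
  using assms unfolding ulim_def by blast

lemma ulim_const: "ulim (\<lambda>_. l) l F"
  by (rule ulimI) (simp add: cs_zero)

lemma ulim_time_independent:
  assumes "(g \<longlongrightarrow> l) F"
  shows "ulim (\<lambda>i t. g i) (\<lambda>t. l) F"
proof (rule ulimI)
  fix p :: "'b \<Rightarrow> real" and e :: real assume "cs p" "e > 0"
  from tendsto_seminormD[OF assms this] show "eventually (\<lambda>i. \<forall>t\<in>{0..1}. p (g i - l) < e) F"
    by eventually_elim simp
qed

lemma ulim_cong:
  assumes "ulim g l F" "eventually (\<lambda>i. \<forall>t\<in>{0..1}. g i t = h i t) F" "\<And>t. t \<in> {0..1} \<Longrightarrow> l t = m t"
  shows "ulim h m F"
proof (rule ulimI)
  fix p :: "'b \<Rightarrow> real" and e :: real assume "cs p" "e > 0"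
  from ulimD[OF assms(1) this] assms(2)
  show "eventually (\<lambda>i. \<forall>t\<in>{0..1}. p (h i t - m t) < e) F"
    by eventually_elim (use assms(3) in \<open>simp del: atLeastAtMost_iff\<close>)
qed

text \<open>Uniform convergence becomes an ordinary limit along the product with the principal
  filter of \<open>{0..1}\<close>, so the limit laws for sums and scalar multiples carry
  over.\<close>

lemma ulim_iff_tendsto:
  "ulim g l F \<longleftrightarrow> ((\<lambda>z. g (fst z) (snd z) - l (snd z)) \<longlongrightarrow> 0) (F \<times>\<^sub>F principal {0..1})"
proof -
  have ev: "eventually P (F \<times>\<^sub>F principal {0..1}) \<longleftrightarrow> eventually (\<lambda>i. \<forall>t\<in>{0..1}. P (i, t)) F" for P
  proof
    assume "eventually P (F \<times>\<^sub>F principal {0..1})"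
    then obtain Q R where "eventually Q F" "\<forall>t\<in>{0..1}. R t" "\<And>i t. Q i \<Longrightarrow> R t \<Longrightarrow> P (i, t)"
      unfolding eventually_prod_filter eventually_principal by blast
    then show "eventually (\<lambda>i. \<forall>t\<in>{0..1}. P (i, t)) F" by (auto elim: eventually_mono)
  next
    assume "eventually (\<lambda>i. \<forall>t\<in>{0..1}. P (i, t)) F"
    then show "eventually P (F \<times>\<^sub>F principal {0..1})"
      unfolding eventually_prod_filter eventually_principal
      by (intro exI[of _ "\<lambda>i. \<forall>t\<in>{0..1}. P (i, t)"] exI[of _ "\<lambda>t. t \<in> {0..1}"]) auto
  qed
  show ?thesis
  proof
    assume "ulim g l F"
    from ulimD[OF this] show "((\<lambda>z. g (fst z) (snd z) - l (snd z)) \<longlongrightarrow> 0) (F \<times>\<^sub>F principal {0..1})"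
      by (intro tendsto_seminormI) (simp add: ev)
  next
    assume "((\<lambda>z. g (fst z) (snd z) - l (snd z)) \<longlongrightarrow> 0) (F \<times>\<^sub>F principal {0..1})"
    from tendsto_seminormD[OF this] show "ulim g l F" by (intro ulimI) (simp add: ev)
  qed
qed

lemma ulim_add:
  assumes "ulim g l F" "ulim h m F"
  shows "ulim (\<lambda>i t. g i t + h i t) (\<lambda>t. l t + m t) F"
  using tendsto_add[OF assms[unfolded ulim_iff_tendsto]] by (simp add: ulim_iff_tendsto algebra_simps)

lemma ulim_scaleR: "ulim g l F \<Longrightarrow> ulim (\<lambda>i t. c *\<^sub>R g i t) (\<lambda>t. c *\<^sub>R l t) F"
  unfolding ulim_iff_tendsto by (drule tendsto_scaleR_lc[of _ _ _ c]) (simp add: scaleR_diff_right)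

lemma ulim_compose:
  assumes "ulim g l F" "filterlim h F G"
  shows "ulim (\<lambda>i. g (h i)) l G"
proof (rule ulimI)
  fix p :: "'b \<Rightarrow> real" and e :: real assume "cs p" "e > 0"
  from eventually_compose_filterlim[OF ulimD[OF assms(1) this] assms(2)]
  show "eventually (\<lambda>i. \<forall>t\<in>{0..1}. p (g (h i) t - l t) < e) G" .
qed

lemma ulim_pointwise:
  assumes "ulim g l F" "t \<in> {0..1}"
  shows "((\<lambda>i. g i t) \<longlongrightarrow> l t) F"
proof (rule tendsto_seminormI)
  fix p :: "'b \<Rightarrow> real" and e :: real assume "cs p" "e > 0"
  from ulimD[OF assms(1) this] show "eventually (\<lambda>i. p (g i t - l t) < e) F"
    by eventually_elim (use assms(2) in blast)
qed

lemma primitive_diff: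
  fixes f g :: "real \<Rightarrow> 'e::locally_convex_space"
  assumes mc: "mackey_complete TYPE('e)" and f: "lip f" and g: "lip g" and t: "t \<in> {0..1}"
  shows "primitive (\<lambda>t. f t - g t) t = primitive f t - primitive g t"
proof -
  have "primitive (\<lambda>t. f t - g t) t = (primitive f t - primitive g t) - (primitive f 0 - primitive g 0)"
    by (rule primitive_unique[OF mc lip_diff[OF f g] t])
      (intro has_curve_deriv_diff primitive_deriv[OF mc] f g)
  then show ?thesis by (simp add: primitive_0[OF mc] f g)
qed

lemma primitive_scaleR:
  fixes f :: "real \<Rightarrow> 'e::locally_convex_space"
  assumes mc: "mackey_complete TYPE('e)" and f: "lip f" and t: "t \<in> {0..1}"
  shows "primitive (\<lambda>t. c *\<^sub>R f t) t = c *\<^sub>R primitive f t"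
proof -
  have "primitive (\<lambda>t. c *\<^sub>R f t) t = c *\<^sub>R primitive f t - c *\<^sub>R primitive f 0"
    by (rule primitive_unique[OF mc lip_scaleR[OF f] t])
      (intro has_curve_deriv_scaleR primitive_deriv[OF mc] f)
  then show ?thesis by (simp add: primitive_0[OF mc] f)
qed

text \<open>Integration over an interval of length at most \<open>1\<close> does not increase
  uniform distances.\<close>

lemma ulim_primitive:
  fixes l :: "real \<Rightarrow> 'e::locally_convex_space"
  assumes mc: "mackey_complete TYPE('e)" and ul: "ulim g l F" and l: "lip l"
    and g: "eventually (\<lambda>i. lip (g i)) F"
  shows "ulim (\<lambda>i. primitive (g i)) (primitive l) F"
proof (rule ulimI)
  fix p :: "'e \<Rightarrow> real" and e :: real assume p: "cs p" and e: "e > 0"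
  have "e/2 > 0" using e by simp
  from ulimD[OF ul p this] g
  show "eventually (\<lambda>i. \<forall>t\<in>{0..1}. p (primitive (g i) t - primitive l t) < e) F"
  proof eventually_elim
    case (elim i)
    show ?case
    proof
      fix t :: real assume t: "t \<in> {0..1}"
      have "p (primitive (\<lambda>t. g i t - l t) t) \<le> e/2"
        by (rule primitive_bound[OF mc lip_diff[OF elim(2) l] p t]) (use elim(1) in \<open>auto intro: less_imp_le\<close>)
      then show "p (primitive (g i) t - primitive l t) < e"
        using e unfolding primitive_diff[OF mc elim(2) l t] by simp
    qed
  qed
qed

lemma (in dominating_seminorms) ulimI_dominating:
  assumes "\<And>r e. r \<in> P \<Longrightarrow> e > 0 \<Longrightarrow> eventually (\<lambda>i. \<forall>t\<in>{0..1}. r (g i t - l t) < e) F"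
  shows "ulim g l F"
proof (rule ulimI)
  fix p :: "'e \<Rightarrow> real" and e :: real assume p: "cs p" and e: "e > 0"
  obtain r where r: "r \<in> P" "\<And>x. p x \<le> r x" using dominating[OF p] by blast
  from assms[OF r(1) e] show "eventually (\<lambda>i. \<forall>t\<in>{0..1}. p (g i t - l t) < e) F"
    by eventually_elim (use r(2) le_less_trans in blast)
qed

context m_convex_inverse_algebra
begin

lemma ulim_mult:
  fixes l m :: "real \<Rightarrow> 'a"
  assumes g: "ulim g l F" and h: "ulim h m F" and l: "lip l" and m: "lip m"
  shows "ulim (\<lambda>i t. g i t * h i t) (\<lambda>t. l t * m t) F"
proof (rule ulimI_dominating)
  fix r :: "'a \<Rightarrow> real" and e :: real
  assume "r \<in> submult_seminorms" and e: "e > 0"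
  then have r: "cs r" "submult r" by auto
  obtain A where A: "A \<ge> 0" "\<And>t. t \<in> {0..1} \<Longrightarrow> r (l t) \<le> A"
    by (rule lip_boundedE[OF l r(1)]) (rule that)
  obtain B where B: "B \<ge> 0" "\<And>t. t \<in> {0..1} \<Longrightarrow> r (m t) \<le> B"
    by (rule lip_boundedE[OF m r(1)]) (rule that)
  \<comment> \<open>\<open>A\<close> and \<open>B + 1\<close> bound the two cofactors, the
    \<open>1\<close> because \<open>d \<le> 1\<close>; the denominator has a further
    \<open>1\<close> so that the final inequality is strict.\<close>
  define d where "d = min 1 (e / (A + B + 2))"
  have d: "d > 0" "d \<le> 1" using A(1) B(1) e by (simp_all add: d_def)
  have "d \<le> e / (A + B + 2)" by (simp add: d_def)
  then have "d * (A + B + 2) \<le> e" using A(1) B(1) by (simp add: pos_le_divide_eq)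
  then have de: "d * (A + B + 1) < e" using d(1) by (simp add: algebra_simps)
  from ulimD[OF g r(1) d(1)] ulimD[OF h r(1) d(1)]
  show "eventually (\<lambda>i. \<forall>t\<in>{0..1}. r (g i t * h i t - l t * m t) < e) F"
  proof eventually_elim
    case (elim i)
    show ?case
    proof
      fix t :: real assume t: "t \<in> {0..1}"
      have 1: "r (g i t - l t) \<le> d" and 2: "r (h i t - m t) \<le> d" using elim t by (auto intro: less_imp_le)
      have "r (h i t) \<le> r (h i t - m t) + r (m t)" using cs_add[OF r(1), of "h i t - m t" "m t"] by simp
      then have 3: "r (h i t) \<le> B + 1" using 2 d(2) B(2)[OF t] by linarith
      have "g i t * h i t - l t * m t = (g i t - l t) * h i t + l t * (h i t - m t)" by (simp add: algebra_simps)
      then have "r (g i t * h i t - l t * m t) \<le> r ((g i t - l t) * h i t) + r (l t * (h i t - m t))"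
        by (simp only: cs_add[OF r(1)])
      also have "r ((g i t - l t) * h i t) \<le> d * (B + 1)"
        by (rule order_trans[OF submult_le[OF r(2)]])
          (intro mult_mono 1 3 cs_nonneg[OF r(1)] less_imp_le[OF d(1)])
      also have "r (l t * (h i t - m t)) \<le> A * d"
        by (rule order_trans[OF submult_le[OF r(2)]])
          (intro mult_mono 2 A t cs_nonneg[OF r(1)])
      finally show "r (g i t * h i t - l t * m t) < e" using de by (simp add: algebra_simps)
    qed
  qed
qed

end

section \<open>Smoothness of maps generated by a differentially closed family\<close>

text \<open>The maps depend on a point \<open>x\<close>, directions \<open>y 0, y 1, \<dots>\<close> and a time \<open>t\<close>. In the end only the
  value at time \<open>1\<close> matters, but integration over \<open>t\<close> requires the whole curve. For the multiplication and
  inversion of the algebra the curves are constant.\<close>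

inductive_set generated ::
    "('e \<Rightarrow> (nat \<Rightarrow> 'e) \<Rightarrow> real \<Rightarrow> 'a) set \<Rightarrow>
      ('e \<Rightarrow> (nat \<Rightarrow> 'e) \<Rightarrow> real \<Rightarrow> 'a::{locally_convex_space, ring}) set"
  for B :: "('e \<Rightarrow> (nat \<Rightarrow> 'e) \<Rightarrow> real \<Rightarrow> 'a) set"
  where
    base: "c \<in> B \<Longrightarrow> c \<in> generated B"
  | const: "(\<lambda>x y t. a) \<in> generated B"
  | add: "c \<in> generated B \<Longrightarrow> d \<in> generated B \<Longrightarrow> (\<lambda>x y t. c x y t + d x y t) \<in> generated B"
  | scaleR: "c \<in> generated B \<Longrightarrow> (\<lambda>x y t. k *\<^sub>R c x y t) \<in> generated B"
  | mult: "c \<in> generated B \<Longrightarrow> d \<in> generated B \<Longrightarrow> (\<lambda>x y t. c x y t * d x y t) \<in> generated B"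
  | prim: "c \<in> generated B \<Longrightarrow> (\<lambda>x y. primitive (c x y)) \<in> generated B"

definition continuous_family ::
    "'e::topological_space set \<Rightarrow> ('e \<Rightarrow> (nat \<Rightarrow> 'e) \<Rightarrow> real \<Rightarrow> 'a::locally_convex_space) \<Rightarrow> bool"
  where "continuous_family U c \<longleftrightarrow>
    (\<forall>x\<in>U. \<forall>y. ulim (\<lambda>z. c (fst z) (snd z)) (c x y) (nhds (x, y)))"

text \<open>\<open>y\<close> stays fixed while \<open>x\<close> moves in direction
  \<open>y k\<close>, just as \<open>iter_dir_deriv\<close> passes from stage \<open>k\<close> to
  \<open>Suc k\<close>; \<open>c'\<close> may thus involve the new direction
  \<open>y k\<close>.\<close>

definition family_deriv ::
    "'e::locally_convex_space set \<Rightarrow> nat \<Rightarrow> ('e \<Rightarrow> (nat \<Rightarrow> 'e) \<Rightarrow> real \<Rightarrow> 'a::locally_convex_space) \<Rightarrow>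
      ('e \<Rightarrow> (nat \<Rightarrow> 'e) \<Rightarrow> real \<Rightarrow> 'a) \<Rightarrow> bool"
  where "family_deriv U k c c' \<longleftrightarrow>
    (\<forall>x\<in>U. \<forall>y. ulim (\<lambda>h t. (c (x + h *\<^sub>R y k) y t - c x y t) /\<^sub>R h) (c' x y) (at 0))"

lemma independent_family_deriv:
  assumes "\<And>x x' y t. c x y t = c x' y t"
  shows "\<exists>c'\<in>generated B. family_deriv U k c c'"
proof -
  have "family_deriv U k c (\<lambda>x y t. 0)"
    unfolding family_deriv_def by (intro ballI allI ulim_cong[OF ulim_const]) (use assms in auto)
  then show ?thesis using generated.const by blast
qed

lemma tendsto_line:
  fixes x v :: "'e::locally_convex_space"
  shows "((\<lambda>h::real. x + h *\<^sub>R v) \<longlongrightarrow> x) (at 0)"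
proof (rule iffD2[OF tendsto_iff_seminorms], intro allI impI)
  fix p :: "'e \<Rightarrow> real" assume p: "cs p"
  have "((\<lambda>h::real. \<bar>h\<bar> * p v) \<longlongrightarrow> 0) (at 0)"
    by (rule tendsto_eq_intros refl | simp)+
  then show "((\<lambda>h. p (x + h *\<^sub>R v - x)) \<longlongrightarrow> 0) (at 0)" by (simp add: cs_scaleR[OF p])
qed

text \<open>\<open>base_deriv\<close> asks derivatives of generators to be generated, not to be
  generators; with the product rule and differentiation under the integral this covers all
  orders.\<close>

locale differential_family = m_convex_inverse_algebra smul
  for smul :: "'k::real_or_complex_field \<Rightarrow>
      'a::{locally_convex_space, ring, topological_monoid_mult} \<Rightarrow> 'a" +
  fixes U :: "'e::locally_convex_space set" and B :: "('e \<Rightarrow> (nat \<Rightarrow> 'e) \<Rightarrow> real \<Rightarrow> 'a) set"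
  assumes open_U: "open U"
    and base_lip: "c \<in> B \<Longrightarrow> x \<in> U \<Longrightarrow> lip (c x y)"
    and base_continuous: "c \<in> B \<Longrightarrow> continuous_family U c"
    and base_deriv: "c \<in> B \<Longrightarrow> \<exists>c'\<in>generated B. family_deriv U k c c'"
begin

lemma generated_lip: "c \<in> generated B \<Longrightarrow> x \<in> U \<Longrightarrow> lip (c x y)"
  by (induction rule: generated.induct)
    (auto intro: base_lip lip_const lip_add lip_scaleR lip_mult lip_primitive[OF mc])

lemma eventually_near_in_U:
  assumes "x \<in> U"
  shows "eventually (\<lambda>z. fst z \<in> U) (nhds (x, y))"
    and "eventually (\<lambda>h::real. x + h *\<^sub>R v \<in> U) (at 0)"
proof -
  have "((\<lambda>z. fst z) \<longlongrightarrow> x) (nhds (x, y))"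
    using tendsto_fst[OF filterlim_ident, of "(x, y)"] by simp
  then show "eventually (\<lambda>z. fst z \<in> U) (nhds (x, y))"
    by (rule topological_tendstoD[OF _ open_U assms])
  show "eventually (\<lambda>h::real. x + h *\<^sub>R v \<in> U) (at 0)"
    by (rule topological_tendstoD[OF tendsto_line open_U assms])
qed

lemma generated_continuous: "c \<in> generated B \<Longrightarrow> continuous_family U c"
proof (induction rule: generated.induct)
  case (base c)
  then show ?case by (rule base_continuous)
next
  case (const a)
  show ?case by (simp add: continuous_family_def ulim_const)
next
  case (add c d)
  then show ?case unfolding continuous_family_def by (auto intro: ulim_add)
next
  case (scaleR c k)
  then show ?case unfolding continuous_family_def by (auto intro: ulim_scaleR)
next
  case (mult c d)
  then show ?case unfolding continuous_family_def by (auto intro: ulim_mult generated_lip)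
next
  case (prim c)
  show ?case
    unfolding continuous_family_def
  proof (intro ballI allI)
    fix x y assume x: "x \<in> U"
    show "ulim (\<lambda>z. primitive (c (fst z) (snd z))) (primitive (c x y)) (nhds (x, y))"
    proof (rule ulim_primitive[OF mc])
      show "ulim (\<lambda>z. c (fst z) (snd z)) (c x y) (nhds (x, y))"
        using prim.IH x unfolding continuous_family_def by blast
      show "lip (c x y)" by (rule generated_lip[OF prim.hyps x])
      show "eventually (\<lambda>z. lip (c (fst z) (snd z))) (nhds (x, y))"
        using eventually_near_in_U(1)[OF x]
        by eventually_elim (rule generated_lip[OF prim.hyps])
    qed
  qed
qed

lemma generated_continuous_line:
  assumes c: "c \<in> generated B" and x: "x \<in> U"
  shows "ulim (\<lambda>h::real. c (x + h *\<^sub>R v) y) (c x y) (at 0)"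
proof -
  have "((\<lambda>h::real. (x + h *\<^sub>R v, y)) \<longlongrightarrow> (x, y)) (at 0)"
    by (intro tendsto_Pair tendsto_line tendsto_const)
  moreover have "ulim (\<lambda>z. c (fst z) (snd z)) (c x y) (nhds (x, y))"
    using generated_continuous[OF c] x unfolding continuous_family_def by blast
  ultimately show ?thesis using ulim_compose by fastforce
qed

lemma generated_deriv: "c \<in> generated B \<Longrightarrow> \<exists>c'\<in>generated B. family_deriv U k c c'"
proof (induction rule: generated.induct)
  case (base c)
  then show ?case by (rule base_deriv)
next
  case (const a)
  show ?case by (rule independent_family_deriv) simp
next
  case (add c d)
  then obtain c' d' where c': "c' \<in> generated B" "family_deriv U k c c'"
    and d': "d' \<in> generated B" "family_deriv U k d d'" by blast
  have "family_deriv U k (\<lambda>x y t. c x y t + d x y t) (\<lambda>x y t. c' x y t + d' x y t)"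
    unfolding family_deriv_def
  proof (intro ballI allI)
    fix x y assume x: "x \<in> U"
    have "ulim (\<lambda>h t. (c (x + h *\<^sub>R y k) y t - c x y t) /\<^sub>R h + (d (x + h *\<^sub>R y k) y t - d x y t) /\<^sub>R h)
        (\<lambda>t. c' x y t + d' x y t) (at 0)"
      using c'(2) d'(2) x unfolding family_deriv_def by (intro ulim_add) auto
    then show "ulim (\<lambda>h t. (c (x + h *\<^sub>R y k) y t + d (x + h *\<^sub>R y k) y t - (c x y t + d x y t)) /\<^sub>R h)
        (\<lambda>t. c' x y t + d' x y t) (at 0)"
      by (rule ulim_cong) (auto simp: algebra_simps)
  qed
  then show ?case using generated.add[OF c'(1) d'(1)] by blast
next
  case (scaleR c a)
  then obtain c' where c': "c' \<in> generated B" "family_deriv U k c c'" by blast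
  have "family_deriv U k (\<lambda>x y t. a *\<^sub>R c x y t) (\<lambda>x y t. a *\<^sub>R c' x y t)"
    unfolding family_deriv_def
  proof (intro ballI allI)
    fix x y assume x: "x \<in> U"
    have "ulim (\<lambda>h t. a *\<^sub>R ((c (x + h *\<^sub>R y k) y t - c x y t) /\<^sub>R h)) (\<lambda>t. a *\<^sub>R c' x y t) (at 0)"
      using c'(2) x unfolding family_deriv_def by (intro ulim_scaleR) auto
    then show "ulim (\<lambda>h t. (a *\<^sub>R c (x + h *\<^sub>R y k) y t - a *\<^sub>R c x y t) /\<^sub>R h) (\<lambda>t. a *\<^sub>R c' x y t) (at 0)"
      by (rule ulim_cong) (auto simp: scaleR_diff_right mult.commute)
  qed
  then show ?case using generated.scaleR[OF c'(1)] by blast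
next
  case (mult c d)
  then obtain c' d' where c': "c' \<in> generated B" "family_deriv U k c c'"
    and d': "d' \<in> generated B" "family_deriv U k d d'" by blast
  have "family_deriv U k (\<lambda>x y t. c x y t * d x y t) (\<lambda>x y t. c' x y t * d x y t + c x y t * d' x y t)"
    unfolding family_deriv_def
  proof (intro ballI allI)
    fix x y assume x: "x \<in> U"
    \<comment> \<open>In the first term \<open>d\<close> is taken at the moved point, hence the need
      for continuity along lines.\<close>
    have "ulim (\<lambda>h t. (c (x + h *\<^sub>R y k) y t - c x y t) /\<^sub>R h * d (x + h *\<^sub>R y k) y t +
          c x y t * ((d (x + h *\<^sub>R y k) y t - d x y t) /\<^sub>R h))
        (\<lambda>t. c' x y t * d x y t + c x y t * d' x y t) (at 0)"
      using c'(2) d'(2) x unfolding family_deriv_def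
      by (intro ulim_add ulim_mult generated_continuous_line mult.hyps ulim_const generated_lip c'(1) d'(1)) auto
    then show "ulim (\<lambda>h t. (c (x + h *\<^sub>R y k) y t * d (x + h *\<^sub>R y k) y t - c x y t * d x y t) /\<^sub>R h)
        (\<lambda>t. c' x y t * d x y t + c x y t * d' x y t) (at 0)"
    proof (rule ulim_cong)
      have "u /\<^sub>R h * w + z * (v /\<^sub>R h) = (u * w + z * v) /\<^sub>R h" for u v w z :: 'a and h
        by (simp only: mult_scaleR_left mult_scaleR_right scaleR_right_distrib)
      then show "eventually (\<lambda>h. \<forall>t\<in>{0..1}. (c (x + h *\<^sub>R y k) y t - c x y t) /\<^sub>R h * d (x + h *\<^sub>R y k) y t +
          c x y t * ((d (x + h *\<^sub>R y k) y t - d x y t) /\<^sub>R h) =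
          (c (x + h *\<^sub>R y k) y t * d (x + h *\<^sub>R y k) y t - c x y t * d x y t) /\<^sub>R h) (at 0)"
        by (simp only:) (simp add: left_diff_distrib right_diff_distrib)
    qed simp
  qed
  then show ?case
    using generated.add[OF generated.mult[OF c'(1) mult.hyps(2)] generated.mult[OF mult.hyps(1) d'(1)]] by blast
next
  case (prim c)
  then obtain c' where c': "c' \<in> generated B" "family_deriv U k c c'" by blast
  have "family_deriv U k (\<lambda>x y. primitive (c x y)) (\<lambda>x y. primitive (c' x y))"
    unfolding family_deriv_def
  proof (intro ballI allI)
    fix x y assume x: "x \<in> U"
    note lipc = generated_lip[OF prim.hyps]
    \<comment> \<open>Linearity of \<open>primitive\<close> is available for Lipschitz curves, hence
      once the moved point lies in \<open>U\<close>.\<close>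
    have ev: "eventually (\<lambda>h. lip (\<lambda>t. (c (x + h *\<^sub>R y k) y t - c x y t) /\<^sub>R h)) (at 0)"
      using eventually_near_in_U(2)[OF x] by eventually_elim (intro lip_scaleR lip_diff lipc x)
    have "ulim (\<lambda>h. primitive (\<lambda>t. (c (x + h *\<^sub>R y k) y t - c x y t) /\<^sub>R h)) (primitive (c' x y)) (at 0)"
      using c'(2) x unfolding family_deriv_def
      by (intro ulim_primitive[OF mc _ generated_lip[OF c'(1) x] ev]) auto
    then show "ulim (\<lambda>h t. (primitive (c (x + h *\<^sub>R y k) y) t - primitive (c x y) t) /\<^sub>R h) (primitive (c' x y)) (at 0)"
    proof (rule ulim_cong)
      show "eventually (\<lambda>h. \<forall>t\<in>{0..1}. primitive (\<lambda>t. (c (x + h *\<^sub>R y k) y t - c x y t) /\<^sub>R h) t =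
          (primitive (c (x + h *\<^sub>R y k) y) t - primitive (c x y) t) /\<^sub>R h) (at 0)"
      proof (rule eventually_mono[OF eventually_near_in_U(2)[OF x, of "y k"]])
        fix h :: real assume elim: "x + h *\<^sub>R y k \<in> U"
        show "\<forall>t\<in>{0..1}. primitive (\<lambda>t. (c (x + h *\<^sub>R y k) y t - c x y t) /\<^sub>R h) t =
          (primitive (c (x + h *\<^sub>R y k) y) t - primitive (c x y) t) /\<^sub>R h"
        proof
          fix t :: real assume t: "t \<in> {0..1}"
          show "primitive (\<lambda>t. (c (x + h *\<^sub>R y k) y t - c x y t) /\<^sub>R h) t =
              (primitive (c (x + h *\<^sub>R y k) y) t - primitive (c x y) t) /\<^sub>R h"
            unfolding primitive_scaleR[OF mc lip_diff[OF lipc[OF elim] lipc[OF x]] t]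
              primitive_diff[OF mc lipc[OF elim] lipc[OF x] t] ..
        qed
      qed
    qed simp
  qed
  then show ?case using generated.prim[OF c'(1)] by blast
qed

text \<open>\<open>Cr_on\<close> takes the directions from a finite product, whose points are
  functions that are \<open>undefined\<close> from \<open>k\<close> on, while
  \<open>continuous_family\<close> uses the full product over all indices. The identity is
  continuous between them because the additional coordinates are constant.\<close>

lemma continuous_map_extensional_directions:
  "continuous_map (prod_topology (top_of_set U) (product_topology (\<lambda>_. euclidean :: 'e topology) {..<k}))
    (top_of_set (U \<times> UNIV)) (\<lambda>z. z :: 'e \<times> (nat \<Rightarrow> 'e))"
proof -
  let ?T = "prod_topology (top_of_set U) (product_topology (\<lambda>_. euclidean :: 'e topology) {..<k})"
  have fst: "continuous_map ?T (top_of_set U) (fst :: 'e \<times> (nat \<Rightarrow> 'e) \<Rightarrow> 'e)"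
    by (rule continuous_map_fst)
  have "continuous_map ?T euclidean (\<lambda>z. snd z i)" for i
  proof (cases "i < k")
    case True
    then show ?thesis
      using continuous_map_compose[OF continuous_map_snd[of "top_of_set U" "product_topology (\<lambda>_. euclidean) {..<k}"]
          continuous_map_product_projection[of i "{..<k}" "\<lambda>_. euclidean"]]
      by (simp add: comp_def)
  next
    case False
    have "continuous_map ?T euclidean (\<lambda>z. undefined :: 'e)" by simp
    then show ?thesis
      by (rule continuous_map_eq) (use False in \<open>auto simp: PiE_def extensional_def\<close>)
  qed
  then have "continuous_map ?T (product_topology (\<lambda>_. euclidean) UNIV) snd"
    unfolding continuous_map_componentwise_UNIV by blast
  then have "continuous_map ?T euclidean (snd :: 'e \<times> (nat \<Rightarrow> 'e) \<Rightarrow> _)"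
    unfolding euclidean_product_topology .
  moreover have "continuous_map ?T euclidean (fst :: 'e \<times> (nat \<Rightarrow> 'e) \<Rightarrow> 'e)"
    using fst by (simp add: continuous_map_in_subtopology)
  ultimately have "continuous_map ?T (prod_topology euclidean euclidean) (\<lambda>z. z)"
    unfolding continuous_map_pairwise by (simp add: comp_def)
  then show ?thesis
    unfolding prod_topology_euclidean by (rule continuous_map_into_subtopology) auto
qed

text \<open>By induction every iterated directional derivative is the value at time \<open>1\<close>
  of a generated family, so the next derivative exists and joint continuity holds at each
  order.\<close>

theorem generated_smooth:
  assumes c: "c \<in> generated B" and f: "\<And>x y. x \<in> U \<Longrightarrow> f x = c x y 1"
  shows "smooth_map_on U f"
proof -
  have deriv: "has_dir_deriv g (c' x y 1) (y k) x"
    if "family_deriv U k c c'" "x \<in> U" "\<And>z. z \<in> U \<Longrightarrow> g z = c z y 1" for g c c' k x y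
  proof -
    have "ulim (\<lambda>h t. (c (x + h *\<^sub>R y k) y t - c x y t) /\<^sub>R h) (c' x y) (at 0)"
      using that(1,2) unfolding family_deriv_def by blast
    then have "((\<lambda>h. (c (x + h *\<^sub>R y k) y 1 - c x y 1) /\<^sub>R h) \<longlongrightarrow> c' x y 1) (at 0)"
      by (rule ulim_pointwise) simp
    moreover have "eventually (\<lambda>h. (c (x + h *\<^sub>R y k) y 1 - c x y 1) /\<^sub>R h =
        (g (x + h *\<^sub>R y k) - g x) /\<^sub>R h) (at 0)"
      using eventually_near_in_U(2)[OF that(2), of "y k"] by eventually_elim (simp add: that(2,3))
    ultimately show ?thesis unfolding has_dir_deriv_def by (rule Lim_transform_eventually)
  qed
  have iter: "\<exists>c\<in>generated B. \<forall>x\<in>U. \<forall>y. iter_dir_deriv k f x y = c x y 1" for k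
  proof (induction k)
    case 0
    then show ?case using c f by auto
  next
    case (Suc k)
    then obtain c where c: "c \<in> generated B" "\<And>x y. x \<in> U \<Longrightarrow> iter_dir_deriv k f x y = c x y 1" by blast
    obtain c' where c': "c' \<in> generated B" "family_deriv U k c c'" using generated_deriv[OF c(1)] by blast
    have "iter_dir_deriv (Suc k) f x y = c' x y 1" if "x \<in> U" for x y
      using deriv[OF c'(2) that c(2), of y]
      unfolding iter_dir_deriv.simps dir_deriv_def has_dir_deriv_def by (intro tendsto_Lim) auto
    then show ?case using c'(1) by blast
  qed
  have cont: "continuous_on (U \<times> UNIV) (\<lambda>(x, y). iter_dir_deriv k f x y)" for k
  proof -
    obtain c where c: "c \<in> generated B" "\<And>x y. x \<in> U \<Longrightarrow> iter_dir_deriv k f x y = c x y 1"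
      using iter by blast
    have "continuous_on (U \<times> UNIV) (\<lambda>z. c (fst z) (snd z) 1)"
      unfolding continuous_on_def
    proof
      fix z :: "'e \<times> (nat \<Rightarrow> 'e)" assume z: "z \<in> U \<times> UNIV"
      then have "ulim (\<lambda>z. c (fst z) (snd z)) (c (fst z) (snd z)) (nhds z)"
        using generated_continuous[OF c(1)] unfolding continuous_family_def by auto
      then have "((\<lambda>z. c (fst z) (snd z) 1) \<longlongrightarrow> c (fst z) (snd z) 1) (nhds z)"
        by (rule ulim_pointwise) simp
      then show "((\<lambda>z. c (fst z) (snd z) 1) \<longlongrightarrow> c (fst z) (snd z) 1) (at z within U \<times> UNIV)"
        by (rule tendsto_mono[OF at_within_le_nhds])
    qed
    then show ?thesis by (rule continuous_on_eq) (auto simp: c(2))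
  qed
  show ?thesis
    unfolding Cr_on_def
  proof (intro conjI allI impI ballI)
    show "open U" by (rule open_U)
    have "continuous_on U (\<lambda>x. (x, \<lambda>_. 0) :: 'e \<times> (nat \<Rightarrow> 'e))"
      by (intro continuous_on_Pair continuous_on_id continuous_on_const)
    from continuous_on_compose2[OF cont[of 0] this] show "continuous_on U f" by auto
  next
    fix k x y assume x: "x \<in> U"
    obtain c where c: "c \<in> generated B" "\<And>x y. x \<in> U \<Longrightarrow> iter_dir_deriv k f x y = c x y 1"
      using iter by blast
    obtain c' where c': "c' \<in> generated B" "family_deriv U k c c'" using generated_deriv[OF c(1)] by blast
    show "\<exists>l. has_dir_deriv (\<lambda>z. iter_dir_deriv k f z y) l (y k) x"
      using deriv[OF c'(2) x c(2), of y] by blast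
  next
    fix k
    show "continuous_map (prod_topology (top_of_set U) (product_topology (\<lambda>_. euclidean) {..<k}))
        euclidean (\<lambda>(x, y). iter_dir_deriv k f x y)"
      using continuous_map_compose[OF continuous_map_extensional_directions, of euclidean "\<lambda>(x, y). iter_dir_deriv k f x y" k]
        cont[of k] by (simp add: comp_def)
  qed
qed

end

section \<open>The unit group and its evolution map\<close>

lemma tendsto_direction: "((\<lambda>z. snd z k) \<longlongrightarrow> y k) (nhds (x, y))"
  for y :: "nat \<Rightarrow> 'e::topological_space"
proof -
  have "continuous_on UNIV (\<lambda>y::nat \<Rightarrow> 'e. y k)" by simp
  moreover have "((\<lambda>z. snd z) \<longlongrightarrow> y) (nhds (x, y))"
    using tendsto_snd[OF filterlim_ident, of "(x, y)"] by simp
  ultimately show ?thesis by (rule continuous_on_tendsto_compose) auto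
qed

lemma tendsto_point: "((\<lambda>z. fst z) \<longlongrightarrow> x) (nhds (x, y))"
  using tendsto_fst[OF filterlim_ident, of "(x, y)"] by simp

text \<open>The \<open>C^1\<close> seminorm is a Lipschitz constant, which brings smooth curves into
  the scope of Mackey completeness.\<close>

lemma curve_at_lip: "lip (curve_at \<gamma>)"
proof (rule has_curve_deriv_imp_lip)
  show "has_curve_deriv (curve_at \<gamma>) (curve_deriv (curve_at \<gamma>) t) t" if "t \<in> {0..1}" for t
    using Cr_curve_has_curve_deriv[OF Cr_curve_curve_at that, of 0] by simp
  fix p :: "'a \<Rightarrow> real" assume p: "cs p"
  have "p (curve_deriv (curve_at \<gamma>) t) \<le> Ck_seminorm 1 p \<gamma>" if "t \<in> {0..1}" for t
    using Ck_seminorm_upper[OF p, of 1 1 t \<gamma>] that by simp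
  then show "\<exists>K. \<forall>t\<in>{0..1}. p (curve_deriv (curve_at \<gamma>) t) \<le> K" by blast
qed

text \<open>The seminorms of order \<open>0\<close> of the smooth topology already give uniform
  convergence, in terms of which continuity of the evolution is stated.\<close>

lemma ulim_curve_at:
  fixes \<gamma> :: "'e::locally_convex_space smooth_curve"
  assumes "(g \<longlongrightarrow> \<gamma>) F"
  shows "ulim (\<lambda>i. curve_at (g i)) (curve_at \<gamma>) F"
proof (rule ulimI)
  fix p :: "'e \<Rightarrow> real" and e :: real assume p: "cs p" and e: "e > 0"
  from eventually_compose_filterlim[OF Ck_ball_nhds[OF p e, of 0 \<gamma>] assms]
  show "eventually (\<lambda>i. \<forall>t\<in>{0..1}. p (curve_at (g i) t - curve_at \<gamma> t) < e) F"
  proof eventually_elim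
    case (elim i)
    show ?case
    proof
      fix t :: real assume "t \<in> {0..1}"
      then have "p (curve_at (g i - \<gamma>) t) \<le> Ck_seminorm 0 p (g i - \<gamma>)"
        using Ck_seminorm_upper[OF p, of 0 0 t "g i - \<gamma>"] by simp
      then show "p (curve_at (g i) t - curve_at \<gamma> t) < e"
        using elim by (simp add: minus_smooth_curve.rep_eq)
    qed
  qed
qed

section \<open>Smoothness of multiplication and inversion\<close>

context m_convex_inverse_algebra
begin

lemma alg_inv_tendsto:
  assumes "x \<in> (alg_units :: 'a set)"
  shows "(alg_inv \<longlongrightarrow> alg_inv x) (nhds x)"
proof -
  have "(alg_inv \<longlongrightarrow> alg_inv x) (at x within alg_units)"
    using continuous_inverse assms unfolding continuous_on_def by blast
  then have "(alg_inv \<longlongrightarrow> alg_inv x) (at x)"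
    using at_within_open[OF assms open_units] by simp
  then show ?thesis by (simp add: tendsto_at_iff_tendsto_nhds)
qed

text \<open>The derivative of inversion in direction \<open>v\<close> is
  \<open>- x^-1 v x^-1\<close>, again an expression in inversion and directions, so these generate a
  family closed under differentiation.\<close>

lemma smooth_inverse:
  assumes "\<And>x. x \<in> alg_units \<Longrightarrow> f x = alg_inv x"
  shows "smooth_map_on (alg_units :: 'a set) f"
proof -
  define B :: "('a \<Rightarrow> (nat \<Rightarrow> 'a) \<Rightarrow> real \<Rightarrow> 'a) set"
    where "B = insert (\<lambda>x y t. alg_inv x) (range (\<lambda>k x y t. y k))"
  have dir: "(\<lambda>x y t. y k) \<in> generated B" for k by (rule generated.base) (simp add: B_def)
  have inv: "(\<lambda>x y t. alg_inv x) \<in> generated B" by (rule generated.base) (simp add: B_def)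
  interpret differential_family smul "alg_units :: 'a set" B
  proof
    show "open (alg_units :: 'a set)" by (rule open_units)
    show "lip (c x y)" if "c \<in> B" for c x y using that by (auto simp: B_def lip_const)
    show "continuous_family alg_units c" if "c \<in> B" for c
      using that unfolding B_def continuous_family_def
      by (auto intro!: ulim_time_independent tendsto_direction filterlim_compose[OF alg_inv_tendsto tendsto_point])
    fix c and k assume "c \<in> B"
    then consider "c = (\<lambda>x y t. alg_inv x)" | j where "c = (\<lambda>x y t. y j)" by (auto simp: B_def)
    then show "\<exists>c'\<in>generated B. family_deriv alg_units k c c'"
    proof cases
      case 1
      have "family_deriv alg_units k c (\<lambda>x y t. (- 1) *\<^sub>R (alg_inv x * y k * alg_inv x))"
        unfolding family_deriv_def 1
      proof (intro ballI allI ulim_time_independent)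
        fix x :: 'a and y :: "nat \<Rightarrow> 'a" assume x: "x \<in> alg_units"
        have line: "((\<lambda>h. alg_inv (x + h *\<^sub>R y k)) \<longlongrightarrow> alg_inv x) (at 0)"
          by (rule filterlim_compose[OF alg_inv_tendsto[OF x] tendsto_line])
        have "((\<lambda>h. (- 1) *\<^sub>R (alg_inv (x + h *\<^sub>R y k) * y k * alg_inv x)) \<longlongrightarrow>
            (- 1) *\<^sub>R (alg_inv x * y k * alg_inv x)) (at 0)"
          by (intro tendsto_scaleR_lc tendsto_mult line tendsto_const)
        moreover have "eventually (\<lambda>h. (- 1) *\<^sub>R (alg_inv (x + h *\<^sub>R y k) * y k * alg_inv x) =
            (alg_inv (x + h *\<^sub>R y k) - alg_inv x) /\<^sub>R h) (at 0)"
        proof -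
          have ev1: "eventually (\<lambda>h::real. x + h *\<^sub>R y k \<in> alg_units) (at 0)"
            by (rule topological_tendstoD[OF tendsto_line open_units x])
          have ev2: "eventually (\<lambda>h::real. h \<noteq> 0) (at 0)" by (simp add: eventually_at_filter)
          show ?thesis
            using ev1 ev2
          proof eventually_elim
            case (elim h)
            let ?z = "x + h *\<^sub>R y k"
            \<comment> \<open>The resolvent identity for \<open>?z\<close> and \<open>x\<close>,
              with the noncommuting factors kept in order.\<close>
            have "alg_inv ?z - alg_inv x = alg_inv ?z * (x * alg_inv x) - (alg_inv ?z * ?z) * alg_inv x"
              by (simp add: alg_inv_left[OF elim(1)] alg_inv_right[OF x])
            also have "\<dots> = alg_inv ?z * (x - ?z) * alg_inv x"
              by (simp only: right_diff_distrib left_diff_distrib mult.assoc)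
            also have "x - ?z = (- h) *\<^sub>R y k" by simp
            also have "alg_inv ?z * ((- h) *\<^sub>R y k) * alg_inv x = (- h) *\<^sub>R (alg_inv ?z * y k * alg_inv x)"
              by (simp only: mult_scaleR_left mult_scaleR_right)
            finally show ?case using elim(2) by simp
          qed
        qed
        ultimately show "((\<lambda>h. (alg_inv (x + h *\<^sub>R y k) - alg_inv x) /\<^sub>R h) \<longlongrightarrow>
            (- 1) *\<^sub>R (alg_inv x * y k * alg_inv x)) (at 0)"
          by (rule Lim_transform_eventually)
      qed
      moreover have "(\<lambda>x y t. (- 1) *\<^sub>R (alg_inv x * y k * alg_inv x)) \<in> generated B"
        by (rule generated.scaleR[OF generated.mult[OF generated.mult[OF inv dir] inv]])
      ultimately show ?thesis by blast
    next
      case 2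
      show ?thesis by (rule independent_family_deriv) (simp add: 2)
    qed
  qed
  show ?thesis by (rule generated_smooth[OF inv]) (rule assms)
qed

text \<open>The projections are linear, so their derivatives are coordinates of the direction; with
  all of these as generators, multiplication is a product in the generated family.\<close>

lemma smooth_mult: "smooth_map_on ((alg_units :: 'a set) \<times> (alg_units :: 'a set)) (\<lambda>(x, y). x * y)"
proof -
  define B :: "('a \<times> 'a \<Rightarrow> (nat \<Rightarrow> 'a \<times> 'a) \<Rightarrow> real \<Rightarrow> 'a) set"
    where "B = {\<lambda>x y t. fst x, \<lambda>x y t. snd x} \<union> range (\<lambda>k x y t. fst (y k)) \<union> range (\<lambda>k x y t. snd (y k))"
  have gen: "(\<lambda>x y t. fst x) \<in> generated B" "(\<lambda>x y t. snd x) \<in> generated B"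
    "(\<lambda>x y t. fst (y k)) \<in> generated B" "(\<lambda>x y t. snd (y k)) \<in> generated B" for k
    by (rule generated.base, simp add: B_def)+
  interpret differential_family smul "(alg_units :: 'a set) \<times> (alg_units :: 'a set)" B
  proof
    show "open ((alg_units :: 'a set) \<times> (alg_units :: 'a set))" by (intro open_Times open_units)
    show "lip (c x y)" if "c \<in> B" for c x y using that by (auto simp: B_def lip_const)
    show "continuous_family (alg_units \<times> alg_units) c" if "c \<in> B" for c
      using that unfolding B_def continuous_family_def
      by (auto intro!: ulim_time_independent tendsto_fst tendsto_snd tendsto_direction
          tendsto_eq_rhs[OF tendsto_fst[OF tendsto_point]] tendsto_eq_rhs[OF tendsto_snd[OF tendsto_point]])
    fix c and k assume "c \<in> B"
    then consider "c = (\<lambda>x y t. fst x)" | "c = (\<lambda>x y t. snd x)"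
      | j where "c = (\<lambda>x y t. fst (y j))" | j where "c = (\<lambda>x y t. snd (y j))" by (auto simp: B_def)
    then show "\<exists>c'\<in>generated B. family_deriv (alg_units \<times> alg_units) k c c'"
    proof cases
      case 1
      have "family_deriv (alg_units \<times> alg_units) k c (\<lambda>x y t. fst (y k))"
        unfolding family_deriv_def 1
        by (intro ballI allI ulim_cong[OF ulim_const]) (auto simp: eventually_at_filter)
      then show ?thesis using gen(3) by blast
    next
      case 2
      have "family_deriv (alg_units \<times> alg_units) k c (\<lambda>x y t. snd (y k))"
        unfolding family_deriv_def 2
        by (intro ballI allI ulim_cong[OF ulim_const]) (auto simp: eventually_at_filter)
      then show ?thesis using gen(4) by blast
    next
      case 3
      show ?thesis by (rule independent_family_deriv) (simp add: 3)
    next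
      case 4
      show ?thesis by (rule independent_family_deriv) (simp add: 4)
    qed
  qed
  show ?thesis by (rule generated_smooth[OF generated.mult[OF gen(1,2)]]) auto
qed

lemma lie_group_units: "lie_group (unit_group :: 'a monoid)"
proof -
  note M = monoid_mult_monoid[where 'a = 'a]
  have carrier: "carrier (unit_group :: 'a monoid) = alg_units" by (simp add: units_of_def)
  have mult: "x \<otimes>\<^bsub>unit_group\<^esub> y = x * y" for x y :: 'a by (simp add: units_of_def mult_monoid_def)
  show ?thesis
    unfolding lie_group_def carrier mult
  proof (intro conjI smooth_mult open_units smooth_inverse)
    show "group (unit_group :: 'a monoid)" by (rule monoid.units_group[OF M])
    show "inv\<^bsub>unit_group\<^esub> x = alg_inv x" if "x \<in> alg_units" for x :: 'a
      by (rule monoid.units_of_inv[OF M that])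
  qed
qed

section \<open>Continuity and differentiability of the evolution\<close>

lemma Ev_tendsto_one:
  fixes w :: "'i \<Rightarrow> real \<Rightarrow> 'a"
  assumes w: "\<And>i. lip (w i)" and lim: "ulim w (\<lambda>_. 0) F"
  shows "ulim (\<lambda>i. Ev (w i)) (\<lambda>_. 1) F" "ulim (\<lambda>i. Ev_inv (w i)) (\<lambda>_. 1) F"
proof -
  have *: "eventually (\<lambda>i. \<forall>t\<in>{0..1}. r (Ev (w i) t - 1) < e \<and> r (Ev_inv (w i) t - 1) < e) F"
    if r: "cs r" "submult r" and e: "e > 0" for r :: "'a \<Rightarrow> real" and e
  proof -
    \<comment> \<open>\<open>1/2\<close> is the range in which \<open>Ev_first_order\<close>
      applies; the \<open>1\<close> in the denominator covers \<open>r 1 = 0\<close> and makes the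
      bound strict.\<close>
    define C where "C = min (1/2) (e / (2 * r 1 + 1))"
    have r1: "0 \<le> r 1" by (rule cs_nonneg[OF r(1)])
    have C: "C > 0" using e r1 by (simp add: C_def)
    have C2: "C \<le> 1/2" unfolding C_def by (rule min.cobounded1)
    have "C \<le> e / (2 * r 1 + 1)" by (simp add: C_def)
    then have "C * (2 * r 1 + 1) \<le> e" using r1 by (simp add: pos_le_divide_eq)
    then have Ce: "2 * C * r 1 < e" using C by (simp add: algebra_simps)
    from ulimD[OF lim r(1) C] show ?thesis
    proof eventually_elim
      case (elim i)
      then have le: "r (w i t) \<le> C" if "t \<in> {0..1}" for t using that by (auto intro: less_imp_le)
      show ?case
        by (intro ballI conjI le_less_trans[OF Ev_first_order[OF w r le C2] Ce]
            le_less_trans[OF Ev_inv_first_order[OF w r le C2] Ce])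
    qed
  qed
  show "ulim (\<lambda>i. Ev (w i)) (\<lambda>_. 1) F" "ulim (\<lambda>i. Ev_inv (w i)) (\<lambda>_. 1) F"
    by (rule ulimI_dominating, rule eventually_mono[OF *], auto)+
qed

lemma Ev_continuous:
  fixes \<gamma> :: "real \<Rightarrow> 'a" and g :: "'i \<Rightarrow> real \<Rightarrow> 'a"
  assumes \<gamma>: "lip \<gamma>" and g: "\<And>i. lip (g i)" and lim: "ulim g \<gamma> F"
  shows "ulim (\<lambda>i. Ev (g i)) (Ev \<gamma>) F" "ulim (\<lambda>i. Ev_inv (g i)) (Ev_inv \<gamma>) F"
proof -
  define w where "w i t = Ev \<gamma> t * (g i t - \<gamma> t) * Ev_inv \<gamma> t" for i t
  have w: "lip (w i)" for i
    unfolding w_def by (intro lip_mult lip_Ev lip_Ev_inv lip_diff \<gamma> g)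
  have "ulim (\<lambda>i t. g i t + - 1 *\<^sub>R \<gamma> t) (\<lambda>t. \<gamma> t + - 1 *\<^sub>R \<gamma> t) F"
    by (intro ulim_add lim ulim_const)
  then have d: "ulim (\<lambda>i t. g i t - \<gamma> t) (\<lambda>_. 0) F" by simp
  have "ulim w (\<lambda>t. Ev \<gamma> t * 0 * Ev_inv \<gamma> t) F"
    unfolding w_def by (intro ulim_mult ulim_const d lip_mult lip_Ev lip_Ev_inv lip_const \<gamma>)
  then have "ulim w (\<lambda>_. 0) F" by simp
  note lim1 = Ev_tendsto_one[OF w this]
  have eq: "Ev (g i) t = Ev (w i) t * Ev \<gamma> t" "Ev_inv (g i) t = Ev_inv \<gamma> t * Ev_inv (w i) t"
    if "t \<in> {0..1}" for i t
    using Ev_add[OF \<gamma> lip_diff[OF g[of i] \<gamma>] that] Ev_inv_add[OF \<gamma> lip_diff[OF g[of i] \<gamma>] that]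
    by (simp_all add: w_def[abs_def])
  have "ulim (\<lambda>i t. Ev (w i) t * Ev \<gamma> t) (\<lambda>t. 1 * Ev \<gamma> t) F"
    by (intro ulim_mult lim1 ulim_const lip_const lip_Ev \<gamma>)
  then show "ulim (\<lambda>i. Ev (g i)) (Ev \<gamma>) F"
    by (rule ulim_cong) (auto simp: eq)
  have "ulim (\<lambda>i t. Ev_inv \<gamma> t * Ev_inv (w i) t) (\<lambda>t. Ev_inv \<gamma> t * 1) F"
    by (intro ulim_mult lim1 ulim_const lip_const lip_Ev_inv \<gamma>)
  then show "ulim (\<lambda>i. Ev_inv (g i)) (Ev_inv \<gamma>) F"
    by (rule ulim_cong) (auto simp: eq)
qed

text \<open>With \<open>C = \<bar>h\<bar> * M\<close> the second-order estimate has an error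
  quadratic in \<open>h\<close>, of which a linear one remains after division by
  \<open>h\<close>.\<close>

lemma Ev_differentiable_at_zero:
  fixes w :: "real \<Rightarrow> 'a"
  assumes w: "lip w"
  shows "ulim (\<lambda>h t. (Ev (\<lambda>s. h *\<^sub>R w s) t - 1) /\<^sub>R h) (primitive w) (at 0)"
    and "ulim (\<lambda>h t. (Ev_inv (\<lambda>s. h *\<^sub>R w s) t - 1) /\<^sub>R h) (\<lambda>t. - primitive w t) (at 0)"
proof -
  have *: "eventually (\<lambda>h. \<forall>t\<in>{0..1}. r ((Ev (\<lambda>s. h *\<^sub>R w s) t - 1) /\<^sub>R h - primitive w t) < e \<and>
      r ((Ev_inv (\<lambda>s. h *\<^sub>R w s) t - 1) /\<^sub>R h - - primitive w t) < e) (at (0::real))"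
    if r: "cs r" "submult r" and e: "e > 0" for r :: "'a \<Rightarrow> real" and e
  proof -
    obtain M where M: "M \<ge> 0" "\<And>t. t \<in> {0..1} \<Longrightarrow> r (w t) \<le> M"
      by (rule lip_boundedE[OF w r(1)]) (rule that)
    have "((\<lambda>h::real. \<bar>h\<bar> * M) \<longlongrightarrow> 0) (at 0)"
      by (rule tendsto_eq_intros refl | simp)+
    then have "eventually (\<lambda>h::real. \<bar>h\<bar> * M < 1/2) (at 0)"
      by (rule order_tendstoD(2)) simp
    moreover have "((\<lambda>h::real. 2 * \<bar>h\<bar> * M * M * r 1) \<longlongrightarrow> 0) (at 0)"
      by (rule tendsto_eq_intros refl | simp)+
    then have "eventually (\<lambda>h::real. 2 * \<bar>h\<bar> * M * M * r 1 < e) (at 0)"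
      by (rule order_tendstoD(2)[OF _ e])
    moreover have "eventually (\<lambda>h::real. h \<noteq> 0) (at 0)" by (simp add: eventually_at_filter)
    ultimately show ?thesis
    proof eventually_elim
      case (elim h)
      have le: "r (h *\<^sub>R w t) \<le> \<bar>h\<bar> * M" if "t \<in> {0..1}" for t
        by (simp add: cs_scaleR[OF r(1)] mult_left_mono M(2)[OF that])
      have C: "\<bar>h\<bar> * M \<le> 1/2" using elim by simp
      show ?case
      proof
        fix t :: real assume t: "t \<in> {0..1}"
        note second = Ev_second_order[OF lip_scaleR[OF w] r le C t] Ev_inv_second_order[OF lip_scaleR[OF w] r le C t]
        have scale: "r (x /\<^sub>R h - v) < e" if "r (x - h *\<^sub>R v) \<le> 2 * (\<bar>h\<bar> * M) * (\<bar>h\<bar> * M) * r 1" for x v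
        proof -
          have "\<bar>h\<bar> * r (x /\<^sub>R h - v) = r (x - h *\<^sub>R v)"
            unfolding diff_quotient_scaleR[OF elim(3)] by (simp add: cs_scaleR[OF r(1)])
          also have "\<dots> \<le> \<bar>h\<bar> * (2 * \<bar>h\<bar> * M * M * r 1)" using that by (simp add: mult_ac)
          also have "\<dots> < \<bar>h\<bar> * e" using elim by (intro mult_strict_left_mono) auto
          finally show ?thesis using elim(3) by simp
        qed
        show "r ((Ev (\<lambda>s. h *\<^sub>R w s) t - 1) /\<^sub>R h - primitive w t) < e \<and>
            r ((Ev_inv (\<lambda>s. h *\<^sub>R w s) t - 1) /\<^sub>R h - - primitive w t) < e"
          by (intro conjI scale) (use second in \<open>simp_all add: primitive_scaleR[OF mc w t]\<close>)
      qed
    qed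
  qed
  show "ulim (\<lambda>h t. (Ev (\<lambda>s. h *\<^sub>R w s) t - 1) /\<^sub>R h) (primitive w) (at 0)"
    "ulim (\<lambda>h t. (Ev_inv (\<lambda>s. h *\<^sub>R w s) t - 1) /\<^sub>R h) (\<lambda>t. - primitive w t) (at 0)"
    by (rule ulimI_dominating, rule eventually_mono[OF *], auto)+
qed

text \<open>Conjugation is linear, so the increment \<open>h v\<close> becomes \<open>h w\<close>,
  and the difference quotient at \<open>\<gamma>\<close> is the one at \<open>0\<close> times the
  fixed factor \<open>Ev \<gamma>\<close> on the right, or \<open>Ev_inv \<gamma>\<close> on the
  left. \<open>P\<close> integrates the conjugated direction.\<close>

lemma Ev_differentiable:
  fixes \<gamma> v :: "real \<Rightarrow> 'a"
  assumes \<gamma>: "lip \<gamma>" and v: "lip v"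
  defines "P \<equiv> primitive (\<lambda>s. Ev \<gamma> s * v s * Ev_inv \<gamma> s)"
  shows "ulim (\<lambda>h t. (Ev (\<lambda>s. \<gamma> s + h *\<^sub>R v s) t - Ev \<gamma> t) /\<^sub>R h) (\<lambda>t. P t * Ev \<gamma> t) (at 0)"
    and "ulim (\<lambda>h t. (Ev_inv (\<lambda>s. \<gamma> s + h *\<^sub>R v s) t - Ev_inv \<gamma> t) /\<^sub>R h)
      (\<lambda>t. (- 1) *\<^sub>R (Ev_inv \<gamma> t * P t)) (at 0)"
proof -
  define w where "w = (\<lambda>s. Ev \<gamma> s * v s * Ev_inv \<gamma> s)"
  have w: "lip w" unfolding w_def by (intro lip_mult lip_Ev lip_Ev_inv \<gamma> v)
  have P: "P = primitive w" by (simp add: P_def w_def)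
  have lipP: "lip P" unfolding P by (rule lip_primitive[OF mc w])
  have eq: "Ev (\<lambda>s. \<gamma> s + h *\<^sub>R v s) t = Ev (\<lambda>s. h *\<^sub>R w s) t * Ev \<gamma> t"
    "Ev_inv (\<lambda>s. \<gamma> s + h *\<^sub>R v s) t = Ev_inv \<gamma> t * Ev_inv (\<lambda>s. h *\<^sub>R w s) t" if "t \<in> {0..1}" for t h
    using Ev_add[OF \<gamma> lip_scaleR[OF v, of h] that] Ev_inv_add[OF \<gamma> lip_scaleR[OF v, of h] that]
    by (simp_all add: w_def mult_scaleR_left mult_scaleR_right)
  have "ulim (\<lambda>h t. (Ev (\<lambda>s. h *\<^sub>R w s) t - 1) /\<^sub>R h * Ev \<gamma> t) (\<lambda>t. primitive w t * Ev \<gamma> t) (at 0)"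
    by (intro ulim_mult Ev_differentiable_at_zero w ulim_const lip_primitive[OF mc] lip_Ev \<gamma>)
  then show "ulim (\<lambda>h t. (Ev (\<lambda>s. \<gamma> s + h *\<^sub>R v s) t - Ev \<gamma> t) /\<^sub>R h) (\<lambda>t. P t * Ev \<gamma> t) (at 0)"
    by (rule ulim_cong) (auto simp: eq P mult_scaleR_left left_diff_distrib)
  have "ulim (\<lambda>h t. Ev_inv \<gamma> t * ((Ev_inv (\<lambda>s. h *\<^sub>R w s) t - 1) /\<^sub>R h)) (\<lambda>t. Ev_inv \<gamma> t * - primitive w t) (at 0)"
    by (intro ulim_mult Ev_differentiable_at_zero w ulim_const lip_minus lip_primitive[OF mc] lip_Ev_inv \<gamma>)
  then show "ulim (\<lambda>h t. (Ev_inv (\<lambda>s. \<gamma> s + h *\<^sub>R v s) t - Ev_inv \<gamma> t) /\<^sub>R h)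
      (\<lambda>t. (- 1) *\<^sub>R (Ev_inv \<gamma> t * P t)) (at 0)"
    by (rule ulim_cong) (auto simp: eq P mult_scaleR_right right_diff_distrib)
qed

lemma smooth_evolution:
  fixes f :: "'a smooth_curve \<Rightarrow> 'a"
  assumes f: "\<And>\<gamma>. f \<gamma> = Ev (curve_at \<gamma>) 1"
  shows "smooth_map_on UNIV f"
proof -
  \<comment> \<open>\<open>Ev_inv\<close> is a generator because the derivative of \<open>Ev\<close>
    contains it; its own derivative again involves only \<open>Ev\<close>, \<open>Ev_inv\<close> and
    the direction.\<close>
  define B :: "('a smooth_curve \<Rightarrow> (nat \<Rightarrow> 'a smooth_curve) \<Rightarrow> real \<Rightarrow> 'a) set"
    where "B = {\<lambda>x y. Ev (curve_at x), \<lambda>x y. Ev_inv (curve_at x)} \<union> range (\<lambda>k x y. curve_at (y k))"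
  have gen: "(\<lambda>x y t. Ev (curve_at x) t) \<in> generated B" "(\<lambda>x y t. Ev_inv (curve_at x) t) \<in> generated B"
    "(\<lambda>x y t. curve_at (y k) t) \<in> generated B" for k
    by (rule generated.base, simp add: B_def)+
  let ?P = "\<lambda>k x y. primitive (\<lambda>t. Ev (curve_at x) t * curve_at (y k) t * Ev_inv (curve_at x) t)"
  have genP: "?P k \<in> generated B" for k by (intro generated.prim generated.mult gen)
  have line: "curve_at (x + h *\<^sub>R v) = (\<lambda>s. curve_at x s + h *\<^sub>R curve_at v s)"
    for x v :: "'a smooth_curve" and h
    by (simp add: plus_smooth_curve.rep_eq scaleR_smooth_curve.rep_eq)
  interpret differential_family smul UNIV B
  proof
    show "open (UNIV :: 'a smooth_curve set)" by simp
    show "lip (c x y)" if "c \<in> B" for c x y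
      using that by (auto simp: B_def lip_Ev lip_Ev_inv curve_at_lip)
    show "continuous_family UNIV c" if "c \<in> B" for c
      using that unfolding B_def continuous_family_def
      by (auto intro!: Ev_continuous curve_at_lip ulim_curve_at tendsto_point tendsto_direction)
    fix c and k assume "c \<in> B"
    then consider "c = (\<lambda>x y. Ev (curve_at x))" | "c = (\<lambda>x y. Ev_inv (curve_at x))"
      | j where "c = (\<lambda>x y. curve_at (y j))" by (auto simp: B_def)
    then show "\<exists>c'\<in>generated B. family_deriv UNIV k c c'"
    proof cases
      case 1
      have "family_deriv UNIV k c (\<lambda>x y t. ?P k x y t * Ev (curve_at x) t)"
        unfolding family_deriv_def 1 line
        by (intro ballI allI Ev_differentiable curve_at_lip)
      then show ?thesis using generated.mult[OF genP gen(1)] by blast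
    next
      case 2
      have "family_deriv UNIV k c (\<lambda>x y t. (- 1) *\<^sub>R (Ev_inv (curve_at x) t * ?P k x y t))"
        unfolding family_deriv_def 2 line
        by (intro ballI allI Ev_differentiable curve_at_lip)
      then show ?thesis using generated.scaleR[OF generated.mult[OF gen(2) genP]] by blast
    next
      case 3
      show ?thesis by (rule independent_family_deriv) (simp add: 3)
    qed
  qed
  show ?thesis by (rule generated_smooth[OF gen(1)]) (rule f)
qed

section \<open>Regularity of the unit group\<close>

lemma is_evolution_Ev:
  fixes \<gamma> :: "real \<Rightarrow> 'a"
  assumes \<gamma>: "lip \<gamma>"
  shows "is_evolution unit_group \<gamma> (Ev \<gamma>)"
proof -
  have deriv: "curve_deriv (Ev \<gamma>) t = Ev \<gamma> t * \<gamma> t" if "t \<in> {0..1}" for t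
    by (rule curve_deriv_eqI[OF that Ev_deriv[OF \<gamma> that]])
  have "continuous_on {0..1} (\<lambda>t. Ev \<gamma> t * \<gamma> t)"
    by (intro lip_imp_continuous lip_mult lip_Ev \<gamma>)
  then have cont1: "continuous_on {0..1} (curve_deriv (Ev \<gamma>))"
    by (rule continuous_on_eq) (simp add: deriv del: atLeastAtMost_iff)
  have cont0: "continuous_on {0..1} (Ev \<gamma>)" by (intro lip_imp_continuous lip_Ev \<gamma>)
  have "Cr_curve 1 (Ev \<gamma>)"
    unfolding Cr_curve_def
  proof (intro conjI allI impI ballI)
    fix j and t :: real assume "enat (Suc j) \<le> 1" and t: "t \<in> {0..1}"
    then have "j = 0" by (simp add: one_enat_def)
    then show "\<exists>v. has_curve_deriv ((curve_deriv ^^ j) (Ev \<gamma>)) v t" using Ev_deriv[OF \<gamma> t] by auto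
  next
    fix j assume "enat j \<le> 1"
    then have "j = 0 \<or> j = 1" by (auto simp: one_enat_def)
    then show "continuous_on {0..1} ((curve_deriv ^^ j) (Ev \<gamma>))" using cont0 cont1 by auto
  qed
  moreover have "Ev \<gamma> t \<in> carrier unit_group" if "t \<in> {0..1}" for t
    using alg_unitsI[OF Ev_right_inv[OF \<gamma> that] Ev_left_inv[OF \<gamma> that]] by (simp add: units_of_def)
  ultimately show ?thesis
    unfolding is_evolution_def left_translate_unit_group
    by (simp add: deriv Ev_0[OF \<gamma>] units_of_def mult_monoid_def del: atLeastAtMost_iff)
qed

lemma is_evolution_unique:
  fixes \<gamma> :: "real \<Rightarrow> 'a"
  assumes \<gamma>: "lip \<gamma>" and \<eta>: "is_evolution unit_group \<gamma> \<eta>" and t: "t \<in> {0..1}"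
  shows "\<eta> t = Ev \<gamma> t"
proof (rule Ev_unique[OF \<gamma> _ _ t])
  show "\<eta> 0 = 1" using \<eta> by (simp add: is_evolution_def units_of_def mult_monoid_def)
  fix s :: real assume s: "s \<in> {0..1}"
  have "\<exists>v. has_curve_deriv ((curve_deriv ^^ 0) \<eta>) v s"
    using \<eta> s unfolding is_evolution_def Cr_curve_def by (metis One_nat_def one_enat_def order_refl)
  then obtain v where v: "has_curve_deriv \<eta> v s" by auto
  have "v = \<eta> s * \<gamma> s"
    using curve_deriv_eqI[OF s v] \<eta> s unfolding is_evolution_def left_translate_unit_group by auto
  then show "has_curve_deriv \<eta> (\<eta> s * \<gamma> s) s" using v by simp
qed

text \<open>\<open>evolution\<close> is defined by choice; uniqueness identifies its value at time
  \<open>1\<close> with that of \<open>Ev\<close>, to which \<open>smooth_evolution\<close>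
  applies.\<close>

theorem regular_unit_group: "regular_lie_group (unit_group :: 'a monoid)"
  unfolding regular_lie_group_def
proof (intro conjI allI lie_group_units smooth_evolution)
  fix \<gamma> :: "'a smooth_curve"
  show ex: "\<exists>\<eta>. is_evolution unit_group (curve_at \<gamma>) \<eta>"
    using is_evolution_Ev[OF curve_at_lip] by blast
  have "is_evolution unit_group (curve_at \<gamma>) (evolution unit_group (curve_at \<gamma>))"
    unfolding evolution_def by (rule someI_ex[OF ex])
  then show "evol unit_group \<gamma> = Ev (curve_at \<gamma>) 1"
    unfolding evol_def by (rule is_evolution_unique[OF curve_at_lip]) simp
qed

end

theorem mainTheorem2:
  fixes smul :: "'k::real_or_complex_field \<Rightarrow>
      'a::{locally_convex_space, ring, topological_monoid_mult} \<Rightarrow> 'a"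
  assumes "continuous_inverse_algebra smul"
    and "mackey_complete TYPE('a)"
    and "(\<forall>x y :: 'a. x * y = y * x) \<or> locally_m_convex smul"
  shows "regular_lie_group (unit_group :: 'a monoid)"
proof -
  interpret continuous_inverse_algebra smul by (rule assms(1))
  interpret m_convex_inverse_algebra smul
  proof
    show "mackey_complete TYPE('a)" by (rule assms(2))
    fix p :: "'a \<Rightarrow> real" assume "cs p"
    then show "\<exists>r. cs r \<and> submult r \<and> (\<forall>x. p x \<le> r x)"
      using assms(3) commutative_dominating locally_m_convex_dominating by blast
  qed
  show ?thesis by (rule regular_unit_group)
qed

end
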